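(* Let $X$ be a separable real Banach space and let $Y$ be a closed linear subspace of $X$. Suppose that there is a Choquet simplex $S$ such that $A(S)$ is infinite-dimensional and the quotient space $X/Y$ contains a linear subspace linearly isometric to $A(S)$. Then $Y^{\perp}$ (identified with $(X/Y)^*$) fails the $\sigma(Y^{\perp},X/Y)$-FPP, and $X^*$ fails the $\sigma(X^*,X)$-FPP.
   Context: All Banach spaces are real. For a Banach space $Z$, $\sigma(Z^*,Z)$ denotes the weak$^*$ topology on $Z^*$ induced by $Z$. A mapping $T\colon C\to C$ on a subset $C$ of $Z^*$ is nonexpansive if $\|T(x)-T(y)\|\le\|x-y\|$ for all $x,y\in C$. The space $Z^*$ has the $\sigma(Z^*,Z)$-FPP (weak$^*$ fixed point property) if for every nonempty, convex, $\sigma(Z^*,Z)$-compact subset $C$ of $Z^*$, every nonexpansive mapping $T\colon C\to C$ has a fixed point; otherwise it fails it. Here $Y^{\perp}=\{x^*\in X^*: x^*(y)=0 \text{ for all } y\in Y\}$, which is canonically isometric to $(X/Y)^*$; via this identification $\sigma(Y^{\perp},X/Y)$ is the weak$^*$ topology on $Y^\perp$ as the dual of $X/Y$. For a Choquet simplex $S$ (a compact convex subset of a Hausdorff locally convex space in which every point is represented by a unique maximal probability measure), $A(S)$ denotes the Banach space of all real continuous affine functions on $S$ with the supremum norm. *)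

theory Defs
  imports "HOL-Analysis.Analysis" "HOL-Probability.Probability_Measure"
begin

section \<open>The weak* fixed point property\<close>

definition nonexpansive_on :: "'b::real_normed_vector set \<Rightarrow> ('b \<Rightarrow> 'b) \<Rightarrow> bool" where
  "nonexpansive_on C T \<longleftrightarrow> (\<forall>x\<in>C. \<forall>y\<in>C. norm (T x - T y) \<le> norm (x - y))"

text \<open>
  The topology \<open>\<tau>\<close> is meant to be a weak* topology on a dual space; its underlying set may be a
  proper subspace of the ambient type. Note that \<^term>\<open>compactin \<tau> C\<close> includes
  \<^term>\<open>C \<subseteq> topspace \<tau>\<close>.
\<close>
definition has_FPP :: "'b::real_normed_vector topology \<Rightarrow> bool" where
  "has_FPP \<tau> \<longleftrightarrow>
    (\<forall>C. C \<noteq> {} \<longrightarrow> convex C \<longrightarrow> compactin \<tau> C \<longrightarrow>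
      (\<forall>T. T \<in> C \<rightarrow> C \<longrightarrow> nonexpansive_on C T \<longrightarrow> (\<exists>x\<in>C. T x = x)))"

text \<open>
  The dual of \<open>'a\<close> is the type of bounded linear functionals with the operator norm. For
  real-valued operators, the strong operator topology of the library is the topology of pointwise
  convergence, i.e. the weak* topology.
\<close>
abbreviation weak_star :: "('a::real_normed_vector \<Rightarrow>\<^sub>L real) topology" where
  "weak_star \<equiv> strong_operator_topology"


section \<open>Quotient spaces and annihilators\<close>

text \<open>The elements of the quotient by the subspace \<open>Y\<close> are the cosets of \<open>Y\<close>, as sets.\<close>
definition quotient_space :: "'a::real_normed_vector set \<Rightarrow> 'a set set" where
  "quotient_space Y = range (\<lambda>x. {x + y |y. y \<in> Y})"

definition quotient_add :: "'a::real_normed_vector set \<Rightarrow> 'a set \<Rightarrow> 'a set" where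
  "quotient_add p q = {x + x' |x x'. x \<in> p \<and> x' \<in> q}"

text \<open>Adding \<open>Y\<close> again matters only for \<open>c = 0\<close>, where the result has to be the coset \<open>Y\<close>.\<close>
definition quotient_scale :: "'a::real_normed_vector set \<Rightarrow> real \<Rightarrow> 'a set \<Rightarrow> 'a set" where
  "quotient_scale Y c q = {c *\<^sub>R x + y |x y. x \<in> q \<and> y \<in> Y}"

definition quotient_norm :: "'a::real_normed_vector set \<Rightarrow> real" where
  "quotient_norm q = (INF x\<in>q. norm x)"

definition quotient_subspace :: "'a::real_normed_vector set \<Rightarrow> 'a set set \<Rightarrow> bool" where
  "quotient_subspace Y V \<longleftrightarrow>
    V \<subseteq> quotient_space Y \<and> Y \<in> V \<and>
    (\<forall>p\<in>V. \<forall>q\<in>V. quotient_add p q \<in> V) \<and>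
    (\<forall>c. \<forall>q\<in>V. quotient_scale Y c q \<in> V)"

definition annihilator :: "'a::real_normed_vector set \<Rightarrow> ('a \<Rightarrow>\<^sub>L real) set" where
  "annihilator Y = {f. \<forall>y\<in>Y. blinfun_apply f y = 0}"

text \<open>
  The functional on the quotient induced by an element \<open>f\<close> of the annihilator: \<open>f\<close> is constant on
  each coset.
\<close>
definition coset_eval :: "('a::real_normed_vector \<Rightarrow>\<^sub>L real) \<Rightarrow> 'a set \<Rightarrow> real" where
  "coset_eval f q = the_elem (blinfun_apply f ` q)"

text \<open>
  The weak* topology on the annihilator of \<open>Y\<close> as the dual of the quotient by \<open>Y\<close>: the coarsest
  topology for which evaluation at every element of the quotient is continuous.
\<close>
definition annihilator_weak_star ::
    "'a::real_normed_vector set \<Rightarrow> ('a \<Rightarrow>\<^sub>L real) topology" where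
  "annihilator_weak_star Y =
    pullback_topology (annihilator Y) (\<lambda>f. restrict (coset_eval f) (quotient_space Y))
      (product_topology (\<lambda>_. euclideanreal) (quotient_space Y))"


section \<open>Choquet simplices\<close>

text \<open>
  Hausdorff locally convex real topological vector spaces. The convexity of \<open>V\<close> is written out
  because the constant \<open>convex\<close> is not available in a class specification.
\<close>
class hausdorff_lcs = real_vector + topological_ab_group_add + t2_space +
  assumes tendsto_scaleR_Pair_lcs:
    "LIM p (nhds c \<times>\<^sub>F nhds x). fst p *\<^sub>R snd p :> nhds (c *\<^sub>R x)"
  and locally_convex_0:
    "open U \<Longrightarrow> 0 \<in> U \<Longrightarrow> \<exists>V. open V \<and> 0 \<in> V \<and> V \<subseteq> U \<and>
      (\<forall>x\<in>V. \<forall>y\<in>V. \<forall>u\<ge>0. \<forall>v\<ge>0. u + v = 1 \<longrightarrow> u *\<^sub>R x + v *\<^sub>R y \<in> V)"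

text \<open>
  Regular Borel probability measures on a compact set. As \<open>S\<close> need not be metrizable, regularity
  is not automatic.
\<close>
definition regular_prob :: "'s::t2_space set \<Rightarrow> 's measure \<Rightarrow> bool" where
  "regular_prob S \<mu> \<longleftrightarrow>
    prob_space \<mu> \<and> sets \<mu> = sets (restrict_space borel S) \<and>
    (\<forall>B\<in>sets \<mu>. emeasure \<mu> B = (SUP K\<in>{K. compact K \<and> K \<subseteq> B}. emeasure \<mu> K))"

definition represents :: "'s::hausdorff_lcs measure \<Rightarrow> 's \<Rightarrow> bool" where
  "represents \<mu> x \<longleftrightarrow>
    (\<forall>\<phi>::'s \<Rightarrow> real. linear \<phi> \<longrightarrow> continuous_on UNIV \<phi> \<longrightarrow> (\<integral>s. \<phi> s \<partial>\<mu>) = \<phi> x)"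

text \<open>The Choquet order on probability measures on \<open>S\<close>.\<close>
definition choquet_le :: "'s::hausdorff_lcs set \<Rightarrow> 's measure \<Rightarrow> 's measure \<Rightarrow> bool" where
  "choquet_le S \<mu> \<nu> \<longleftrightarrow>
    (\<forall>f. continuous_on S f \<longrightarrow> convex_on S f \<longrightarrow> (\<integral>s. f s \<partial>\<mu>) \<le> (\<integral>s. f s \<partial>\<nu>))"

definition maximal_prob :: "'s::hausdorff_lcs set \<Rightarrow> 's measure \<Rightarrow> bool" where
  "maximal_prob S \<mu> \<longleftrightarrow>
    regular_prob S \<mu> \<and> (\<forall>\<nu>. regular_prob S \<nu> \<longrightarrow> choquet_le S \<mu> \<nu> \<longrightarrow> \<nu> = \<mu>)"

definition choquet_simplex :: "'s::hausdorff_lcs set \<Rightarrow> bool" where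
  "choquet_simplex S \<longleftrightarrow>
    compact S \<and> convex S \<and> (\<forall>x\<in>S. \<exists>!\<mu>. maximal_prob S \<mu> \<and> represents \<mu> x)"


section \<open>The space of continuous affine functions\<close>

text \<open>
  Functions on \<open>S\<close> are represented by their extension by zero, so that equality is equality on
  \<open>S\<close> and the vector space operations are pointwise.
\<close>
definition affine_functions :: "'s::hausdorff_lcs set \<Rightarrow> ('s \<Rightarrow> real) set" where
  "affine_functions S =
    {f. continuous_on S f \<and>
        (\<forall>x\<in>S. \<forall>y\<in>S. \<forall>u\<ge>0. \<forall>v\<ge>0. u + v = 1 \<longrightarrow> f (u *\<^sub>R x + v *\<^sub>R y) = u * f x + v * f y) \<and>
        (\<forall>x. x \<notin> S \<longrightarrow> f x = 0)}"

definition sup_norm_on :: "'s set \<Rightarrow> ('s \<Rightarrow> real) \<Rightarrow> real" where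
  "sup_norm_on S f = (SUP x\<in>S. \<bar>f x\<bar>)"

definition infinite_dimensional :: "('s \<Rightarrow> real) set \<Rightarrow> bool" where
  "infinite_dimensional F \<longleftrightarrow>
    \<not> (\<exists>B. finite B \<and> B \<subseteq> F \<and> (\<forall>f\<in>F. \<exists>c. f = (\<lambda>x. \<Sum>b\<in>B. c b * b x)))"

definition linearly_isometric_to_A ::
    "'a::real_normed_vector set \<Rightarrow> 'a set set \<Rightarrow> 's::hausdorff_lcs set \<Rightarrow> bool" where
  "linearly_isometric_to_A Y V S \<longleftrightarrow>
    (\<exists>J. bij_betw J (affine_functions S) V \<and>
      (\<forall>f\<in>affine_functions S. \<forall>g\<in>affine_functions S.
        J (\<lambda>x. f x + g x) = quotient_add (J f) (J g)) \<and>
      (\<forall>c. \<forall>f\<in>affine_functions S. J (\<lambda>x. c * f x) = quotient_scale Y c (J f)) \<and>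
      (\<forall>f\<in>affine_functions S. quotient_norm (J f) = sup_norm_on S f))"

end

theory Submission
  imports Defs "HOL-Probability.Probability_Mass_Function"
begin

text \<open>
  Write \<open>\<mu> x\<close> for the maximal measure of a point \<open>x\<close> of the simplex \<open>S\<close>. As \<open>A(S)\<close> is separable,
  \<open>S\<close> is metrizable and a measure is maximal iff it is carried by the extreme points, so that
  \<open>\<mu>\<close> is affine. Choose distinct extreme points \<open>e 0, e 1, \<dots>\<close> and put \<open>Q n x = \<mu> x {e n}\<close> for
  \<open>n > 0\<close>, the rest of the mass being \<open>Q 0 x\<close>. A functional of norm \<open>N\<close> on \<open>A(S)\<close> that kills
  constants is \<open>N/2\<close> times a difference of two evaluations; hence
  \<open>\<Sum>n. \<bar>Q n x - Q n x'\<bar>\<close> is at most the norm of the difference of the evaluations at \<open>x\<close>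
  and \<open>x'\<close>. Let \<open>C\<close> be the weak* compact set of norm preserving extensions, within the
  annihilator of \<open>Y\<close>, of the evaluations at points of \<open>S\<close>, and let \<open>E n\<close> in \<open>C\<close> extend the
  evaluation at \<open>e n\<close>. The map that sends an extension of the evaluation at \<open>x\<close> to
  \<open>\<Sum>n. Q n x \<cdot> E (n + 1)\<close> is nonexpansive, and it shifts the coordinates \<open>Q n\<close>, so a fixed point
  would satisfy \<open>Q n x \<le> Q (n + 1) x\<close> for all \<open>n\<close>, although these numbers sum to \<open>1\<close>.
\<close>

section \<open>The Hahn-Banach theorem\<close>

text \<open>The obstacle is the lift from evaluations on \<open>A(S)\<close> to functionals on the
  whole space: Hahn-Banach gives norm preserving extensions, but nothing makes their choice
  nonexpansive. The map therefore factors through l1. A linear map on l1 is a contraction as soon as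
  the unit vectors go into the unit ball, so the \<open>E n\<close> may be arbitrary extensions. The
  simplex enters in the step from evaluations to l1: uniqueness of the maximal measure makes
  \<open>\<mu>\<close> affine, which turns a difference of evaluations into a difference of measures
  of the right size. Lumping the remaining mass into \<open>Q 0\<close> keeps the total equal to 1,
  so that the image lies in \<open>C\<close> again. Affinity by itself says nothing about infinite
  convex combinations; hence one summand is split off from the series at a time and the rest is
  estimated below by zero, which yields an inequality between consecutive coordinates and not an
  equality. The type of \<open>S\<close> carries no metric: a dense sequence in \<open>A(S)\<close>
  embeds \<open>S\<close> into a space of real sequences, where the measure theory of separable
  metric spaces applies.\<close>

definition sublinear :: "('v::real_vector \<Rightarrow> real) \<Rightarrow> bool" where
  "sublinear q \<longleftrightarrow> (\<forall>x y. q (x + y) \<le> q x + q y) \<and> (\<forall>c\<ge>0. \<forall>x. q (c *\<^sub>R x) \<le> c * q x)"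

lemma sublinearI:
  assumes "\<And>x y. q (x + y) \<le> q x + q y" "\<And>c x. c > 0 \<Longrightarrow> q (c *\<^sub>R x) \<le> c * q x" "q 0 \<le> 0"
  shows "sublinear q"
  unfolding sublinear_def using assms by (metis less_eq_real_def mult_zero_left scale_zero_left)

lemma sublinear_add: "sublinear q \<Longrightarrow> q (x + y) \<le> q x + q y"
  and sublinear_scale_le: "sublinear q \<Longrightarrow> c \<ge> 0 \<Longrightarrow> q (c *\<^sub>R x) \<le> c * q x"
  by (auto simp: sublinear_def)

lemma sublinear_zero: assumes "sublinear q" shows "q 0 = 0"
  using sublinear_add[OF assms, of 0 0] sublinear_scale_le[OF assms, of 0 0] by simp

lemma sublinear_ge: assumes "sublinear q" shows "- q (- x) \<le> q x"
  using sublinear_add[OF assms, of x "- x"] sublinear_zero[OF assms] by simp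

text \<open>The reverse inequality is the assumed one for the factor \<open>1/c\<close> at the point
  \<open>c x\<close>.\<close>

lemma sublinear_scale: assumes "sublinear q" "c \<ge> 0" shows "q (c *\<^sub>R x) = c * q x"
proof (cases "c = 0")
  case True then show ?thesis using sublinear_zero[OF assms(1)] by simp
next
  case False
  then have c: "c > 0" using assms by simp
  have "q ((1/c) *\<^sub>R (c *\<^sub>R x)) \<le> (1/c) * q (c *\<^sub>R x)"
    using sublinear_scale_le[OF assms(1), of "1/c" "c *\<^sub>R x"] c by simp
  then have "q x \<le> (1/c) * q (c *\<^sub>R x)" using c by simp
  then have "c * q x \<le> q (c *\<^sub>R x)" using c by (simp add: field_simps)
  with sublinear_scale_le[OF assms] show ?thesis by (simp add: order_antisym)
qed

text \<open>\<open>W\<close> is a cone on which \<open>h\<close> is additive and dominated by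
  \<open>q\<close>. Since \<open>r (- u) \<le> - h u\<close>, any linear functional below
  \<open>r\<close> is at least \<open>h\<close> on \<open>W\<close>. The infimum is finite because
  \<open>- q (- x)\<close> is a lower bound. It serves twice: with a ray, to show that minimal
  functionals are linear, and with a subspace, to extend a given functional.\<close>

lemma sublinear_inf_convolution:
  fixes q h :: "'v::real_vector \<Rightarrow> real"
  assumes q: "sublinear q" and W0: "0 \<in> W"
    and Wadd: "\<And>u v. u \<in> W \<Longrightarrow> v \<in> W \<Longrightarrow> u + v \<in> W"
    and Wscale: "\<And>c u. c > 0 \<Longrightarrow> u \<in> W \<Longrightarrow> c *\<^sub>R u \<in> W"
    and hadd: "\<And>u v. u \<in> W \<Longrightarrow> v \<in> W \<Longrightarrow> h (u + v) = h u + h v"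
    and hscale: "\<And>c u. c > 0 \<Longrightarrow> u \<in> W \<Longrightarrow> h (c *\<^sub>R u) = c * h u"
    and hq: "\<And>u. u \<in> W \<Longrightarrow> h u \<le> q u"
  defines "r \<equiv> \<lambda>x. INF u\<in>W. q (x + u) - h u"
  shows "sublinear r" and "r x \<le> q x" and "u \<in> W \<Longrightarrow> r x \<le> q (x + u) - h u"
proof -
  have h0: "h 0 = 0" using hadd[OF W0 W0] by simp
  have lb: "- q (- x) \<le> q (x + u) - h u" if "u \<in> W" for x u
    using hq[OF that] sublinear_add[OF q, of "x + u" "- x"] by simp
  have bdd: "bdd_below ((\<lambda>u. q (x + u) - h u) ` W)" for x using lb by (auto intro!: bdd_belowI)
  show low: "r x \<le> q (x + u) - h u" if "u \<in> W" for x u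
    unfolding r_def using bdd that by (auto intro: cINF_lower)
  have gr: "m \<le> r x" if "\<And>u. u \<in> W \<Longrightarrow> m \<le> q (x + u) - h u" for m x
    unfolding r_def using W0 that by (auto intro: cINF_greatest)
  show "r x \<le> q x" for x using low[OF W0, of x] h0 by simp
  show "sublinear r"
  proof (rule sublinearI)
    fix x y
    have *: "r (x + y) \<le> (q (x + u) - h u) + (q (y + v) - h v)" if "u \<in> W" "v \<in> W" for u v
      using low[OF Wadd[OF that], of "x + y"] sublinear_add[OF q, of "x + u" "y + v"] hadd[OF that]
      by (simp add: algebra_simps)
    have "r (x + y) - (q (y + v) - h v) \<le> r x" if "v \<in> W" for v
      by (rule gr) (use * that in \<open>fastforce simp: algebra_simps\<close>)
    then have "r (x + y) - r x \<le> r y" by (intro gr) (fastforce simp: algebra_simps)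
    then show "r (x + y) \<le> r x + r y" by simp
  next
    fix c :: real and x assume c: "c > 0"
    have "r (c *\<^sub>R x) / c \<le> r x"
    proof (rule gr)
      fix u assume u: "u \<in> W"
      have "r (c *\<^sub>R x) \<le> q (c *\<^sub>R (x + u)) - h (c *\<^sub>R u)"
        using low[OF Wscale[OF c u], of "c *\<^sub>R x"] by (simp add: algebra_simps)
      also have "\<dots> = c * (q (x + u) - h u)"
        using sublinear_scale[OF q, of c "x + u"] c hscale[OF c u] by (simp add: algebra_simps)
      finally show "r (c *\<^sub>R x) / c \<le> q (x + u) - h u" using c by (simp add: field_simps)
    qed
    then show "r (c *\<^sub>R x) \<le> c * r x" using c by (simp add: field_simps)
  next
    show "r 0 \<le> 0" using low[OF W0, of 0] h0 sublinear_zero[OF q] by simp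
  qed
qed

text \<open>Zorn's lemma for the reversed pointwise order. The pointwise infimum of a chain is
  bounded below by \<open>- p (- x)\<close>; it is subadditive because for two members of the chain
  the smaller one can be used at both points.\<close>

lemma minimal_sublinear_exists:
  fixes p :: "'v::real_vector \<Rightarrow> real"
  assumes p: "sublinear p"
  shows "\<exists>q. sublinear q \<and> q \<le> p \<and> (\<forall>r. sublinear r \<longrightarrow> r \<le> q \<longrightarrow> r = q)"
proof -
  define A where "A = {q. sublinear q \<and> q \<le> p}"
  define P where "P = (\<lambda>q r::'v \<Rightarrow> real. r \<le> q)"
  have "\<exists>m\<in>A. \<forall>a\<in>A. P m a \<longrightarrow> a = m"
  proof (rule predicate_Zorn)
    show "partial_order_on A (relation_of P A)"
      unfolding partial_order_on_def preorder_on_def refl_on_def trans_def antisym_def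
        relation_of_def P_def by auto
    fix C assume C: "C \<in> Chains (relation_of P A)"
    have CA: "C \<subseteq> A" using C unfolding Chains_def relation_of_def by auto
    have tot: "q \<le> r \<or> r \<le> q" if "q \<in> C" "r \<in> C" for q r
      using C that unfolding Chains_def relation_of_def P_def by blast
    show "\<exists>u\<in>A. \<forall>a\<in>C. P a u"
    proof (cases "C = {}")
      case True then show ?thesis using p by (auto simp: A_def)
    next
      case False
      define u where "u = (\<lambda>x. INF q\<in>C. q x)"
      have lb: "- p (- x) \<le> q x" if "q \<in> C" for q x
      proof -
        have "sublinear q" "q (- x) \<le> p (- x)" using CA that by (auto simp: A_def le_fun_def)
        then show ?thesis using sublinear_ge[of q x] by linarith
      qed
      have bdd: "bdd_below ((\<lambda>q. q x) ` C)" for x using lb by (auto intro!: bdd_belowI)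
      have low: "u x \<le> q x" if "q \<in> C" for q x
        unfolding u_def using bdd that by (auto intro: cINF_lower)
      have gr: "m \<le> u x" if "\<And>q. q \<in> C \<Longrightarrow> m \<le> q x" for m x
        unfolding u_def using False that by (auto intro: cINF_greatest)
      have sl: "sublinear q" if "q \<in> C" for q using CA that by (auto simp: A_def)
      have "sublinear u"
      proof (rule sublinearI)
        fix x y
        have *: "u (x + y) \<le> q x + r y" if qr: "q \<in> C" "r \<in> C" for q r
          using tot[OF qr]
        proof
          assume "q \<le> r"
          then have "q y \<le> r y" by (simp add: le_fun_def)
          then show ?thesis using low[OF qr(1), of "x + y"] sublinear_add[OF sl[OF qr(1)], of x y]
            by simp
        next
          assume "r \<le> q"
          then have "r x \<le> q x" by (simp add: le_fun_def)
          then show ?thesis using low[OF qr(2), of "x + y"] sublinear_add[OF sl[OF qr(2)], of x y]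
            by simp
        qed
        have "u (x + y) - r y \<le> u x" if "r \<in> C" for r
          by (rule gr) (use * that in \<open>fastforce simp: algebra_simps\<close>)
        then have "u (x + y) - u x \<le> u y" by (intro gr) (fastforce simp: algebra_simps)
        then show "u (x + y) \<le> u x + u y" by simp
      next
        fix c :: real and x assume c: "c > 0"
        have "u (c *\<^sub>R x) / c \<le> u x"
        proof (rule gr)
          fix q assume "q \<in> C"
          then show "u (c *\<^sub>R x) / c \<le> q x"
            using low[of q "c *\<^sub>R x"] sublinear_scale_le[OF sl, of q c x] c by (simp add: field_simps)
        qed
        then show "u (c *\<^sub>R x) \<le> c * u x" using c by (simp add: field_simps)
      next
        obtain q where "q \<in> C" using False by auto
        then show "u 0 \<le> 0" using low[of q 0] sublinear_zero[OF sl[of q]] by simp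
      qed
      moreover have "u \<le> p"
      proof -
        obtain q where "q \<in> C" using False by auto
        then have "q \<le> p" using CA by (auto simp: A_def)
        then show ?thesis using low[OF \<open>q \<in> C\<close>] by (meson le_fun_def order_trans)
      qed
      ultimately show ?thesis using low by (auto simp: A_def P_def le_fun_def)
    qed
  qed
  then show ?thesis unfolding A_def P_def by (metis (no_types, lifting) mem_Collect_eq order_trans)
qed

text \<open>Lowering \<open>q\<close> along the ray through \<open>y\<close> yields a sublinear
  \<open>r \<le> q\<close>, which by minimality is \<open>q\<close> itself. The bound
  \<open>r x \<le> q (x + y) - q y\<close> then says that \<open>q\<close> is superadditive, hence
  additive.\<close>

lemma minimal_sublinear_linear:
  fixes q :: "'v::real_vector \<Rightarrow> real"
  assumes q: "sublinear q" and min: "\<And>r. sublinear r \<Longrightarrow> r \<le> q \<Longrightarrow> r = q"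
  shows "linear q"
proof -
  have sup: "q x + q y \<le> q (x + y)" for x y
  proof -
    define W where "W = {t *\<^sub>R y |t. t \<ge> 0}"
    have qt: "q (t *\<^sub>R y) = t * q y" if "t \<ge> 0" for t using sublinear_scale[OF q that] .
    define r where "r = (\<lambda>x. INF u\<in>W. q (x + u) - q u)"
    have W: "0 \<in> W" "\<And>u v. u \<in> W \<Longrightarrow> v \<in> W \<Longrightarrow> u + v \<in> W"
        "\<And>c u. c > 0 \<Longrightarrow> u \<in> W \<Longrightarrow> c *\<^sub>R u \<in> W"
    proof -
      show "0 \<in> W" by (auto simp: W_def intro: exI[of _ 0])
      show "u + v \<in> W" if uv: "u \<in> W" "v \<in> W" for u v
      proof -
        obtain s t where "u = s *\<^sub>R y" "s \<ge> 0" "v = t *\<^sub>R y" "t \<ge> 0" using uv by (auto simp: W_def)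
        then show ?thesis by (auto simp: W_def simp flip: scaleR_add_left)
      qed
      show "c *\<^sub>R u \<in> W" if cu: "c > 0" "u \<in> W" for c u
      proof -
        obtain s where "u = s *\<^sub>R y" "s \<ge> 0" using cu by (auto simp: W_def)
        then show ?thesis using cu(1) by (auto simp: W_def)
      qed
    qed
    have h: "q (u + v) = q u + q v" if "u \<in> W" "v \<in> W" for u v
    proof -
      obtain s t where "u = s *\<^sub>R y" "s \<ge> 0" "v = t *\<^sub>R y" "t \<ge> 0" using \<open>u \<in> W\<close> \<open>v \<in> W\<close> by (auto simp: W_def)
      then show ?thesis using qt[of "s + t"] by (simp add: qt scaleR_add_left distrib_right)
    qed
    note c = sublinear_inf_convolution[of q W q, OF q W h sublinear_scale[OF q] order_refl, folded r_def]
    have "sublinear r" "r \<le> q" "r x \<le> q (x + y) - q y"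
    proof -
      have "y \<in> W" by (auto simp: W_def intro: exI[of _ 1])
      then show "sublinear r" "r \<le> q" "r x \<le> q (x + y) - q y"
        using c unfolding le_fun_def r_def by auto
    qed
    then show ?thesis using min[of r] by auto
  qed
  have add: "q (x + y) = q x + q y" for x y
    using sup[of x y] sublinear_add[OF q, of x y] by simp
  have neg: "q (- x) = - q x" for x using add[of x "- x"] sublinear_zero[OF q] by simp
  show ?thesis
  proof (rule linearI)
    show "q (x + y) = q x + q y" for x y by (rule add)
    show "q (c *\<^sub>R x) = c *\<^sub>R q x" for c x
    proof (cases "c \<ge> 0")
      case True then show ?thesis using sublinear_scale[OF q] by simp
    next
      case False
      then have "q ((- c) *\<^sub>R x) = (- c) * q x" using sublinear_scale[OF q, of "- c" x] by simp
      then show ?thesis using neg[of "c *\<^sub>R x"] by simp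
    qed
  qed
qed

text \<open>A minimal sublinear functional below the lowered \<open>r\<close> is linear and
  satisfies \<open>q (- u) \<le> - f u\<close> on \<open>U\<close>; applied to \<open>u\<close> and
  to \<open>- u\<close> this gives equality.\<close>

theorem hahn_banach:
  fixes p f :: "'v::real_vector \<Rightarrow> real"
  assumes p: "sublinear p" and U: "subspace U"
    and fadd: "\<And>u v. u \<in> U \<Longrightarrow> v \<in> U \<Longrightarrow> f (u + v) = f u + f v"
    and fscale: "\<And>c u. u \<in> U \<Longrightarrow> f (c *\<^sub>R u) = c * f u"
    and fp: "\<And>u. u \<in> U \<Longrightarrow> f u \<le> p u"
  obtains g where "linear g" "\<And>u. u \<in> U \<Longrightarrow> g u = f u" "\<And>x. g x \<le> p x"
proof -
  define r where "r = (\<lambda>x. INF u\<in>U. p (x + u) - f u)"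
  have c: "sublinear r" "\<And>x. r x \<le> p x" "\<And>u x. u \<in> U \<Longrightarrow> r x \<le> p (x + u) - f u"
    unfolding r_def
    by (rule sublinear_inf_convolution; use p U fadd fscale fp in
        \<open>simp add: subspace_0 subspace_add subspace_scale\<close>)+
  obtain q where q: "sublinear q" "q \<le> r" "\<And>s. sublinear s \<Longrightarrow> s \<le> q \<Longrightarrow> s = q"
    using minimal_sublinear_exists[OF c(1)] by blast
  have lin: "linear q" using minimal_sublinear_linear[OF q(1) q(3)] by blast
  have le: "q (- u) \<le> - f u" if "u \<in> U" for u
    using c(3)[OF that, of "- u"] le_funD[OF q(2), of "- u"] sublinear_zero[OF p] by simp
  have "q u = f u" if u: "u \<in> U" for u
  proof -
    have "- u \<in> U" using subspace_neg[OF U u] .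
    then have "q u \<le> - f (- u)" using le[of "- u"] by simp
    then have "q u \<le> f u" using fscale[OF u, of "- 1"] by simp
    moreover have "f u \<le> q u" using le[OF u] linear_neg[OF lin, of u] by simp
    ultimately show ?thesis by simp
  qed
  moreover have "q x \<le> p x" for x using le_funD[OF q(2), of x] c(2)[of x] by simp
  ultimately show thesis using that lin by blast
qed

section \<open>Locally convex spaces\<close>

lemma tendsto_scaleR_lcs:
  fixes g :: "'b \<Rightarrow> 's::hausdorff_lcs"
  assumes "(f \<longlongrightarrow> c) F" "(g \<longlongrightarrow> x) F"
  shows "((\<lambda>z. f z *\<^sub>R g z) \<longlongrightarrow> c *\<^sub>R x) F"
proof -
  have "filterlim (\<lambda>z. (f z, g z)) (nhds c \<times>\<^sub>F nhds x) F"
    using assms by (intro filterlim_Pair)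
  from filterlim_compose[OF tendsto_scaleR_Pair_lcs this] show ?thesis by simp
qed

lemma continuous_on_scaleR_lcs [continuous_intros]:
  fixes g :: "'b::topological_space \<Rightarrow> 's::hausdorff_lcs"
  shows "continuous_on A f \<Longrightarrow> continuous_on A g \<Longrightarrow> continuous_on A (\<lambda>z. f z *\<^sub>R g z)"
  unfolding continuous_on_def by (auto intro: tendsto_scaleR_lcs)

text \<open>This is the Minkowski functional of \<open>V\<close>, finite because
  \<open>x / n\<close> tends to zero and so enters \<open>V\<close>. As \<open>V\<close> need not be
  symmetric, it is sublinear but not a seminorm in general.\<close>

lemma sublinear_gauge:
  fixes V :: "'s::hausdorff_lcs set"
  assumes V: "open V" "0 \<in> V"
    and cvx: "\<And>x y u v. x \<in> V \<Longrightarrow> y \<in> V \<Longrightarrow> u \<ge> 0 \<Longrightarrow> v \<ge> 0 \<Longrightarrow> u + v = 1 \<Longrightarrow> u *\<^sub>R x + v *\<^sub>R y \<in> V"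
  obtains p where "sublinear p" "\<And>x. x \<in> V \<Longrightarrow> p x \<le> 1" "\<And>x. x \<notin> V \<Longrightarrow> p x \<ge> 1" "\<And>x. p x \<ge> 0"
proof -
  define G where "G x = {t. t > 0 \<and> (1/t) *\<^sub>R x \<in> V}" for x
  define p where "p x = Inf (G x)" for x
  have ne: "G x \<noteq> {}" for x
  proof -
    have "((\<lambda>n. (1 / real (Suc n)) *\<^sub>R x) \<longlongrightarrow> 0 *\<^sub>R x) sequentially"
      by (intro tendsto_scaleR_lcs tendsto_const LIMSEQ_Suc lim_1_over_n)
    then have "\<forall>\<^sub>F n in sequentially. (1 / real (Suc n)) *\<^sub>R x \<in> V"
      using V by (auto dest!: topological_tendstoD)
    then obtain n where "(1 / real (Suc n)) *\<^sub>R x \<in> V" by (auto simp: eventually_sequentially)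
    then have "real (Suc n) \<in> G x" by (simp add: G_def)
    then show ?thesis by auto
  qed
  have bdd: "bdd_below (G x)" for x by (rule bdd_belowI[of _ 0]) (auto simp: G_def)
  have shrink: "s *\<^sub>R x \<in> V" if "x \<in> V" "0 \<le> s" "s \<le> 1" for s x
    using cvx[OF that(1) V(2), of s "1 - s"] that by simp
  have low: "p x \<le> t" if "t \<in> G x" for x t unfolding p_def using bdd that by (rule cInf_lower[rotated])
  have gr: "m \<le> p x" if "\<And>t. t \<in> G x \<Longrightarrow> m \<le> t" for m x
    unfolding p_def using ne that by (rule cInf_greatest)
  show thesis
  proof
    show "p x \<ge> 0" for x by (rule gr) (auto simp: G_def)
    show "p x \<le> 1" if "x \<in> V" for x by (rule low) (use that in \<open>simp add: G_def\<close>)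
    show "p x \<ge> 1" if "x \<notin> V" for x
    proof (rule gr, rule ccontr)
      fix t assume t: "t \<in> G x" "\<not> 1 \<le> t"
      then have t0: "t > 0" "(1/t) *\<^sub>R x \<in> V" by (auto simp: G_def)
      then have "t *\<^sub>R ((1/t) *\<^sub>R x) \<in> V" using t(2) by (intro shrink[OF t0(2)]) auto
      moreover have "t *\<^sub>R ((1/t) *\<^sub>R x) = x" using t0(1) by simp
      ultimately show False using that by simp
    qed
    show "sublinear p"
    proof (rule sublinearI)
      fix x y
      have *: "p (x + y) \<le> s + t" if st: "s \<in> G x" "t \<in> G y" for s t
      proof (rule low)
        have pos: "s > 0" "t > 0" using st by (auto simp: G_def)
        have "(s/(s+t)) *\<^sub>R ((1/s) *\<^sub>R x) + (t/(s+t)) *\<^sub>R ((1/t) *\<^sub>R y) \<in> V"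
          using st pos by (intro cvx) (auto simp: G_def simp flip: add_divide_distrib)
        then show "s + t \<in> G (x + y)" using pos by (simp add: G_def scaleR_add_right)
      qed
      have "p (x + y) - t \<le> p x" if "t \<in> G y" for t
        by (rule gr) (use * that in \<open>fastforce simp: algebra_simps\<close>)
      then have "p (x + y) - p x \<le> p y" by (intro gr) (fastforce simp: algebra_simps)
      then show "p (x + y) \<le> p x + p y" by simp
    next
      fix c :: real and x assume c: "c > 0"
      have "p (c *\<^sub>R x) / c \<le> p x"
      proof (rule gr)
        fix t assume "t \<in> G x"
        then have "c * t \<in> G (c *\<^sub>R x)" using c by (simp add: G_def)
        then show "p (c *\<^sub>R x) / c \<le> t" using low[of "c * t" "c *\<^sub>R x"] c by (simp add: field_simps)
      qed
      then show "p (c *\<^sub>R x) \<le> c * p x" using c by (simp add: field_simps)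
    next
      show "p 0 \<le> 0"
      proof (rule field_le_epsilon)
        fix e :: real assume "e > 0"
        then show "p 0 \<le> 0 + e" using low[of e 0] V by (simp add: G_def)
      qed
    qed
  qed
qed

text \<open>By homogeneity the bound 1 on \<open>W\<close> becomes \<open>e/2\<close> on a scaled
  copy of \<open>W\<close>; the factor 2 provides the strict inequality.\<close>

lemma linear_continuous_lcs:
  fixes \<phi> :: "'s::hausdorff_lcs \<Rightarrow> real"
  assumes lin: "linear \<phi>" and W: "open W" "0 \<in> W" and bd: "\<And>w. w \<in> W \<Longrightarrow> \<bar>\<phi> w\<bar> \<le> 1"
  shows "continuous_on UNIV \<phi>"
  unfolding continuous_on_def
proof (intro ballI tendstoI)
  fix x :: 's and e :: real assume e: "e > 0"
  have "((\<lambda>y. (2/e) *\<^sub>R (y - x)) \<longlongrightarrow> (2/e) *\<^sub>R (x - x)) (at x)"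
    by (intro tendsto_scaleR_lcs tendsto_const tendsto_diff tendsto_ident_at)
  then have "\<forall>\<^sub>F y in at x. (2/e) *\<^sub>R (y - x) \<in> W" using W by (auto dest!: topological_tendstoD)
  then show "\<forall>\<^sub>F y in at x within UNIV. dist (\<phi> y) (\<phi> x) < e"
  proof (eventually_elim)
    case (elim y)
    have "\<phi> ((2/e) *\<^sub>R (y - x)) = (2/e) * (\<phi> y - \<phi> x)"
      by (simp only: linear_scale[OF lin] linear_diff[OF lin] real_scaleR_def)
    then have "(2/e) * \<bar>\<phi> y - \<phi> x\<bar> \<le> 1"
      using bd[OF elim] e by (simp only: abs_mult) simp
    then show ?case using e by (simp add: dist_real_def field_simps)
  qed
qed

text \<open>Hahn-Banach for the functional that sends \<open>t z\<close> to \<open>t\<close> on the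
  line through \<open>z = x - y\<close>. It is dominated by the gauge of a convex neighbourhood of
  zero that misses \<open>z\<close>, because that gauge is at least 1 at \<open>z\<close>.\<close>

lemma continuous_linear_separates:
  fixes x y :: "'s::hausdorff_lcs"
  assumes "x \<noteq> y"
  obtains \<phi> :: "'s \<Rightarrow> real" where "linear \<phi>" "continuous_on UNIV \<phi>" "\<phi> x \<noteq> \<phi> y"
proof -
  define z where "z = x - y"
  have z: "z \<noteq> 0" using assms by (simp add: z_def)
  obtain V where V: "open V" "0 \<in> V" "V \<subseteq> - {z}"
    "\<forall>x\<in>V. \<forall>y\<in>V. \<forall>u\<ge>0. \<forall>v\<ge>0. u + v = 1 \<longrightarrow> u *\<^sub>R x + v *\<^sub>R y \<in> V"
    proof -
    have "open (- {z})" "0 \<in> - {z}" using z by auto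
    from locally_convex_0[OF this] show thesis using that by blast
  qed
  obtain p where p: "sublinear p" "\<And>x. x \<in> V \<Longrightarrow> p x \<le> 1" "\<And>x. x \<notin> V \<Longrightarrow> p x \<ge> 1" "\<And>x. p x \<ge> 0"
  proof (rule sublinear_gauge[OF V(1,2)])
    show "u *\<^sub>R x + v *\<^sub>R y \<in> V" if "x \<in> V" "y \<in> V" "u \<ge> 0" "v \<ge> 0" "u + v = 1" for x y u v
      using V(4) that by blast
  qed blast
  define c where "c u = (THE t. u = t *\<^sub>R z)" for u
  have c: "c (t *\<^sub>R z) = t" for t unfolding c_def using z by (intro the_equality) auto
  have pz: "1 \<le> p z" using p(3)[of z] V(3) by auto
  obtain \<phi> where \<phi>: "linear \<phi>" "\<And>u. u \<in> range (\<lambda>t. t *\<^sub>R z) \<Longrightarrow> \<phi> u = c u" "\<And>x. \<phi> x \<le> p x"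
  proof (rule hahn_banach[of p "range (\<lambda>t. t *\<^sub>R z)" c])
    show "subspace (range (\<lambda>t. t *\<^sub>R z))"
      using subspace_span[of "{z}"] by (simp add: span_singleton)
    show "c (u + v) = c u + c v" if "u \<in> range (\<lambda>t. t *\<^sub>R z)" "v \<in> range (\<lambda>t. t *\<^sub>R z)" for u v
      using that by (auto simp: c simp flip: scaleR_add_left)
    show "c (s *\<^sub>R u) = s * c u" if "u \<in> range (\<lambda>t. t *\<^sub>R z)" for s u using that by (auto simp: c)
    show "c u \<le> p u" if u: "u \<in> range (\<lambda>t. t *\<^sub>R z)" for u
    proof -
      obtain t where t: "u = t *\<^sub>R z" using u by auto
      show ?thesis
      proof (cases "t \<ge> 0")
        case True
        then have "p u = t * p z" using sublinear_scale[OF p(1)] t by simp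
        then show ?thesis using pz True mult_left_mono[of 1 "p z" t] by (simp add: t c)
      next
        case False then show ?thesis using p(4)[of u] by (simp add: t c)
      qed
    qed
  qed (use p in auto)
  have "continuous_on UNIV \<phi>"
  \<comment> \<open>The gauge bounds \<open>\<phi>\<close> only from above; on the reflected
    neighbourhood it bounds \<open>- \<phi>\<close>.\<close>
  proof (rule linear_continuous_lcs[OF \<phi>(1), of "V \<inter> uminus -` V"])
    have "open (uminus -` V)"
      using V(1) by (intro open_vimage) (auto intro!: continuous_intros)
    then show "open (V \<inter> uminus -` V)" using V(1) by auto
    show "0 \<in> V \<inter> uminus -` V" using V by auto
    show "\<bar>\<phi> w\<bar> \<le> 1" if "w \<in> V \<inter> uminus -` V" for w
      using that p(2)[of w] p(2)[of "- w"] \<phi>(3)[of w] \<phi>(3)[of "- w"] linear_neg[OF \<phi>(1), of w] by auto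
  qed
  moreover have "\<phi> x \<noteq> \<phi> y"
  proof -
    have "\<phi> z = 1" using \<phi>(2)[of z] c[of 1] by (auto simp: image_iff) (metis scaleR_one)
    then show ?thesis using linear_diff[OF \<phi>(1), of x y] by (simp add: z_def)
  qed
  ultimately show thesis using that \<phi>(1) by blast
qed

section \<open>Continuous affine functions on a compact convex set\<close>

text \<open>
  For finitely many indices, a minimizer \<open>k0\<close> of the squared error is a solution: its first-order
  condition contradicts \<open>dom\<close> for \<open>r i = L i - h i k0\<close> unless the error vanishes.
\<close>
lemma moment_problem_solvable:
  fixes K :: "'k::t2_space set" and h :: "'i \<Rightarrow> 'k \<Rightarrow> real" and L :: "'i \<Rightarrow> real"
  assumes K: "compact K"
    and cont: "\<And>i. i \<in> I \<Longrightarrow> continuous_on K (h i)"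
    and cvx: "\<And>k k' t. k \<in> K \<Longrightarrow> k' \<in> K \<Longrightarrow> 0 < t \<Longrightarrow> t \<le> 1 \<Longrightarrow>
      \<exists>m\<in>K. \<forall>i\<in>I. h i m = h i k + t * (h i k' - h i k)"
    and dom: "\<And>F r. finite F \<Longrightarrow> F \<subseteq> I \<Longrightarrow>
      \<exists>k\<in>K. (\<Sum>i\<in>F. r i * L i) \<le> (\<Sum>i\<in>F. r i * h i k)"
  shows "\<exists>k\<in>K. \<forall>i\<in>I. h i k = L i"
proof -
  have ne: "K \<noteq> {}" using dom[of "{}"] by auto
  have fin: "\<exists>k\<in>K. \<forall>i\<in>F. h i k = L i" if F: "finite F" "F \<subseteq> I" for F
  proof -
    define \<phi> where "\<phi> k = (\<Sum>i\<in>F. (h i k - L i)\<^sup>2)" for k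
    have "continuous_on K \<phi>" unfolding \<phi>_def using cont F by (auto intro!: continuous_intros)
    from continuous_attains_inf[OF K ne this] obtain k0
      where k0: "k0 \<in> K" "\<And>k. k \<in> K \<Longrightarrow> \<phi> k0 \<le> \<phi> k" by blast
    define r where "r i = L i - h i k0" for i
    obtain k1 where k1: "k1 \<in> K" "(\<Sum>i\<in>F. r i * L i) \<le> (\<Sum>i\<in>F. r i * h i k1)"
      using dom[OF F] by blast
    define P where "P = (\<Sum>i\<in>F. r i * (h i k1 - h i k0))"
    define D where "D = (\<Sum>i\<in>F. (h i k1 - h i k0)\<^sup>2)"
    have P_le: "2 * P \<le> t * D" if t: "0 < t" "t \<le> 1" for t
    proof -
      obtain m where m: "m \<in> K" "\<forall>i\<in>I. h i m = h i k0 + t * (h i k1 - h i k0)"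
        using cvx[OF k0(1) k1(1) t] by blast
      have "\<phi> m = (\<Sum>i\<in>F. (h i k0 + t * (h i k1 - h i k0) - L i)\<^sup>2)"
        unfolding \<phi>_def using m(2) F(2) by (intro sum.cong) auto
      also have "\<dots> = (\<Sum>i\<in>F. (h i k0 - L i)\<^sup>2 - 2 * t * (r i * (h i k1 - h i k0))
          + t\<^sup>2 * (h i k1 - h i k0)\<^sup>2)"
        by (intro sum.cong) (auto simp: r_def power2_eq_square algebra_simps)
      also have "\<dots> = \<phi> k0 - 2 * t * P + t\<^sup>2 * D"
        by (simp add: \<phi>_def P_def D_def sum.distrib sum_subtractf sum_distrib_left)
      finally have "t * (2 * P) \<le> t * (t * D)" using k0(2)[OF m(1)] by (simp add: power2_eq_square)
      then show ?thesis using t(1) by simp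
    qed
    have D0: "D \<ge> 0" unfolding D_def by (intro sum_nonneg) auto
    have "2 * P \<le> 0"
    proof (rule field_le_epsilon)
      fix e :: real assume e: "e > 0"
      define t where "t = min 1 (e / (D + 1))"
      have "0 < t" "t \<le> 1" using e D0 by (auto simp: t_def)
      then have "2 * P \<le> t * D" by (rule P_le)
      also have "\<dots> \<le> e / (D + 1) * D" using D0 by (intro mult_right_mono) (auto simp: t_def)
      also have "\<dots> \<le> e" using e D0 by (simp add: field_simps)
      finally show "2 * P \<le> 0 + e" by simp
    qed
    \<comment> \<open>Here domination for the coefficients \<open>r\<close> enters: the squared
      error at \<open>k0\<close> is at most the directional quantity \<open>P\<close>, which
      minimality has just made nonpositive.\<close>
    moreover have "(\<Sum>i\<in>F. (r i)\<^sup>2) \<le> P"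
    proof -
      have "(\<Sum>i\<in>F. (r i)\<^sup>2) = (\<Sum>i\<in>F. r i * L i) - (\<Sum>i\<in>F. r i * h i k0)"
        by (simp add: r_def power2_eq_square right_diff_distrib flip: sum_subtractf)
      also have "\<dots> \<le> (\<Sum>i\<in>F. r i * h i k1) - (\<Sum>i\<in>F. r i * h i k0)" using k1(2) by simp
      also have "\<dots> = P" by (simp add: P_def right_diff_distrib sum_subtractf)
      finally show ?thesis .
    qed
    moreover have "(\<Sum>i\<in>F. (r i)\<^sup>2) \<ge> 0" by (intro sum_nonneg) auto
    ultimately have "(\<Sum>i\<in>F. (r i)\<^sup>2) = 0" by linarith
    then have "\<forall>i\<in>F. r i = 0" using F(1) by (simp add: sum_nonneg_eq_0_iff)
    then show ?thesis using k0(1) by (auto simp: r_def)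
  qed
  \<comment> \<open>The solution sets of the single equations are closed, so the finite case passes
    to all of \<open>I\<close> by the finite intersection property.\<close>
  define C where "C i = {k\<in>K. h i k = L i}" for i
  have "K \<inter> \<Inter> (C ` I) \<noteq> {}"
  proof (rule compact_imp_fip_image[OF K])
    show "closed (C i)" if "i \<in> I" for i
      unfolding C_def using continuous_closed_preimage_constant[OF cont[OF that]] compact_imp_closed[OF K]
      by simp
    show "K \<inter> \<Inter> (C ` F) \<noteq> {}" if "finite F" "F \<subseteq> I" for F
      using fin[OF that] by (auto simp: C_def)
  qed
  then show ?thesis by (auto simp: C_def)
qed

section \<open>Joins of convex sets and extreme points\<close>

lemma convex_two_weights:
  assumes "convex Q" "x \<in> Q" "y \<in> Q" "u \<ge> 0" "v \<ge> (0::real)"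
  obtains z where "z \<in> Q" "u *\<^sub>R x + v *\<^sub>R y = (u + v) *\<^sub>R z"
proof (cases "u + v = 0")
  case True
  then have "u = 0" "v = 0" using assms by auto
  then show ?thesis using that[of x] assms by simp
next
  case False
  define z where "z = (u/(u+v)) *\<^sub>R x + (v/(u+v)) *\<^sub>R y"
  have "z \<in> Q" unfolding z_def using False assms
    by (intro convexD) (auto simp flip: add_divide_distrib)
  moreover have "u *\<^sub>R x + v *\<^sub>R y = (u + v) *\<^sub>R z" using False by (simp add: z_def scaleR_add_right)
  ultimately show ?thesis using that by blast
qed

text \<open>For \<open>d = 0\<close> and nonempty convex sets this is the convex hull of their
  union. For \<open>d > 0\<close> each point has weight at least \<open>d\<close> on
  \<open>R\<close>, so that an extreme point of \<open>S\<close> outside \<open>R\<close> stays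
  outside the join even if \<open>Q\<close> is all of \<open>S\<close>.\<close>

definition join :: "real \<Rightarrow> 'v::real_vector set \<Rightarrow> 'v set \<Rightarrow> 'v set" where
  "join d Q R = (\<lambda>(t, x, y). (1 - t) *\<^sub>R x + t *\<^sub>R y) ` ({d..1} \<times> Q \<times> R)"

lemma joinI: "d \<le> t \<Longrightarrow> t \<le> 1 \<Longrightarrow> x \<in> Q \<Longrightarrow> y \<in> R \<Longrightarrow> (1 - t) *\<^sub>R x + t *\<^sub>R y \<in> join d Q R"
  unfolding join_def by (rule image_eqI[of _ _ "(t, x, y)"]) auto

lemma joinE:
  assumes "p \<in> join d Q R"
  obtains t x y where "p = (1 - t) *\<^sub>R x + t *\<^sub>R y" "d \<le> t" "t \<le> 1" "x \<in> Q" "y \<in> R"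
  using assms unfolding join_def by auto

lemma convex_join:
  assumes Q: "convex Q" and R: "convex R" and d: "0 \<le> d"
  shows "convex (join d Q R)"
proof (rule convexI)
  fix p q and u v :: real
  assume p: "p \<in> join d Q R" and q: "q \<in> join d Q R" and uv: "0 \<le> u" "0 \<le> v" "u + v = 1"
  obtain t x y where p: "p = (1 - t) *\<^sub>R x + t *\<^sub>R y" "d \<le> t" "t \<le> 1" "0 \<le> t" "x \<in> Q" "y \<in> R"
    using joinE[OF p] d by (metis order_trans)
  obtain t' x' y' where q: "q = (1 - t') *\<^sub>R x' + t' *\<^sub>R y'" "d \<le> t'" "t' \<le> 1" "0 \<le> t'" "x' \<in> Q" "y' \<in> R"
    using joinE[OF q] d by (metis order_trans)
  define T where "T = u * t + v * t'"
  obtain X where X: "X \<in> Q" "(u * (1 - t)) *\<^sub>R x + (v * (1 - t')) *\<^sub>R x' = (u * (1 - t) + v * (1 - t')) *\<^sub>R X"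
    by (rule convex_two_weights[OF Q p(5) q(5), of "u * (1 - t)" "v * (1 - t')"]) (use p q uv in auto)
  obtain Z where Z: "Z \<in> R" "(u * t) *\<^sub>R y + (v * t') *\<^sub>R y' = T *\<^sub>R Z"
    unfolding T_def
    by (rule convex_two_weights[OF R p(6) q(6), of "u * t" "v * t'"]) (use p q uv in auto)
  have T1: "u * (1 - t) + v * (1 - t') = 1 - T" using uv(3) by (simp add: T_def algebra_simps)
  have "u *\<^sub>R p + v *\<^sub>R q = ((u * (1 - t)) *\<^sub>R x + (v * (1 - t')) *\<^sub>R x') + ((u * t) *\<^sub>R y + (v * t') *\<^sub>R y')"
    by (simp add: p(1) q(1) scaleR_add_right)
  then have e: "u *\<^sub>R p + v *\<^sub>R q = (1 - T) *\<^sub>R X + T *\<^sub>R Z" using X(2) Z(2) T1 by simp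
  have "u * d + v * d \<le> T" unfolding T_def using p q uv by (intro add_mono mult_left_mono) auto
  then have "d \<le> T" using uv(3) by (simp flip: distrib_right)
  moreover have "T \<le> 1" using T1 p q uv by (smt (verit) mult_nonneg_nonneg)
  ultimately show "u *\<^sub>R p + v *\<^sub>R q \<in> join d Q R" unfolding e using X(1) Z(1) by (intro joinI)
qed

lemma compact_join:
  fixes Q R :: "'s::hausdorff_lcs set"
  assumes "compact Q" "compact R"
  shows "compact (join d Q R)"
  unfolding join_def using assms
  by (intro compact_continuous_image compact_Times) (auto simp: split_beta intro!: continuous_intros)

lemma extreme_point_eq:
  assumes p: "p extreme_point_of S" and xy: "x \<in> S" "y \<in> S" and t: "0 < t" "t \<le> 1"
    and eq: "p = (1 - t) *\<^sub>R x + t *\<^sub>R y"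
  shows "y = p"
proof (rule ccontr)
  assume "y \<noteq> p"
  then have "t \<noteq> 1" using eq by auto
  moreover have "x \<noteq> y" using \<open>y \<noteq> p\<close> eq by (auto simp flip: scaleR_add_left)
  ultimately have "p \<in> open_segment x y" using t eq unfolding in_segment by auto
  then show False using p xy by (auto simp: extreme_point_of_def)
qed

section \<open>The space of continuous affine functions: separation and representation of
  functionals\<close>

locale compact_convex =
  fixes S :: "'s::hausdorff_lcs set"
  assumes S_compact: "compact S" and S_convex: "convex S"
begin

abbreviation A :: "('s \<Rightarrow> real) set" where "A \<equiv> affine_functions S"

lemma A_cont: "a \<in> A \<Longrightarrow> continuous_on S a"
  by (simp add: affine_functions_def)

lemma A_affine: "a \<in> A \<Longrightarrow> x \<in> S \<Longrightarrow> y \<in> S \<Longrightarrow> u \<ge> 0 \<Longrightarrow> v \<ge> 0 \<Longrightarrow> u + v = 1 \<Longrightarrow>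
    a (u *\<^sub>R x + v *\<^sub>R y) = u * a x + v * a y"
  by (simp add: affine_functions_def)

lemma A_join: "a \<in> A \<Longrightarrow> x \<in> S \<Longrightarrow> y \<in> S \<Longrightarrow> 0 \<le> t \<Longrightarrow> t \<le> 1 \<Longrightarrow>
    a ((1 - t) *\<^sub>R x + t *\<^sub>R y) = (1 - t) * a x + t * a y"
  by (rule A_affine) auto

lemma S_join: "x \<in> S \<Longrightarrow> y \<in> S \<Longrightarrow> 0 \<le> t \<Longrightarrow> t \<le> 1 \<Longrightarrow> (1 - t) *\<^sub>R x + t *\<^sub>R y \<in> S"
  using S_convex by (simp add: convex_def)

lemma A_add: "a \<in> A \<Longrightarrow> b \<in> A \<Longrightarrow> (\<lambda>x. a x + b x) \<in> A"
  by (auto simp: affine_functions_def algebra_simps intro!: continuous_intros)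

lemma A_scale: "a \<in> A \<Longrightarrow> (\<lambda>x. c * a x) \<in> A"
  by (auto simp: affine_functions_def algebra_simps intro!: continuous_intros)

lemma A_zero: "(\<lambda>x. 0) \<in> A"
  by (auto simp: affine_functions_def)

lemma A_sum: "finite F \<Longrightarrow> F \<subseteq> A \<Longrightarrow> (\<lambda>x. \<Sum>a\<in>F. r a * a x) \<in> A"
  by (induction F rule: finite_induct) (auto simp: A_zero intro!: A_add A_scale)

lemma A_const: "(\<lambda>x. if x \<in> S then c else 0) \<in> A"
proof -
  have "continuous_on S (\<lambda>x. if x \<in> S then c else 0)"
    by (rule continuous_on_eq[OF continuous_on_const]) auto
  then show ?thesis using S_convex
    by (auto simp: affine_functions_def convex_def simp flip: distrib_right)
qed

lemma A_linear:
  assumes "linear \<phi>" "continuous_on UNIV \<phi>"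
  shows "(\<lambda>x. if x \<in> S then \<phi> x else 0) \<in> A"
proof -
  have "continuous_on S (\<lambda>x. if x \<in> S then \<phi> x else 0)"
    by (rule continuous_on_eq[OF continuous_on_subset[OF assms(2)]]) auto
  then show ?thesis using S_convex assms(1)
    by (auto simp: affine_functions_def convex_def linear_add linear_scale)
qed

lemma A_eq_imp_eq:
  assumes "x \<in> S" "y \<in> S" "\<And>a. a \<in> A \<Longrightarrow> a x = a y"
  shows "x = y"
proof (rule ccontr)
  assume "x \<noteq> y"
  then obtain \<phi> :: "'s \<Rightarrow> real" where "linear \<phi>" "continuous_on UNIV \<phi>" "\<phi> x \<noteq> \<phi> y"
    using continuous_linear_separates by blast
  then show False using assms(1,2) assms(3)[OF A_linear] by auto
qed

text \<open>If no member of \<open>A\<close> separates, the moment problem on \<open>Q\<close> with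
  the values at \<open>p\<close> as data satisfies the domination condition. A solution agrees with
  \<open>p\<close> under all of \<open>A\<close>, hence is \<open>p\<close>, which lies outside
  \<open>Q\<close>.\<close>

lemma A_separation:
  assumes Q: "compact Q" "convex Q" "Q \<subseteq> S" and p: "p \<in> S" "p \<notin> Q"
  shows "\<exists>a\<in>A. \<forall>q\<in>Q. a p < a q"
proof (rule ccontr)
  assume "\<not> ?thesis"
  then have neg: "\<exists>q\<in>Q. a q \<le> a p" if "a \<in> A" for a using that by (meson linorder_not_le)
  have "\<exists>q\<in>Q. \<forall>a\<in>A. a q = a p"
  proof (rule moment_problem_solvable[OF Q(1)])
    show "continuous_on Q a" if "a \<in> A" for a
      using A_cont[OF that] Q(3) by (rule continuous_on_subset)
    show "\<exists>m\<in>Q. \<forall>a\<in>A. a m = a k + t * (a k' - a k)"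
      if "k \<in> Q" "k' \<in> Q" "0 < t" "t \<le> 1" for k k' and t :: real
    proof (intro bexI ballI)
      show "(1 - t) *\<^sub>R k + t *\<^sub>R k' \<in> Q" using that Q(2) by (simp add: convex_def)
      show "a ((1 - t) *\<^sub>R k + t *\<^sub>R k') = a k + t * (a k' - a k)" if "a \<in> A" for a
        using A_join[OF that, of k k' t] \<open>k \<in> Q\<close> \<open>k' \<in> Q\<close> \<open>0 < t\<close> \<open>t \<le> 1\<close> Q(3)
        by (auto simp: algebra_simps)
    qed
    show "\<exists>q\<in>Q. (\<Sum>a\<in>F. r a * a p) \<le> (\<Sum>a\<in>F. r a * a q)" if "finite F" "F \<subseteq> A" for F r
      \<comment> \<open>Failure of separation bounds a function from above by its value at
        \<open>p\<close>; the factor \<open>- 1\<close> turns this into the bound from below that is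
        wanted.\<close>
      using neg[OF A_scale[OF A_sum[OF that], of "- 1" r]] by auto
  qed
  then obtain q where "q \<in> Q" "\<forall>a\<in>A. a q = a p" by blast
  then have "q = p" using A_eq_imp_eq[of q p] Q(3) p(1) by auto
  then show False using \<open>q \<in> Q\<close> p(2) by simp
qed

text \<open>Since linear combinations of members of \<open>A\<close> are again members,
  \<open>bound\<close> is exactly the domination that the moment problem on \<open>S\<close>,
  indexed by \<open>A\<close> itself, asks for.\<close>

lemma state_is_evaluation:
  assumes add: "\<And>a b. a \<in> A \<Longrightarrow> b \<in> A \<Longrightarrow> L (\<lambda>x. a x + b x) = L a + L b"
    and scale: "\<And>c a. a \<in> A \<Longrightarrow> L (\<lambda>x. c * a x) = c * L a"
    and bound: "\<And>a. a \<in> A \<Longrightarrow> \<exists>s\<in>S. L a \<le> a s"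
  shows "\<exists>s\<in>S. \<forall>a\<in>A. a s = L a"
proof (rule moment_problem_solvable[OF S_compact])
  show "continuous_on S a" if "a \<in> A" for a using A_cont[OF that] .
  show "\<exists>m\<in>S. \<forall>a\<in>A. a m = a k + t * (a k' - a k)"
    if "k \<in> S" "k' \<in> S" "0 < t" "t \<le> 1" for k k' and t :: real
    using that S_join[of k k' t] A_join[of _ k k' t]
    by (intro bexI[of _ "(1 - t) *\<^sub>R k + t *\<^sub>R k'"]) (auto simp: algebra_simps)
  fix F and r :: "('s \<Rightarrow> real) \<Rightarrow> real" assume F: "finite F" "F \<subseteq> A"
  have "L (\<lambda>x. \<Sum>a\<in>F. r a * a x) = (\<Sum>a\<in>F. r a * L a)" using F
  proof (induction F rule: finite_induct)
    case empty then show ?case using scale[OF A_zero, of 0] by simp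
  next
    case (insert b F)
    then show ?case using add[OF A_scale[of b "r b"] A_sum[of F r]] scale by auto
  qed
  then show "\<exists>s\<in>S. (\<Sum>a\<in>F. r a * L a) \<le> (\<Sum>a\<in>F. r a * a s)"
    using bound[OF A_sum[OF F, of r]] by simp
qed

lemma abs_le_sup_norm: "a \<in> A \<Longrightarrow> s \<in> S \<Longrightarrow> \<bar>a s\<bar> \<le> sup_norm_on S a"
proof -
  assume a: "a \<in> A" "s \<in> S"
  have "compact ((\<lambda>x. \<bar>a x\<bar>) ` S)"
    using A_cont[OF a(1)] S_compact by (intro compact_continuous_image continuous_intros)
  then have "bdd_above ((\<lambda>x. \<bar>a x\<bar>) ` S)" by (simp add: bounded_imp_bdd_above compact_imp_bounded)
  then show ?thesis unfolding sup_norm_on_def using a by (intro cSUP_upper) auto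
qed

lemma sup_norm_le: "S \<noteq> {} \<Longrightarrow> (\<And>s. s \<in> S \<Longrightarrow> \<bar>a s\<bar> \<le> c) \<Longrightarrow> sup_norm_on S a \<le> c"
  unfolding sup_norm_on_def by (rule cSUP_least)

text \<open>The difference of two evaluations kills constants, so only the distance of a function to
  the constants matters, and this is half of its oscillation; hence the factor \<open>N/2\<close>.
  The pair of points solves a moment problem on \<open>S \<times> S\<close>.\<close>

lemma difference_representation:
  assumes N: "N \<ge> 0" and x: "x \<in> S" "x' \<in> S"
    and bound: "\<And>a. a \<in> A \<Longrightarrow> \<bar>a x - a x'\<bar> \<le> N * sup_norm_on S a"
  shows "\<exists>y\<in>S. \<exists>y'\<in>S. \<forall>a\<in>A. N/2 * (a y - a y') = a x - a x'"
proof -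
  have "\<exists>k\<in>S \<times> S. \<forall>a\<in>A. N/2 * (a (fst k) - a (snd k)) = a x - a x'"
  proof (rule moment_problem_solvable[OF compact_Times[OF S_compact S_compact],
        where h = "\<lambda>a k. N/2 * (a (fst k) - a (snd k))" and L = "\<lambda>a. a x - a x'"])
    show "continuous_on (S \<times> S) (\<lambda>k. N/2 * (a (fst k) - a (snd k)))" if "a \<in> A" for a
      using A_cont[OF that] by (auto intro!: continuous_intros continuous_on_compose2[of S a])
    show "\<exists>m\<in>S \<times> S. \<forall>a\<in>A. N/2 * (a (fst m) - a (snd m))
        = N/2 * (a (fst k) - a (snd k)) + t * (N/2 * (a (fst k') - a (snd k')) - N/2 * (a (fst k) - a (snd k)))"
      if k: "k \<in> S \<times> S" "k' \<in> S \<times> S" and t: "0 < t" "t \<le> 1" for k k' :: "'s \<times> 's" and t :: real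
    proof (intro bexI ballI)
      let ?m = "((1 - t) *\<^sub>R fst k + t *\<^sub>R fst k', (1 - t) *\<^sub>R snd k + t *\<^sub>R snd k')"
      show "?m \<in> S \<times> S" using k t S_join by auto
      show "N/2 * (a (fst ?m) - a (snd ?m))
        = N/2 * (a (fst k) - a (snd k)) + t * (N/2 * (a (fst k') - a (snd k')) - N/2 * (a (fst k) - a (snd k)))"
        if "a \<in> A" for a
      proof -
        have e: "a (fst ?m) = (1 - t) * a (fst k) + t * a (fst k')"
             "a (snd ?m) = (1 - t) * a (snd k) + t * a (snd k')"
          using A_join[OF that, of "fst k" "fst k'" t] A_join[OF that, of "snd k" "snd k'" t] k t
          by auto
        show ?thesis unfolding e by (simp add: algebra_simps)
      qed
    qed
    fix F and r :: "('s \<Rightarrow> real) \<Rightarrow> real" assume F: "finite F" "F \<subseteq> A"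
    define b where "b = (\<lambda>x. \<Sum>a\<in>F. r a * a x)"
    have b: "b \<in> A" unfolding b_def using A_sum[OF F] .
    have ne: "S \<noteq> {}" using x by auto
    obtain y where y: "y \<in> S" "\<And>s. s \<in> S \<Longrightarrow> b s \<le> b y"
      using continuous_attains_sup[OF S_compact ne A_cont[OF b]] by blast
    obtain y' where y': "y' \<in> S" "\<And>s. s \<in> S \<Longrightarrow> b y' \<le> b s"
      using continuous_attains_inf[OF S_compact ne A_cont[OF b]] by blast
    \<comment> \<open>Subtracting the midrange halves the oscillation bound.\<close>
    define m where "m = (b y + b y') / 2"
    define c where "c = (\<lambda>x. b x + - 1 * (if x \<in> S then m else 0))"
    have c: "c \<in> A" unfolding c_def by (intro A_add A_scale b A_const)
    have "sup_norm_on S c \<le> (b y - b y') / 2"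
      using y(2) y'(2) by (intro sup_norm_le[OF ne]) (force simp: c_def m_def abs_le_iff field_simps)
    then have "N * sup_norm_on S c \<le> N * ((b y - b y') / 2)" using N by (rule mult_left_mono)
    then have "b x - b x' \<le> N/2 * (b y - b y')" using bound[OF c] x by (auto simp: c_def)
    moreover have "(\<Sum>a\<in>F. r a * (a x - a x')) = b x - b x'"
      by (simp add: b_def right_diff_distrib sum_subtractf)
    moreover have "(\<Sum>a\<in>F. r a * (N/2 * (a y - a y'))) = N/2 * (b y - b y')"
      unfolding b_def by (simp add: sum_distrib_left right_diff_distrib mult.left_commute flip: sum_subtractf)
    ultimately show "\<exists>k\<in>S \<times> S. (\<Sum>a\<in>F. r a * (a x - a x')) \<le> (\<Sum>a\<in>F. r a * (N/2 * (a (fst k) - a (snd k))))"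
      using y(1) y'(1) by (intro bexI[of _ "(y, y')"]) auto
  qed
  then show ?thesis by auto
qed

text \<open>An extreme point of \<open>S\<close> in the hull of two compact convex subsets would
  already lie in one of them, so the pieces can be joined one at a time.\<close>

lemma convex_cover_avoiding_extreme_point:
  assumes p: "p extreme_point_of S" and F: "finite F"
    and Q: "\<And>z. z \<in> F \<Longrightarrow> compact (Q z) \<and> convex (Q z) \<and> Q z \<subseteq> S \<and> p \<notin> Q z"
  shows "\<exists>D. compact D \<and> convex D \<and> D \<subseteq> S \<and> p \<notin> D \<and> (\<Union>z\<in>F. Q z) \<subseteq> D"
  using F Q
proof (induction F rule: finite_induct)
  case empty then show ?case by (intro exI[of _ "{}"]) auto
next
  case (insert z F)
  then obtain D where D: "compact D" "convex D" "D \<subseteq> S" "p \<notin> D" "(\<Union>z\<in>F. Q z) \<subseteq> D" by auto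
  have z: "compact (Q z)" "convex (Q z)" "Q z \<subseteq> S" "p \<notin> Q z" using insert.prems by auto
  show ?case
  \<comment> \<open>A join with the empty set is empty and would lose the other piece.\<close>
  proof (cases "D = {} \<or> Q z = {}")
    case True
    then show ?thesis
    proof
      assume "D = {}" then show ?thesis using D z by (intro exI[of _ "Q z"]) auto
    next
      assume "Q z = {}" then show ?thesis using D z by (intro exI[of _ D]) auto
    qed
  next
    case False
    define J where "J = join 0 D (Q z)"
    have "compact J" "convex J" unfolding J_def using D z by (auto intro: compact_join convex_join)
    moreover have "J \<subseteq> S"
    proof
      fix q assume "q \<in> J"
      then obtain t x y where "q = (1 - t) *\<^sub>R x + t *\<^sub>R y" "0 \<le> t" "t \<le> 1" "x \<in> D" "y \<in> Q z"
        unfolding J_def by (rule joinE)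
      then show "q \<in> S" using S_join[of x y t] D(3) z(3) by auto
    qed
    moreover have "p \<notin> J"
    proof
      assume "p \<in> J"
      then obtain t x y where txy: "p = (1 - t) *\<^sub>R x + t *\<^sub>R y" "0 \<le> t" "t \<le> 1" "x \<in> D" "y \<in> Q z"
        unfolding J_def by (rule joinE)
      show False
      proof (cases "t = 0")
        case True then show ?thesis using txy D by simp
      next
        case False
        then have "y = p" using extreme_point_eq[OF p, of x y t] txy D z by auto
        then show ?thesis using txy z by simp
      qed
    qed
    moreover have "D \<subseteq> J"
    proof
      fix x assume "x \<in> D"
      obtain y where "y \<in> Q z" using False by auto
      then show "x \<in> J" unfolding J_def using joinI[of 0 0 x D y "Q z"] \<open>x \<in> D\<close> by simp
    qed
    moreover have "Q z \<subseteq> J"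
    proof
      fix y assume "y \<in> Q z"
      obtain x where "x \<in> D" using False by auto
      then show "y \<in> J" unfolding J_def using joinI[of 0 1 x D y "Q z"] \<open>y \<in> Q z\<close> by simp
    qed
    ultimately show ?thesis using D(5) by (intro exI[of _ J]) auto
  qed
qed

text \<open>In substance this is Milman's converse to Krein-Milman. Finitely many closed half spaces
  that miss \<open>p\<close> cover \<open>B\<close>, and their traces on \<open>S\<close> are
  compact and convex.\<close>

lemma convex_avoiding_extreme_point:
  assumes p: "p extreme_point_of S" and B: "compact B" "B \<subseteq> S" "p \<notin> B"
  shows "\<exists>D. compact D \<and> convex D \<and> D \<subseteq> S \<and> p \<notin> D \<and> B \<subseteq> D"
proof -
  have "\<exists>\<phi>::'s \<Rightarrow> real. linear \<phi> \<and> continuous_on UNIV \<phi> \<and> \<phi> p < \<phi> z" if "z \<in> B" for z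
  proof -
    have "z \<noteq> p" using that B by auto
    then obtain \<phi> :: "'s \<Rightarrow> real" where \<phi>: "linear \<phi>" "continuous_on UNIV \<phi>" "\<phi> z \<noteq> \<phi> p"
      using continuous_linear_separates by blast
    show ?thesis
    proof (cases "\<phi> p < \<phi> z")
      case True then show ?thesis using \<phi> by blast
    next
      case False
      then have "linear (\<lambda>x. - \<phi> x)" "continuous_on UNIV (\<lambda>x. - \<phi> x)" "- \<phi> p < - \<phi> z"
        using \<phi> by (auto intro!: continuous_intros linear_compose_neg)
      then show ?thesis by blast
    qed
  qed
  then obtain \<phi> :: "'s \<Rightarrow> 's \<Rightarrow> real" where \<phi>: "\<And>z. z \<in> B \<Longrightarrow> linear (\<phi> z)" "\<And>z. z \<in> B \<Longrightarrow> continuous_on UNIV (\<phi> z)"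
    "\<And>z. z \<in> B \<Longrightarrow> \<phi> z p < \<phi> z z" by metis
  \<comment> \<open>The level halfway between the two values puts \<open>z\<close> inside the open
    half space and \<open>p\<close> outside the closed one.\<close>
  define c where "c z = (\<phi> z p + \<phi> z z) / 2" for z
  define W where "W z = {s. c z < \<phi> z s}" for z
  obtain F where F: "F \<subseteq> B" "finite F" "B \<subseteq> (\<Union>z\<in>F. W z)"
  proof (rule compactE_image[OF B(1), of B W])
    show "open (W z)" if "z \<in> B" for z
      unfolding W_def using \<phi>(2)[OF that] by (intro open_Collect_less continuous_intros) auto
    show "B \<subseteq> (\<Union>z\<in>B. W z)" using \<phi>(3) by (force simp: W_def c_def)
  qed blast
  define Q where "Q z = S \<inter> {s. c z \<le> \<phi> z s}" for z
  have "\<exists>D. compact D \<and> convex D \<and> D \<subseteq> S \<and> p \<notin> D \<and> (\<Union>z\<in>F. Q z) \<subseteq> D"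
  proof (rule convex_cover_avoiding_extreme_point[OF p F(2)], intro conjI)
    fix z assume "z \<in> F"
    then have z: "z \<in> B" using F by auto
    show "compact (Q z)" unfolding Q_def using \<phi>(2)[OF z] S_compact
      by (intro compact_Int_closed closed_Collect_le continuous_intros) auto
    have "convex {s. c z \<le> \<phi> z s}"
    proof (rule convexI, clarsimp)
      fix x y and u v :: real
      assume *: "c z \<le> \<phi> z x" "c z \<le> \<phi> z y" "0 \<le> u" "0 \<le> v" "u + v = 1"
      have "u * c z + v * c z \<le> u * \<phi> z x + v * \<phi> z y"
        using * by (intro add_mono mult_left_mono) auto
      then show "c z \<le> \<phi> z (u *\<^sub>R x + v *\<^sub>R y)"
        using * \<phi>(1)[OF z] by (simp add: linear_add linear_scale flip: distrib_right)
    qed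
    then show "convex (Q z)" unfolding Q_def using S_convex by (intro convex_Int)
    show "Q z \<subseteq> S" by (auto simp: Q_def)
    show "p \<notin> Q z" using \<phi>(3)[OF z] by (simp add: Q_def c_def)
  qed
  moreover have "B \<subseteq> (\<Union>z\<in>F. Q z)" using F(3) B(2) by (force simp: Q_def W_def)
  ultimately show ?thesis by blast
qed

text \<open>In other words, the upper envelope of \<open>f\<close> agrees with \<open>f\<close> at
  extreme points. The region where \<open>f\<close> exceeds \<open>f p\<close> by half of
  \<open>e\<close> lies in a compact convex set \<open>D\<close> without \<open>p\<close>, and the
  majorant has to rise only there.\<close>

lemma affine_majorant_at_extreme_point:
  assumes p: "p extreme_point_of S" and f: "continuous_on S f" and e: "e > 0"
  shows "\<exists>a\<in>A. (\<forall>s\<in>S. f s \<le> a s) \<and> a p \<le> f p + e"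
proof -
  have pS: "p \<in> S" using p by (simp add: extreme_point_of_def)
  then have ne: "S \<noteq> {}" by auto
  define e' where "e' = e / 2"
  have e': "e' > 0" using e by (simp add: e'_def)
  define B where "B = {s\<in>S. f p + e' \<le> f s}"
  have "closed B" unfolding B_def using f compact_imp_closed[OF S_compact]
    using continuous_closed_preimage[OF f _ closed_atLeast[of "f p + e'"]]
    by (simp add: vimage_def Int_def)
  then have "compact B" using compact_Int_closed[OF S_compact] by (metis B_def Int_absorb1 mem_Collect_eq subsetI)
  moreover have "B \<subseteq> S" "p \<notin> B" using e' by (auto simp: B_def)
  ultimately obtain D where D: "compact D" "convex D" "D \<subseteq> S" "p \<notin> D" "B \<subseteq> D"
    using convex_avoiding_extreme_point[OF p] by blast
  have fB: "f s \<le> f p + e'" if "s \<in> S" "s \<notin> B" for s using that by (auto simp: B_def)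
  show ?thesis
  proof (cases "D = {}")
    case True
    then have "f s \<le> f p + e" if "s \<in> S" for s using fB[OF that] D e by (auto simp: e'_def)
    then show ?thesis using A_const[of "f p + e"] pS by (intro bexI[OF _ A_const[of "f p + e"]]) auto
  next
    case False
    obtain z where z: "z \<in> S" "\<And>s. s \<in> S \<Longrightarrow> f s \<le> f z"
      using continuous_attains_sup[OF S_compact ne f] by blast
    define G where "G = f z - f p"
    have G: "G \<ge> 0" using z(2)[OF pS] by (simp add: G_def)
    \<comment> \<open>This weight makes \<open>G * d\<close> at most \<open>e'\<close>, the half of
      the error that the value of the majorant at \<open>p\<close> may still use.\<close>
    define d where "d = e' / (e' + G)"
    have d: "0 < d" "d \<le> 1" "G * d \<le> e'" using e' G by (auto simp: d_def field_simps)
    \<comment> \<open>Separating \<open>p\<close> from this join, and not only from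
      \<open>D\<close>, gives a quantitative estimate: above its minimum, \<open>h\<close> has risen
      at \<open>p\<close> by less than the fraction \<open>d\<close> of its rise at
      \<open>D\<close>.\<close>
    define Q where "Q = join d S D"
    have "compact Q" "convex Q" unfolding Q_def using D d S_compact S_convex
      by (auto intro: compact_join convex_join)
    moreover have "Q \<subseteq> S"
    proof
      fix q assume "q \<in> Q"
      then obtain t x y where "q = (1 - t) *\<^sub>R x + t *\<^sub>R y" "d \<le> t" "t \<le> 1" "x \<in> S" "y \<in> D"
        unfolding Q_def by (rule joinE)
      then show "q \<in> S" using S_join[of x y t] d D by auto
    qed
    moreover have "p \<notin> Q"
    proof
      assume "p \<in> Q"
      then obtain t x y where txy: "p = (1 - t) *\<^sub>R x + t *\<^sub>R y" "d \<le> t" "t \<le> 1" "x \<in> S" "y \<in> D"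
        unfolding Q_def by (rule joinE)
      then have "y = p" using extreme_point_eq[OF p, of x y t] d D by auto
      then show False using txy D by simp
    qed
    ultimately obtain h where h: "h \<in> A" "\<And>q. q \<in> Q \<Longrightarrow> h p < h q"
      using A_separation[of Q p] pS by blast
    obtain y0 where y0: "y0 \<in> S" "\<And>s. s \<in> S \<Longrightarrow> h y0 \<le> h s"
      using continuous_attains_inf[OF S_compact ne A_cont[OF h(1)]] by blast
    obtain x0 where x0: "x0 \<in> D" "\<And>s. s \<in> D \<Longrightarrow> h x0 \<le> h s"
      using continuous_attains_inf[OF D(1) False continuous_on_subset[OF A_cont[OF h(1)] D(3)]] by blast
    have "(1 - d) *\<^sub>R y0 + d *\<^sub>R x0 \<in> Q" unfolding Q_def using d y0(1) x0(1) by (intro joinI) auto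
    then have "h p < (1 - d) * h y0 + d * h x0"
      using h(2) A_join[OF h(1), of y0 x0 d] y0(1) x0(1) D(3) d by fastforce
    then have hp: "h p - h y0 < d * (h x0 - h y0)" by (simp add: algebra_simps)
    have "0 < d * (h x0 - h y0)" using hp y0(2)[OF pS] by linarith
    then have pos: "0 < h x0 - h y0" using d by (simp add: zero_less_mult_iff)
    \<comment> \<open>With this slope the rise from the minimum of \<open>h\<close> on
      \<open>S\<close> to its minimum on \<open>D\<close> is exactly \<open>G\<close>, enough to
      dominate \<open>f\<close> on \<open>B\<close>.\<close>
    define k where "k = G / (h x0 - h y0)"
    have k: "k \<ge> 0" "k * (h x0 - h y0) = G" using G pos by (auto simp: k_def)
    define a where "a = (\<lambda>s. (if s \<in> S then f p + e' - k * h y0 else 0) + k * h s)"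
    have aA: "a \<in> A" unfolding a_def by (intro A_add A_scale A_const h)
    have as: "a s = f p + e' + k * (h s - h y0)" if "s \<in> S" for s
      using that by (simp add: a_def algebra_simps)
    have "f s \<le> a s" if s: "s \<in> S" for s
    proof (cases "s \<in> B")
      case True
      have "h x0 \<le> h s" using x0(2) True D(5) by blast
      then have "G \<le> k * (h s - h y0)" unfolding k(2)[symmetric] using k(1) by (intro mult_left_mono) auto
      then show ?thesis using as[OF s] z(2)[OF s] e' by (simp add: G_def)
    next
      case False
      have "0 \<le> k * (h s - h y0)" using k(1) y0(2)[OF s] by simp
      then show ?thesis using as[OF s] fB[OF s False] by simp
    qed
    moreover have "a p \<le> f p + e"
    proof -
      have "k * (h p - h y0) \<le> k * (d * (h x0 - h y0))" using k(1) hp by (intro mult_left_mono) auto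
      also have "\<dots> = G * d" using k(2) by (metis mult.commute mult.left_commute)
      finally show ?thesis using as[OF pS] d(3) by (simp add: e'_def)
    qed
    ultimately show ?thesis using aA by blast
  qed
qed

end

section \<open>Borel sections and mixtures of measures\<close>

text \<open>
  The Kuratowski--Ryll-Nardzewski scheme: with each point of the image, approximate a preimage by
  the first member of a dense sequence that is close enough to a preimage lying in all the balls
  chosen before.
\<close>
theorem borel_section_exists:
  fixes B :: "'b::{metric_space, second_countable_topology} set" and \<pi> :: "'b \<Rightarrow> 'c::t2_space"
  assumes B: "compact B" and cont: "continuous_on B \<pi>"
  shows "\<exists>\<sigma>\<in>borel_measurable (restrict_space borel (\<pi> ` B)). \<forall>z\<in>\<pi> ` B. \<sigma> z \<in> B \<and> \<pi> (\<sigma> z) = z"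
proof -
  define M where "M = restrict_space (borel :: 'c measure) (\<pi> ` B)"
  have space_M: "space M = \<pi> ` B" by (simp add: M_def space_restrict_space)
  have sets_M: "K \<in> sets M" if "compact K" "K \<subseteq> \<pi> ` B" for K
  proof -
    have "K \<in> sets borel" using that(1) by (simp add: borel_closed compact_imp_closed)
    then have "\<pi> ` B \<inter> K \<in> sets M" unfolding M_def sets_restrict_space by (rule imageI)
    then show ?thesis using that(2) by (simp add: Int_absorb1)
  qed
  obtain D :: "'b set" where D: "countable D" "\<And>X. open X \<Longrightarrow> X \<noteq> {} \<Longrightarrow> \<exists>d\<in>D. d \<in> X"
    using countable_dense_setE by blast
  then have "D \<noteq> {}" by blast
  define q where "q = from_nat_into D"
  have q: "\<exists>i. dist (q i) w \<le> e" if e: "e > 0" for w and e :: real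
  proof -
    obtain d where "d \<in> D" "d \<in> ball w e" using D(2)[of "ball w e"] e by (auto simp: not_le)
    moreover obtain i where "q i = d" using from_nat_into_surj[OF D(1) \<open>d \<in> D\<close>] by (auto simp: q_def)
    ultimately have "dist (q i) w \<le> e" by (simp add: dist_commute)
    then show ?thesis by blast
  qed
  \<comment> \<open>A list records the indices chosen so far; its entry at position \<open>k\<close>
    confines the preimage to a ball of radius \<open>(1/2) ^ k\<close>.\<close>
  define H where "H l = B \<inter> (\<Inter>k<length l. cball (q (l ! k)) ((1/2) ^ k))" for l
  have H_compact: "compact (H l)" for l
    unfolding H_def by (intro compact_Int_closed B closed_INT) auto
  have H_sub: "H l \<subseteq> B" for l by (auto simp: H_def)
  have H_snoc: "H (l @ [i]) = H l \<inter> cball (q i) ((1/2) ^ length l)" for l i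
  proof -
    have "{..<Suc (length l)} = insert (length l) {..<length l}" by auto
    then show ?thesis by (auto simp: H_def nth_append)
  qed
  have img_compact: "compact (\<pi> ` H l)" for l
    using H_compact continuous_on_subset[OF cont H_sub] by (rule compact_continuous_image[rotated])
  \<comment> \<open>The images involved are compact, hence measurable, and so is the least
    admissible index.\<close>
  define sel where "sel l z = (LEAST i. z \<in> \<pi> ` H (l @ [i]))" for l z
  define code where "code = rec_nat (\<lambda>z. []) (\<lambda>n c z. c z @ [sel (c z) z])"
  have code_0: "code 0 z = []" and code_Suc: "code (Suc n) z = code n z @ [sel (code n z) z]" for n z
    by (simp_all add: code_def)
  have len: "length (code n z) = n" for n z by (induction n) (simp_all add: code_0 code_Suc)
  have sel_meas: "sel l \<in> measurable M (count_space UNIV)" for l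
    unfolding sel_def
  proof (rule measurable_Least)
    fix i
    have "\<pi> ` H (l @ [i]) \<in> sets M" by (intro sets_M img_compact image_mono H_sub)
    then show "Measurable.pred M (\<lambda>z. z \<in> \<pi> ` H (l @ [i]))" by measurable
  qed
  have code_meas: "code n \<in> measurable M (count_space UNIV)" for n
  proof (induction n)
    case 0 then show ?case by (simp add: code_0[abs_def])
  next
    case (Suc n)
    \<comment> \<open>The codes form a countable discrete type, so measurability in \<open>z\<close>
      for each fixed code is enough.\<close>
    have "(\<lambda>z. (\<lambda>l z. l @ [sel l z]) (code n z) z) \<in> measurable M (count_space UNIV)"
      using Suc
    proof (rule measurable_compose_countable[rotated])
      show "(\<lambda>z. l @ [sel l z]) \<in> measurable M (count_space UNIV)" for l
        by (rule measurable_compose[OF sel_meas]) simp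
    qed
    then show ?case by (simp add: code_Suc[abs_def])
  qed
  have inv: "z \<in> \<pi> ` H (code n z)" if z: "z \<in> \<pi> ` B" for n z
  proof (induction n)
    case 0 then show ?case using z by (simp add: code_0 H_def)
  next
    case (Suc n)
    then obtain w where w: "w \<in> H (code n z)" "z = \<pi> w" by auto
    obtain i where "dist (q i) w \<le> (1/2) ^ n" using q[of "(1/2) ^ n" w] by auto
    then have "z \<in> \<pi> ` H (code n z @ [i])" using w by (auto simp: H_snoc len)
    then show ?case unfolding code_Suc sel_def by (rule LeastI)
  qed
  \<comment> \<open>For fixed \<open>z\<close> these closed sets are nested and nonempty;
    compactness gives a common point, which is the value of the section.\<close>
  define C where "C z n = {w \<in> H (code n z). \<pi> w = z}" for z n
  have "\<exists>w. \<forall>n. w \<in> C z n" if z: "z \<in> \<pi> ` B" for z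
  proof -
    have anti: "C z n \<subseteq> C z m" if "m \<le> n" for m n
      by (rule lift_Suc_antimono_le[of "C z"]) (use that in \<open>auto simp: C_def code_Suc H_snoc\<close>)
    have "B \<inter> \<Inter> (C z ` UNIV) \<noteq> {}"
    proof (rule compact_imp_fip_image[OF B])
      show "closed (C z n)" for n
        unfolding C_def
        using continuous_closed_preimage_constant[OF continuous_on_subset[OF cont H_sub]
            compact_imp_closed[OF H_compact]] by simp
      fix I :: "nat set" assume I: "finite I"
      define m where "m = Max (insert 0 I)"
      obtain w where w: "w \<in> C z m" using inv[OF z, of m] by (auto simp: C_def)
      have "w \<in> C z n" if "n \<in> I" for n
        using w anti[of n m] that I by (auto simp: m_def)
      then have "w \<in> B \<inter> \<Inter> (C z ` I)" using w H_sub by (auto simp: C_def)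
      then show "B \<inter> \<Inter> (C z ` I) \<noteq> {}" by blast
    qed
    then show ?thesis by auto
  qed
  then obtain \<sigma> where \<sigma>: "\<And>z n. z \<in> \<pi> ` B \<Longrightarrow> \<sigma> z \<in> C z n" by metis
  have "\<sigma> \<in> borel_measurable M"
  proof (rule borel_measurable_LIMSEQ_metric)
    show "(\<lambda>z. q (last (code (Suc n) z))) \<in> borel_measurable M" for n
      by (rule measurable_compose[OF code_meas]) simp
    fix z assume "z \<in> space M"
    then have z: "z \<in> \<pi> ` B" by (simp add: space_M)
    \<comment> \<open>The code of length \<open>Suc n\<close> ends with position \<open>n\<close>,
      hence the exponent \<open>n\<close>.\<close>
    have d: "dist (q (last (code (Suc n) z))) (\<sigma> z) \<le> (1/2) ^ n" for n
      using \<sigma>[OF z, of "Suc n"] by (simp add: C_def code_Suc H_snoc len)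
    have "(\<lambda>n. dist (q (last (code (Suc n) z))) (\<sigma> z)) \<longlonglongrightarrow> 0"
    proof (rule tendsto_sandwich[of "\<lambda>_. 0"])
      show "(\<lambda>n. (1/2::real) ^ n) \<longlonglongrightarrow> 0" by (rule LIMSEQ_power_zero) simp
    qed (use d in auto)
    then show "(\<lambda>n. q (last (code (Suc n) z))) \<longlonglongrightarrow> \<sigma> z"
      by (simp add: tendsto_dist_iff[of _ "\<sigma> z"])
  qed
  moreover have "\<sigma> z \<in> B \<and> \<pi> (\<sigma> z) = z" if "z \<in> \<pi> ` B" for z
    using \<sigma>[OF that, of 0] H_sub by (auto simp: C_def)
  ultimately show ?thesis by (auto simp: M_def)
qed

text \<open>Encoding the convex combination as a Bernoulli choice of the measure lets the facts
  about \<open>bind\<close> supply measurability, total mass and integrals.\<close>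

definition mixture :: "real \<Rightarrow> 'b measure \<Rightarrow> 'b measure \<Rightarrow> 'b measure" where
  "mixture t M N = measure_pmf (bernoulli_pmf t) \<bind> (\<lambda>b. if b then M else N)"

context
  fixes M N K :: "'b measure" and t :: real
  assumes MN: "prob_space M" "prob_space N" "sets M = sets K" "sets N = sets K" and t: "0 \<le> t" "t \<le> 1"
begin

lemma mixture_kernel: "(\<lambda>b. if b then M else N) \<in> measurable (measure_pmf p) (subprob_algebra K)"
  using MN by (auto simp: measurable_def space_subprob_algebra prob_space_imp_subprob_space)

lemma sets_mixture: "sets (mixture t M N) = sets K"
  unfolding mixture_def by (rule sets_bind) (use MN in auto)

lemma prob_space_mixture: "prob_space (mixture t M N)"
  unfolding mixture_def
  by (rule measure_pmf.prob_space_bind[OF _ mixture_kernel]) (use MN in auto)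

lemma integral_mixture:
  assumes f: "f \<in> borel_measurable K" and bound: "\<And>x. x \<in> space K \<Longrightarrow> \<bar>f x\<bar> \<le> c"
  shows "(\<integral>x. f x \<partial>mixture t M N) = t * (\<integral>x. f x \<partial>M) + (1 - t) * (\<integral>x. f x \<partial>N)"
proof -
  have "(\<integral>x. f x \<partial>mixture t M N) = (\<integral>b. (\<integral>x. f x \<partial>(if b then M else N)) \<partial>measure_pmf (bernoulli_pmf t))"
    unfolding mixture_def
  proof (rule integral_bind[OF f bound mixture_kernel])
    show "AE b in measure_pmf (bernoulli_pmf t). emeasure (if b then M else N) (space (if b then M else N)) \<le> ennreal 1"
      using MN by (auto simp: prob_space.emeasure_space_1)
  qed (auto intro: measure_pmf.finite_measure)
  then show ?thesis using t by simp
qed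

lemma measure_mixture:
  assumes X: "X \<in> sets K"
  shows "measure (mixture t M N) X = t * measure M X + (1 - t) * measure N X"
proof -
  have sp: "space M = space K" "space N = space K" "space (mixture t M N) = space K"
    using MN sets_mixture by (auto dest: sets_eq_imp_space_eq)
  have "X \<subseteq> space K" using X sets.sets_into_space by blast
  then show ?thesis
    using integral_mixture[of "indicator X" 1] X sp by (simp add: Int_absorb2 indicator_le_1)
qed

end

section \<open>Maximal measures on a compact convex set with separable space of affine functions\<close>

lemma convex_on_max_fun:
  assumes "convex_on S f" "convex_on S g"
  shows "convex_on S (\<lambda>x. max (f x) (g x))"
  unfolding convex_on_def
proof (intro conjI ballI allI impI)
  show "convex S" using assms by (simp add: convex_on_def)
  fix x y and u v :: real assume *: "x \<in> S" "y \<in> S" "0 \<le> u" "0 \<le> v" "u + v = 1"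
  have "f (u *\<^sub>R x + v *\<^sub>R y) \<le> u * f x + v * f y" "g (u *\<^sub>R x + v *\<^sub>R y) \<le> u * g x + v * g y"
    using assms * by (auto simp: convex_on_def)
  moreover have "u * f x + v * f y \<le> u * max (f x) (g x) + v * max (f y) (g y)"
    "u * g x + v * g y \<le> u * max (f x) (g x) + v * max (f y) (g y)"
    using * by (auto intro!: add_mono mult_left_mono)
  ultimately show "max (f (u *\<^sub>R x + v *\<^sub>R y)) (g (u *\<^sub>R x + v *\<^sub>R y))
      \<le> u * max (f x) (g x) + v * max (f y) (g y)" by linarith
qed

locale separable_affine = compact_convex S for S :: "'s::hausdorff_lcs set" +
  fixes fn :: "nat \<Rightarrow> 's \<Rightarrow> real"
  assumes fn_A: "fn k \<in> affine_functions S"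
    and fn_dense: "a \<in> affine_functions S \<Longrightarrow> e > 0 \<Longrightarrow> \<exists>k. \<forall>s\<in>S. \<bar>fn k s - a s\<bar> < e"
    and S_nonempty: "S \<noteq> {}"
begin

abbreviation MS :: "'s measure" where "MS \<equiv> restrict_space borel S"

text \<open>A dense sequence in \<open>A\<close> separates points, so on the compact set
  \<open>S\<close> this map is a homeomorphism onto its image, with inverse \<open>\<kappa>\<close>.
  It stands in for a metric on \<open>S\<close>.\<close>

definition \<iota> :: "'s \<Rightarrow> nat \<Rightarrow> real" where "\<iota> s = (\<lambda>k. fn k s)"

definition \<kappa> :: "(nat \<Rightarrow> real) \<Rightarrow> 's" where "\<kappa> = the_inv_into S \<iota>"

lemma space_MS: "space MS = S"
  by (simp add: space_restrict_space)

lemma sets_MS: "X \<in> sets MS \<longleftrightarrow> X \<in> sets borel \<and> X \<subseteq> S"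
  using compact_imp_closed[OF S_compact] by (subst sets_restrict_space_iff) (auto simp: borel_closed)

lemma compact_sets_MS: "compact K \<Longrightarrow> K \<subseteq> S \<Longrightarrow> K \<in> sets MS"
  by (simp add: sets_MS borel_closed compact_imp_closed)

lemma fn_eq_imp_eq:
  assumes xy: "x \<in> S" "y \<in> S" and eq: "\<And>k. fn k x = fn k y"
  shows "x = y"
proof (rule A_eq_imp_eq[OF xy])
  fix a assume a: "a \<in> A"
  have "\<bar>a x - a y\<bar> \<le> 0"
  proof (rule field_le_epsilon)
    fix e :: real assume "e > 0"
    then obtain k where k: "\<And>s. s \<in> S \<Longrightarrow> \<bar>fn k s - a s\<bar> < e / 2" using fn_dense[OF a, of "e / 2"] by auto
    show "\<bar>a x - a y\<bar> \<le> 0 + e" using k[OF xy(1)] k[OF xy(2)] eq[of k] by linarith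
  qed
  then show "a x = a y" by simp
qed

lemma \<iota>_inj: "inj_on \<iota> S"
  by (rule inj_onI, rule fn_eq_imp_eq) (auto simp: \<iota>_def dest: fun_cong)

lemma \<iota>_cont: "continuous_on S \<iota>"
  unfolding \<iota>_def by (intro continuous_on_coordinatewise_then_product A_cont fn_A)

lemma \<kappa>_\<iota>: "s \<in> S \<Longrightarrow> \<kappa> (\<iota> s) = s"
  unfolding \<kappa>_def using \<iota>_inj by (rule the_inv_into_f_f)

lemma \<kappa>_cont: "continuous_on (\<iota> ` S) \<kappa>"
  using \<iota>_cont S_compact \<kappa>_\<iota> by (intro continuous_on_inv) auto

lemma \<iota>_compact: "compact (\<iota> ` S)"
  using \<iota>_cont S_compact by (rule compact_continuous_image)

lemma \<kappa>_S: "u \<in> \<iota> ` S \<Longrightarrow> \<kappa> u \<in> S"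
  using \<kappa>_\<iota> by auto

lemma \<iota>_measurable: "\<iota> \<in> borel_measurable MS"
  using \<iota>_cont by (rule borel_measurable_continuous_on_restrict)

lemma \<kappa>_measurable: "\<kappa> \<in> measurable (restrict_space borel (\<iota> ` S)) MS"
  by (rule measurable_restrict_space2)
    (auto simp: space_restrict_space \<kappa>_\<iota> intro: borel_measurable_continuous_on_restrict \<kappa>_cont)

lemma \<iota>_image_borel:
  assumes "B \<in> sets MS"
  shows "\<iota> ` B \<in> sets borel"
proof -
  have "\<kappa> -` B \<inter> space (restrict_space borel (\<iota> ` S)) \<in> sets (restrict_space borel (\<iota> ` S))"
    using \<kappa>_measurable assms by (rule measurable_sets)
  moreover have "\<kappa> -` B \<inter> space (restrict_space borel (\<iota> ` S)) = \<iota> ` B"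
    using assms by (auto simp: space_restrict_space sets_MS \<kappa>_\<iota>)
  moreover have "\<iota> ` S \<in> sets borel" using \<iota>_compact by (simp add: borel_closed compact_imp_closed)
  ultimately show ?thesis by (simp add: sets_restrict_space_iff)
qed

text \<open>The image measure under \<open>\<iota>\<close> lives on a Polish space, where finite
  Borel measures are inner regular; the compact sets are carried back by
  \<open>\<kappa>\<close>.\<close>

lemma regular_probI:
  assumes \<mu>: "prob_space \<mu>" and sets: "sets \<mu> = sets MS"
  shows "regular_prob S \<mu>"
  unfolding regular_prob_def
proof (intro conjI ballI \<mu> sets)
  fix B assume B: "B \<in> sets \<mu>"
  interpret prob_space \<mu> by (rule \<mu>)
  have sp: "space \<mu> = S" using sets_eq_imp_space_eq[OF sets] by (simp add: space_MS)
  have m: "\<iota> \<in> borel_measurable \<mu>" using \<iota>_measurable measurable_cong_sets[OF sets refl] by blast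
  define N where "N = distr \<mu> borel \<iota>"
  have N: "emeasure N (\<iota> ` C) = emeasure \<mu> C" if "C \<in> sets \<mu>" for C
  proof -
    have C: "C \<in> sets MS" using that sets by simp
    then have "C \<subseteq> S" by (simp add: sets_MS)
    then have "\<iota> -` (\<iota> ` C) \<inter> space \<mu> = C" using \<iota>_inj by (auto simp: sp dest: inj_onD)
    then show ?thesis unfolding N_def using \<iota>_image_borel[OF C] m by (simp add: emeasure_distr)
  qed
  have BS: "B \<subseteq> S" using B sets by (simp add: sets_MS)
  have "emeasure \<mu> B = emeasure N (\<iota> ` B)" using N[OF B] by simp
  also have "\<dots> = (SUP K\<in>{K. K \<subseteq> \<iota> ` B \<and> compact K}. emeasure N K)"
  proof (rule inner_regular)
    show "sets N = sets borel" by (simp add: N_def)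
    show "emeasure N (space N) \<noteq> \<infinity>"
      using prob_space.emeasure_space_1[OF prob_space_distr[OF m]] by (simp add: N_def)
    show "\<iota> ` B \<in> sets borel" using \<iota>_image_borel B sets by simp
  qed
  also have "\<dots> \<le> (SUP K\<in>{K. compact K \<and> K \<subseteq> B}. emeasure \<mu> K)"
  proof (rule SUP_least)
    fix K assume "K \<in> {K. K \<subseteq> \<iota> ` B \<and> compact K}"
    then have K: "K \<subseteq> \<iota> ` B" "compact K" by auto
    have KS: "K \<subseteq> \<iota> ` S" using K BS by auto
    have c: "compact (\<kappa> ` K)" using continuous_on_subset[OF \<kappa>_cont KS] K(2) by (rule compact_continuous_image)
    have s: "\<kappa> ` K \<subseteq> B"
    proof
      fix z assume "z \<in> \<kappa> ` K"
      then obtain t where t: "t \<in> B" "z = \<kappa> (\<iota> t)" using K(1) by blast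
      then show "z \<in> B" using BS \<kappa>_\<iota>[of t] by auto
    qed
    have "\<iota> ` \<kappa> ` K = K"
    proof -
      have "\<iota> (\<kappa> u) = u" if "u \<in> K" for u using that KS \<kappa>_\<iota> by auto
      then show ?thesis by (auto simp: image_image)
    qed
    moreover have "\<kappa> ` K \<in> sets \<mu>" using compact_sets_MS[OF c] s BS sets by auto
    ultimately have "emeasure N K = emeasure \<mu> (\<kappa> ` K)" using N[of "\<kappa> ` K"] by simp
    then show "emeasure N K \<le> (SUP K\<in>{K. compact K \<and> K \<subseteq> B}. emeasure \<mu> K)"
      using c s by (auto intro: SUP_upper)
  qed
  finally have "emeasure \<mu> B \<le> (SUP K\<in>{K. compact K \<and> K \<subseteq> B}. emeasure \<mu> K)" .
  moreover have "(SUP K\<in>{K. compact K \<and> K \<subseteq> B}. emeasure \<mu> K) \<le> emeasure \<mu> B"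
    using B by (intro SUP_least emeasure_mono) auto
  ultimately show "emeasure \<mu> B = (SUP K\<in>{K. compact K \<and> K \<subseteq> B}. emeasure \<mu> K)" by (rule antisym)
qed

text \<open>
  \<open>Z k m\<close> is the set of midpoints of two points of \<open>S\<close> at which \<open>fn k\<close> differs by at least
  \<open>1 / Suc m\<close>. These compact sets cover precisely the points of \<open>S\<close> that are not extreme.
\<close>

definition G :: "nat \<Rightarrow> nat \<Rightarrow> ((nat \<Rightarrow> real) \<times> (nat \<Rightarrow> real)) set" where
  "G k m = {w \<in> \<iota> ` S \<times> \<iota> ` S. 1 / real (Suc m) \<le> fst w k - snd w k}"

definition mid :: "(nat \<Rightarrow> real) \<times> (nat \<Rightarrow> real) \<Rightarrow> 's" where
  "mid w = (1/2) *\<^sub>R \<kappa> (fst w) + (1/2) *\<^sub>R \<kappa> (snd w)"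

definition Z :: "nat \<Rightarrow> nat \<Rightarrow> 's set" where "Z k m = mid ` G k m"

lemma G_compact: "compact (G k m)"
proof -
  have c: "compact (\<iota> ` S \<times> \<iota> ` S)" by (intro compact_Times \<iota>_compact)
  have "closed {w :: (nat \<Rightarrow> real) \<times> (nat \<Rightarrow> real). 1 / real (Suc m) \<le> fst w k - snd w k}"
    by (intro closed_Collect_le continuous_intros continuous_on_product_coordinates[THEN continuous_on_compose2[of UNIV]]) auto
  then have "compact ((\<iota> ` S \<times> \<iota> ` S) \<inter> {w. 1 / real (Suc m) \<le> fst w k - snd w k})"
    using c by (intro compact_Int_closed)
  then show ?thesis by (simp add: G_def Int_def)
qed

lemma mid_cont: "continuous_on (G k m) mid"
  unfolding mid_def
  by (intro continuous_intros continuous_on_compose2[OF \<kappa>_cont]) (auto simp: G_def)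

lemma mid_S: "w \<in> G k m \<Longrightarrow> mid w \<in> S"
  unfolding mid_def using S_join[of "\<kappa> (fst w)" "\<kappa> (snd w)" "1/2"] \<kappa>_S by (auto simp: G_def)

lemma Z_subset: "Z k m \<subseteq> S" by (auto simp: Z_def mid_S)

lemma Z_sets: "Z k m \<in> sets MS"
  unfolding Z_def
  by (intro compact_sets_MS compact_continuous_image mid_cont G_compact) (auto simp: mid_S)

lemma extreme_imp_not_Z:
  assumes p: "p extreme_point_of S"
  shows "p \<notin> Z k m"
proof
  assume "p \<in> Z k m"
  then obtain w where w: "w \<in> G k m" "p = mid w" by (auto simp: Z_def)
  then obtain x y where "w = (\<iota> x, \<iota> y)" "x \<in> S" "y \<in> S" by (auto simp: G_def)
  then have xy: "x \<in> S" "y \<in> S" "1 / real (Suc m) \<le> fn k x - fn k y"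
    "p = (1/2) *\<^sub>R x + (1/2) *\<^sub>R y" using w by (auto simp: G_def mid_def \<kappa>_\<iota>) (simp add: \<iota>_def)
  have "y = p" by (rule extreme_point_eq[OF p xy(1,2), of "1/2"]) (use xy(4) in simp_all)
  moreover have "x = p"
    by (rule extreme_point_eq[OF p xy(2,1), of "1/2"]) (use xy(4) in \<open>simp_all add: add.commute\<close>)
  moreover have "0 < 1 / real (Suc m)" by simp
  ultimately show False using xy(3) by simp
qed

lemma not_Z_imp_extreme:
  assumes s: "s \<in> S" and nZ: "\<And>k m. s \<notin> Z k m"
  shows "s extreme_point_of S"
proof (rule ccontr)
  assume "\<not> ?thesis"
  then obtain x y where xy: "x \<in> S" "y \<in> S" "s \<in> open_segment x y" using s by (auto simp: extreme_point_of_def)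
  then obtain u where u: "s = (1 - u) *\<^sub>R x + u *\<^sub>R y" "0 < u" "u < 1" "x \<noteq> y" by (auto simp: in_segment)
  \<comment> \<open>Moving by the distance to the nearer end in both directions keeps the points in
    the segment and makes \<open>s\<close> their midpoint.\<close>
  define d where "d = min u (1 - u)"
  have d: "0 < d" "0 \<le> u - d" "u + d \<le> 1" using u by (auto simp: d_def)
  define x' where "x' = s + d *\<^sub>R (y - x)"
  define y' where "y' = s - d *\<^sub>R (y - x)"
  have "x' = (1 - (u + d)) *\<^sub>R x + (u + d) *\<^sub>R y" "y' = (1 - (u - d)) *\<^sub>R x + (u - d) *\<^sub>R y"
    by (simp_all add: x'_def y'_def u(1) algebra_simps)
  then have S': "x' \<in> S" "y' \<in> S" using xy d u by (auto intro: S_join)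
  have mid: "s = (1/2) *\<^sub>R x' + (1/2) *\<^sub>R y'"
    by (simp add: x'_def y'_def scaleR_add_right scaleR_diff_right flip: scaleR_add_left)
  have "x' - y' = (d + d) *\<^sub>R (y - x)"
    unfolding x'_def y'_def scaleR_add_left by simp
  then have "x' \<noteq> y'" using d u by auto
  then obtain k where k: "fn k x' \<noteq> fn k y'" using fn_eq_imp_eq[OF S'] by blast
  have in_Z: "\<exists>m. (1/2) *\<^sub>R a + (1/2) *\<^sub>R b \<in> Z k m" if ab: "a \<in> S" "b \<in> S" "fn k b < fn k a" for a b
  proof -
    obtain m where "1 / real (Suc m) < fn k a - fn k b" using ab reals_Archimedean[of "fn k a - fn k b"]
      by (auto simp: inverse_eq_divide)
    then have "(\<iota> a, \<iota> b) \<in> G k m" using ab by (auto simp: G_def \<iota>_def)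
    then have "mid (\<iota> a, \<iota> b) \<in> Z k m" by (auto simp: Z_def)
    then show ?thesis using ab by (auto simp: mid_def \<kappa>_\<iota>)
  qed
  consider "fn k y' < fn k x'" | "fn k x' < fn k y'" using k by linarith
  then show False
  proof cases
    case 1 then show ?thesis using in_Z[OF S'] nZ mid by auto
  next
    case 2 then show ?thesis using in_Z[OF S'(2,1)] nZ mid by (auto simp: add.commute)
  qed
qed

section \<open>Maximal measures do not charge the sets of midpoints\<close>

lemma bounded_on_S: "continuous_on S f \<Longrightarrow> \<exists>c. \<forall>s\<in>S. \<bar>f s\<bar> \<le> (c::real)"
  using compact_continuous_image[OF _ S_compact, of f] compact_imp_bounded[of "f ` S"]
  by (auto simp: bounded_iff)

lemma integrable_continuous:
  assumes "prob_space \<mu>" "sets \<mu> = sets MS" and f: "continuous_on S f"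
  shows "integrable \<mu> (f :: 's \<Rightarrow> real)"
proof -
  interpret prob_space \<mu> by fact
  obtain c where c: "\<forall>s\<in>S. \<bar>f s\<bar> \<le> c" using bounded_on_S[OF f] by blast
  have "f \<in> borel_measurable MS" using f by (rule borel_measurable_continuous_on_restrict)
  then have "f \<in> borel_measurable \<mu>" using measurable_cong_sets[OF assms(2) refl] by blast
  then show ?thesis
    using c sets_eq_imp_space_eq[OF assms(2)]
    by (intro integrable_const_bound[of _ c]) (auto intro!: AE_I2 simp: space_MS)
qed

text \<open>Each \<open>s\<close> in \<open>Z k m\<close> is spread to the ends of a measurably
  chosen segment with midpoint \<open>s\<close>, half of the mass to each. The new measure is larger
  in the Choquet order, hence equal to \<open>\<mu>\<close> by maximality. The convex function
  \<open>(fn k)\<^sup>2\<close> however gains a fixed amount on \<open>Z k m\<close>, so that set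
  has no mass.\<close>

lemma maximal_null:
  assumes max: "maximal_prob S \<mu>"
  shows "measure \<mu> (Z k m) = 0"
proof -
  have \<mu>: "prob_space \<mu>" and sets: "sets \<mu> = sets MS" using max by (auto simp: maximal_prob_def regular_prob_def)
  interpret prob_space \<mu> by (rule \<mu>)
  have sp: "space \<mu> = S" using sets_eq_imp_space_eq[OF sets] by (simp add: space_MS)
  \<comment> \<open>The section takes values in pairs of coordinate sequences, a separable metric
    space; \<open>\<kappa>\<close> brings them back to \<open>S\<close>.\<close>
  obtain \<sigma> where \<sigma>: "\<sigma> \<in> borel_measurable (restrict_space borel (Z k m))"
    "\<And>z. z \<in> Z k m \<Longrightarrow> \<sigma> z \<in> G k m \<and> mid (\<sigma> z) = z"
    using borel_section_exists[OF G_compact mid_cont, of k m] unfolding Z_def by blast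
  define a where "a s = (if s \<in> Z k m then \<kappa> (fst (\<sigma> s)) else s)" for s
  define b where "b s = (if s \<in> Z k m then \<kappa> (snd (\<sigma> s)) else s)" for s
  have \<sigma>S: "fst (\<sigma> z) \<in> \<iota> ` S" "snd (\<sigma> z) \<in> \<iota> ` S" if "z \<in> Z k m" for z
    using \<sigma>(2)[OF that] by (auto simp: G_def)
  have aS: "a s \<in> S" and bS: "b s \<in> S" if "s \<in> S" for s using that \<sigma>S \<kappa>_S by (auto simp: a_def b_def)
  have mid: "(1/2) *\<^sub>R a s + (1/2) *\<^sub>R b s = s" if "s \<in> S" for s
    using \<sigma>(2)[of s] by (auto simp: a_def b_def mid_def simp flip: scaleR_add_left)
  have restr: "restrict_space MS (Z k m) = restrict_space borel (Z k m)"
    using Z_subset by (subst restrict_restrict_space)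
      (auto simp: Int_absorb1 compact_imp_closed S_compact borel_closed sets_MS intro: Z_sets[unfolded sets_MS, THEN conjunct1])
  have meas: "(\<lambda>s. if s \<in> Z k m then \<kappa> (g (\<sigma> s)) else s) \<in> measurable MS MS"
    if g: "g \<in> borel_measurable borel" "\<And>z. z \<in> Z k m \<Longrightarrow> g (\<sigma> z) \<in> \<iota> ` S" for g
  proof (subst measurable_If_restrict_space_iff)
    have Zeq: "{x \<in> space MS. x \<in> Z k m} = Z k m" using Z_subset by (auto simp: space_MS)
    show "{x \<in> space MS. x \<in> Z k m} \<in> sets MS" unfolding Zeq by (rule Z_sets)
    have "(\<lambda>s. g (\<sigma> s)) \<in> measurable (restrict_space borel (Z k m)) (restrict_space borel (\<iota> ` S))"
      using g \<sigma>(1) by (intro measurable_restrict_space2 measurable_compose[OF \<sigma>(1)])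
        (auto simp: space_restrict_space)
    then have "(\<lambda>s. \<kappa> (g (\<sigma> s))) \<in> measurable (restrict_space borel (Z k m)) MS"
      by (rule measurable_compose[OF _ \<kappa>_measurable])
    then show "(\<lambda>s. \<kappa> (g (\<sigma> s))) \<in> measurable (restrict_space MS {x. x \<in> Z k m}) MS \<and>
        (\<lambda>s. s) \<in> measurable (restrict_space MS {x. x \<notin> Z k m}) MS"
      by (simp add: restr measurable_restrict_space1)
  qed
  have am: "a \<in> measurable \<mu> MS" and bm: "b \<in> measurable \<mu> MS"
    using meas[of fst] meas[of snd] \<sigma>S measurable_cong_sets[OF sets refl]
    by (auto simp: a_def[abs_def] b_def[abs_def] borel_measurable_continuous_onI
        continuous_on_fst continuous_on_snd continuous_on_id)
  define \<nu> where "\<nu> = mixture (1/2) (distr \<mu> MS a) (distr \<mu> MS b)"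
  note mix = prob_space_distr[OF am] prob_space_distr[OF bm] sets_distr[of \<mu> MS a] sets_distr[of \<mu> MS b]
  have \<nu>: "prob_space \<nu>" "sets \<nu> = sets MS" unfolding \<nu>_def
    by (rule prob_space_mixture[OF mix] sets_mixture[OF mix]; simp)+
  have int: "(\<integral>s. f s \<partial>\<nu>) = (\<integral>s. (f (a s) + f (b s)) / 2 \<partial>\<mu>)"
    and fi: "integrable \<mu> (\<lambda>s. (f (a s) + f (b s)) / 2)"
    if f: "continuous_on S f" for f :: "'s \<Rightarrow> real"
  proof -
    obtain c where c: "\<forall>s\<in>S. \<bar>f s\<bar> \<le> c" using bounded_on_S[OF f] by blast
    have fm: "f \<in> borel_measurable MS" using f by (rule borel_measurable_continuous_on_restrict)
    have i: "integrable \<mu> (\<lambda>s. f (a s))" "integrable \<mu> (\<lambda>s. f (b s))"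
      using c aS bS measurable_compose[OF am fm] measurable_compose[OF bm fm]
      by (auto intro!: integrable_const_bound[of _ c] AE_I2 simp: sp)
    then show "integrable \<mu> (\<lambda>s. (f (a s) + f (b s)) / 2)" by auto
    have "(\<integral>s. f s \<partial>\<nu>) = 1/2 * (\<integral>s. f s \<partial>distr \<mu> MS a) + (1 - 1/2) * (\<integral>s. f s \<partial>distr \<mu> MS b)"
      unfolding \<nu>_def by (rule integral_mixture[OF mix _ _ fm, of _ c]) (use c in \<open>auto simp: space_MS\<close>)
    then show "(\<integral>s. f s \<partial>\<nu>) = (\<integral>s. (f (a s) + f (b s)) / 2 \<partial>\<mu>)"
      using i by (simp add: integral_distr[OF am fm] integral_distr[OF bm fm])
  qed
  have "choquet_le S \<mu> \<nu>"
    unfolding choquet_le_def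
  proof (intro allI impI)
    fix f :: "'s \<Rightarrow> real" assume f: "continuous_on S f" "convex_on S f"
    have "f s \<le> (f (a s) + f (b s)) / 2" if "s \<in> S" for s
    proof -
      have "f ((1/2) *\<^sub>R a s + (1/2) *\<^sub>R b s) \<le> 1/2 * f (a s) + 1/2 * f (b s)"
        using f(2)[unfolded convex_on_def, THEN conjunct2, rule_format, OF aS[OF that] bS[OF that],
            of "1/2" "1/2"] by simp
      then show ?thesis using mid[OF that] by simp
    qed
    then show "(\<integral>s. f s \<partial>\<mu>) \<le> (\<integral>s. f s \<partial>\<nu>)"
      unfolding int[OF f(1)] using integrable_continuous[OF \<mu> sets f(1)] fi[OF f(1)]
      by (intro integral_mono) (auto simp: sp)
  qed
  then have eq: "\<nu> = \<mu>" using max regular_probI[OF \<nu>] by (simp add: maximal_prob_def)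
  define f where "f s = (fn k s)\<^sup>2" for s
  have f: "continuous_on S f" unfolding f_def by (intro continuous_intros A_cont fn_A)
  \<comment> \<open>The mean of two squares exceeds the square of the mean by a quarter of the
    squared difference, and on \<open>Z k m\<close> the difference is at least
    \<open>1 / Suc m\<close>.\<close>
  define \<delta> where "\<delta> = (1 / real (Suc m))\<^sup>2 / 4"
  have gap: "\<delta> * indicator (Z k m) s \<le> (f (a s) + f (b s)) / 2 - f s" if s: "s \<in> S" for s
  proof -
    have "fn k ((1/2) *\<^sub>R a s + (1/2) *\<^sub>R b s) = 1/2 * fn k (a s) + 1/2 * fn k (b s)"
      using A_affine[OF fn_A aS[OF s] bS[OF s], of "1/2" "1/2"] by simp
    then have fs: "fn k s = (fn k (a s) + fn k (b s)) / 2" unfolding mid[OF s] by simp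
    have e: "(f (a s) + f (b s)) / 2 - f s = (fn k (a s) - fn k (b s))\<^sup>2 / 4"
      unfolding f_def fs by (simp add: power2_eq_square field_simps)
    show ?thesis
    proof (cases "s \<in> Z k m")
      case True
      have "1 / real (Suc m) \<le> fst (\<sigma> s) k - snd (\<sigma> s) k" using \<sigma>(2)[OF True] by (simp add: G_def)
      moreover have "fn k (\<kappa> u) = u k" if "u \<in> \<iota> ` S" for u using that \<kappa>_\<iota> by (auto simp: \<iota>_def)
      ultimately have "1 / real (Suc m) \<le> fn k (a s) - fn k (b s)"
        using \<sigma>S[OF True] True by (simp add: a_def b_def)
      then have "(1 / real (Suc m))\<^sup>2 \<le> (fn k (a s) - fn k (b s))\<^sup>2" by (intro power_mono) auto
      then show ?thesis unfolding e using True by (simp add: \<delta>_def)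
    qed (simp add: e)
  qed
  have "\<delta> * measure \<mu> (Z k m) = (\<integral>s. \<delta> * indicator (Z k m) s \<partial>\<mu>)"
    using Z_sets sets Z_subset by (simp add: sp Int_absorb2)
  also have "\<dots> \<le> (\<integral>s. (f (a s) + f (b s)) / 2 - f s \<partial>\<mu>)"
    using gap fi[OF f] integrable_continuous[OF \<mu> sets f] Z_sets sets
    by (intro integral_mono) (auto simp: sp intro!: integrable_real_indicator simp: less_top[symmetric])
  also have "\<dots> = (\<integral>s. f s \<partial>\<nu>) - (\<integral>s. f s \<partial>\<mu>)"
    using fi[OF f] integrable_continuous[OF \<mu> sets f] int[OF f] by simp
  also have "\<dots> = 0" by (simp add: eq)
  finally have "\<delta> * measure \<mu> (Z k m) \<le> 0" .
  moreover have "\<delta> > 0" by (simp add: \<delta>_def)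
  ultimately show ?thesis using measure_nonneg[of \<mu> "Z k m"] by (simp add: mult_le_0_iff order_antisym)
qed

end

text \<open>Each evaluation lowers the dimension by at most one: a function \<open>f0\<close> with
  \<open>f0 e \<noteq> 0\<close> spans a complement of the functions that vanish at
  \<open>e\<close>.\<close>

lemma determined_by_finite_imp_not_infinite_dimensional:
  fixes F :: "('b \<Rightarrow> real) set"
  assumes E: "finite E"
    and F0: "(\<lambda>x. 0) \<in> F"
    and Fadd: "\<And>f g. f \<in> F \<Longrightarrow> g \<in> F \<Longrightarrow> (\<lambda>x. f x + g x) \<in> F"
    and Fscale: "\<And>c f. f \<in> F \<Longrightarrow> (\<lambda>x. c * f x) \<in> F"
    and det: "\<And>f. f \<in> F \<Longrightarrow> (\<And>e. e \<in> E \<Longrightarrow> f e = 0) \<Longrightarrow> f = (\<lambda>x. 0)"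
  shows "\<not> infinite_dimensional F"
proof -
  have "\<exists>B. finite B \<and> B \<subseteq> F \<and> (\<forall>f\<in>F. \<exists>c. f = (\<lambda>x. \<Sum>b\<in>B. c b * b x))"
    using E F0 Fadd Fscale det
  proof (induction E arbitrary: F rule: finite_induct)
    case empty
    then show ?case by (intro exI[of _ "{}"]) auto
  next
    case (insert e E)
    define F' where "F' = {f \<in> F. f e = 0}"
    have "\<exists>B. finite B \<and> B \<subseteq> F' \<and> (\<forall>f\<in>F'. \<exists>c. f = (\<lambda>x. \<Sum>b\<in>B. c b * b x))"
    proof (rule insert.IH)
      show "f = (\<lambda>x. 0)" if "f \<in> F'" "\<And>e. e \<in> E \<Longrightarrow> f e = 0" for f
        by (rule insert.prems(4)) (use that in \<open>auto simp: F'_def\<close>)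
      show "(\<lambda>x. 0) \<in> F'" using insert.prems(1) by (simp add: F'_def)
      show "(\<lambda>x. f x + g x) \<in> F'" if "f \<in> F'" "g \<in> F'" for f g
        using that insert.prems(2)[of f g] by (simp add: F'_def)
      show "(\<lambda>x. c * f x) \<in> F'" if "f \<in> F'" for c f
        using that insert.prems(3)[of f c] by (simp add: F'_def)
    qed
    then obtain B where B: "finite B" "B \<subseteq> F'" "\<And>f. f \<in> F' \<Longrightarrow> \<exists>c. f = (\<lambda>x. \<Sum>b\<in>B. c b * b x)"
      by blast
    show ?case
    proof (cases "F' = F")
      case True then show ?thesis using B by blast
    next
      case False
      then obtain f0 where f0: "f0 \<in> F" "f0 e \<noteq> 0" by (auto simp: F'_def)
      have nB: "f0 \<notin> B" using B(2) f0 by (auto simp: F'_def)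
      have "\<exists>c. f = (\<lambda>x. \<Sum>b\<in>insert f0 B. c b * b x)" if f: "f \<in> F" for f
      proof -
        have "(\<lambda>x. f x + (- (f e / f0 e)) * f0 x) \<in> F'"
          unfolding F'_def using insert.prems(2)[OF f insert.prems(3)[OF f0(1), of "- (f e / f0 e)"]] f0(2)
          by simp
        then obtain c where c: "(\<lambda>x. f x + (- (f e / f0 e)) * f0 x) = (\<lambda>x. \<Sum>b\<in>B. c b * b x)"
          using B(3) by blast
        have "f x = (\<Sum>b\<in>insert f0 B. (c(f0 := f e / f0 e)) b * b x)" for x
        proof -
          have "(\<Sum>b\<in>B. (c(f0 := f e / f0 e)) b * b x) = (\<Sum>b\<in>B. c b * b x)"
            using nB by (intro sum.cong) auto
          then show ?thesis using fun_cong[OF c, of x] nB B(1) by simp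
        qed
        then show ?thesis by blast
      qed
      then show ?thesis using B(1,2) f0(1) by (intro exI[of _ "insert f0 B"]) (auto simp: F'_def)
    qed
  qed
  then show ?thesis by (simp add: infinite_dimensional_def)
qed

context separable_affine
begin

section \<open>Measures carried by the extreme points are maximal\<close>

lemma AE_extreme_point:
  assumes \<rho>: "prob_space \<rho>" "sets \<rho> = sets MS" and null: "\<And>k m. measure \<rho> (Z k m) = 0"
  shows "AE s in \<rho>. s extreme_point_of S"
proof -
  interpret prob_space \<rho> by fact
  have sp: "space \<rho> = S" using sets_eq_imp_space_eq[OF \<rho>(2)] by (simp add: space_MS)
  have "Z k m \<in> null_sets \<rho>" for k m
    using null[of k m] Z_sets \<rho>(2) by (intro null_setsI) (auto simp: emeasure_eq_measure)
  then have "AE s in \<rho>. s \<notin> Z k m" for k m by (rule AE_not_in)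
  then have "AE s in \<rho>. \<forall>k m. s \<notin> Z k m" by (simp add: AE_all_countable)
  then show ?thesis using AE_space by eventually_elim (auto simp: sp intro: not_Z_imp_extreme)
qed

text \<open>Raising the majorant by \<open>e / 3\<close> before approximating it within
  \<open>e / 3\<close> keeps the approximant above \<open>f\<close>. With countably many majorants,
  one sequence can serve all extreme points at once.\<close>

lemma fn_majorant_at_extreme_point:
  assumes p: "p extreme_point_of S" and f: "continuous_on S f" and e: "e > 0"
  shows "\<exists>k. (\<forall>s\<in>S. f s \<le> fn k s) \<and> fn k p \<le> f p + e"
proof -
  have pS: "p \<in> S" using p by (simp add: extreme_point_of_def)
  obtain a where a: "a \<in> A" "\<And>s. s \<in> S \<Longrightarrow> f s \<le> a s" "a p \<le> f p + e / 3"
    using affine_majorant_at_extreme_point[OF p f, of "e / 3"] e by auto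
  have "(\<lambda>s. a s + (if s \<in> S then e / 3 else 0)) \<in> A" by (intro A_add A_const a)
  from fn_dense[OF this, of "e / 3"] obtain k where
    k: "\<And>s. s \<in> S \<Longrightarrow> \<bar>fn k s - (a s + e / 3)\<bar> < e / 3" using e by auto
  have "f s \<le> fn k s" if "s \<in> S" for s using k[OF that] a(2)[OF that] by linarith
  moreover have "fn k p \<le> f p + e" using k[OF pS] a(3) by linarith
  ultimately show ?thesis by blast
qed

lemma A_minus_convex: "a \<in> A \<Longrightarrow> convex_on S (\<lambda>s. - a s)"
  unfolding convex_on_def using A_affine[of a] S_convex by (auto simp: algebra_simps)

lemma A_convex: "a \<in> A \<Longrightarrow> convex_on S a"
  unfolding convex_on_def using A_affine[of a] S_convex by auto

text \<open>Minima of more and more affine majorants are concave and decrease to \<open>f\<close> at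
  every extreme point, hence \<open>\<rho>\<close>-almost everywhere. For concave functions the
  Choquet order reverses the inequality of integrals, and this survives dominated convergence
  although \<open>f\<close> is merely continuous.\<close>

lemma choquet_le_integral_le:
  fixes f :: "'s \<Rightarrow> real"
  assumes \<rho>: "prob_space \<rho>" "sets \<rho> = sets MS" and null: "\<And>k m. measure \<rho> (Z k m) = 0"
    and \<nu>: "prob_space \<nu>" "sets \<nu> = sets MS" and le: "choquet_le S \<rho> \<nu>" and f: "continuous_on S f"
  shows "(\<integral>s. f s \<partial>\<nu>) \<le> (\<integral>s. f s \<partial>\<rho>)"
proof -
  interpret \<rho>: prob_space \<rho> by fact
  interpret \<nu>: prob_space \<nu> by fact
  have sp: "space \<rho> = S" "space \<nu> = S"
    using sets_eq_imp_space_eq[OF \<rho>(2)] sets_eq_imp_space_eq[OF \<nu>(2)] by (auto simp: space_MS)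
  obtain z where z: "z \<in> S" "\<And>s. s \<in> S \<Longrightarrow> f s \<le> f z"
    using continuous_attains_sup[OF S_compact S_nonempty f] by blast
  \<comment> \<open>Indices whose function is not above \<open>f\<close> get the constant maximum of
    \<open>f\<close>, so that every term is a majorant.\<close>
  define c where "c i = (if \<forall>s\<in>S. f s \<le> fn i s then fn i else (\<lambda>s. if s \<in> S then f z else 0))" for i
  have cA: "c i \<in> A" for i by (simp add: c_def fn_A A_const)
  have fc: "f s \<le> c i s" if "s \<in> S" for i s using that z by (auto simp: c_def)
  define g where "g = rec_nat (c 0) (\<lambda>n g s. min (g s) (c (Suc n) s))"
  have g_0: "g 0 = c 0" and g_Suc: "g (Suc n) = (\<lambda>s. min (g n s) (c (Suc n) s))" for n
    by (simp_all add: g_def)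
  have g_cont: "continuous_on S (g n)" for n
    by (induction n) (simp_all add: g_0 g_Suc continuous_on_min A_cont[OF cA])
  have g_concave: "convex_on S (\<lambda>s. - g n s)" for n
  proof (induction n)
    case 0 then show ?case by (simp add: g_0 A_minus_convex cA)
  next
    case (Suc n)
    have "(\<lambda>s. - g (Suc n) s) = (\<lambda>s. max (- g n s) (- c (Suc n) s))" by (auto simp: g_Suc)
    then show ?case using convex_on_max_fun[OF Suc A_minus_convex[OF cA, of "Suc n"]] by simp
  qed
  have fg: "f s \<le> g n s" if "s \<in> S" for n s
    by (induction n) (use fc that in \<open>auto simp: g_0 g_Suc\<close>)
  have gc: "i \<le> n \<Longrightarrow> g n s \<le> c i s" for n i s
  proof (induction n)
    case 0 then show ?case by (simp add: g_0)
  next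
    case (Suc n) then show ?case by (cases "i = Suc n") (auto simp: g_Suc min.coboundedI1)
  qed
  have lim: "(\<lambda>n. g n s) \<longlonglongrightarrow> f s" if s: "s extreme_point_of S" for s
  proof (rule LIMSEQ_I)
    fix e :: real assume e: "e > 0"
    have sS: "s \<in> S" using s by (simp add: extreme_point_of_def)
    obtain k where k: "\<forall>s\<in>S. f s \<le> fn k s" "fn k s \<le> f s + e / 2"
      using fn_majorant_at_extreme_point[OF s f, of "e / 2"] e by auto
    then have "c k = fn k" by (simp add: c_def)
    then have "norm (g n s - f s) < e" if "k \<le> n" for n
      using gc[OF that, of s] fg[OF sS, of n] k(2) e by simp
    then show "\<exists>N. \<forall>n\<ge>N. norm (g n s - f s) < e" by blast
  qed
  obtain b1 where b1: "\<forall>s\<in>S. \<bar>f s\<bar> \<le> b1" using bounded_on_S[OF f] by blast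
  obtain b2 where b2: "\<forall>s\<in>S. \<bar>c 0 s\<bar> \<le> b2" using bounded_on_S[OF A_cont[OF cA]] by blast
  have meas: "h \<in> borel_measurable \<rho>" if "continuous_on S h" for h :: "'s \<Rightarrow> real"
    using integrable_continuous[OF \<rho> that] by (rule borel_measurable_integrable)
  have "(\<lambda>n. \<integral>s. g n s \<partial>\<rho>) \<longlonglongrightarrow> (\<integral>s. f s \<partial>\<rho>)"
  proof (rule integral_dominated_convergence[where w = "\<lambda>_. b1 + b2"])
    show "AE s in \<rho>. (\<lambda>n. g n s) \<longlonglongrightarrow> f s"
      using AE_extreme_point[OF \<rho> null] by eventually_elim (rule lim)
    show "AE s in \<rho>. norm (g n s) \<le> b1 + b2" for n
    proof (rule AE_I2)
      fix s assume "s \<in> space \<rho>"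
      then have s: "s \<in> S" by (simp add: sp)
      show "norm (g n s) \<le> b1 + b2"
        using fg[OF s, of n] gc[of 0 n s] b1[rule_format, OF s] b2[rule_format, OF s] by simp
    qed
  qed (use meas f g_cont in auto)
  moreover have "(\<integral>s. f s \<partial>\<nu>) \<le> (\<integral>s. g n s \<partial>\<rho>)" for n
  proof -
    have "(\<integral>s. f s \<partial>\<nu>) \<le> (\<integral>s. g n s \<partial>\<nu>)"
      using fg by (intro integral_mono integrable_continuous \<nu> f g_cont) (auto simp: sp)
    also have "\<dots> \<le> (\<integral>s. g n s \<partial>\<rho>)"
    proof -
      have "continuous_on S (\<lambda>s. - g n s)" by (intro continuous_intros g_cont)
      then have "(\<integral>s. - g n s \<partial>\<rho>) \<le> (\<integral>s. - g n s \<partial>\<nu>)"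
        using le g_concave by (simp only: choquet_le_def)
      then show ?thesis by simp
    qed
    finally show ?thesis .
  qed
  ultimately show ?thesis by (intro LIMSEQ_le_const) auto
qed

text \<open>Sublevel sets of continuous convex functions are stable under intersection, as a maximum
  of convex functions is convex, and they generate the Borel sets. Their indicators are bounded
  limits of differences of continuous convex functions.\<close>

lemma measure_eqI_convex:
  assumes \<rho>: "prob_space \<rho>" "sets \<rho> = sets MS" and \<nu>: "prob_space \<nu>" "sets \<nu> = sets MS"
    and eq: "\<And>f. continuous_on S f \<Longrightarrow> convex_on S f \<Longrightarrow> (\<integral>s. f s \<partial>\<nu>) = (\<integral>s. f s \<partial>\<rho>)"
  shows "\<nu> = \<rho>"
proof -
  interpret \<rho>: prob_space \<rho> by fact
  interpret \<nu>: prob_space \<nu> by fact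
  have sp: "space \<rho> = S" "space \<nu> = S"
    using sets_eq_imp_space_eq[OF \<rho>(2)] sets_eq_imp_space_eq[OF \<nu>(2)] by (auto simp: space_MS)
  define E where "E = {{s\<in>S. g s \<le> 0} |g :: 's \<Rightarrow> real. continuous_on S g \<and> convex_on S g}"
  have E_Pow: "E \<subseteq> Pow S" by (auto simp: E_def)
  have E_sets: "E \<subseteq> sets MS"
  proof
    fix X assume "X \<in> E"
    then obtain g :: "'s \<Rightarrow> real" where g: "X = {s\<in>S. g s \<le> 0}" "continuous_on S g" by (auto simp: E_def)
    have "g \<in> borel_measurable MS" using g(2) by (rule borel_measurable_continuous_on_restrict)
    then have "{s\<in>space MS. g s \<le> 0} \<in> sets MS" by measurable
    then show "X \<in> sets MS" by (simp add: g space_MS)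
  qed
  have S_E: "S \<in> E"
    unfolding E_def using S_convex
    by (intro CollectI exI[of _ "\<lambda>_. 0"]) (auto simp: convex_on_const)
  \<comment> \<open>The sublevel sets of all \<open>fn k\<close> belong to \<open>E\<close>, so
    \<open>\<iota>\<close> is measurable for the generated algebra; a Borel set is the preimage of
    its Borel image under \<open>\<iota>\<close>.\<close>
  have sets_E: "sets MS = sigma_sets S E"
  proof
    show "sigma_sets S E \<subseteq> sets MS" using sets.sigma_sets_subset[OF E_sets] by (simp add: space_MS)
    have sp_sig: "space (sigma S E) = S" "sets (sigma S E) = sigma_sets S E" using E_Pow by auto
    have "(\<lambda>s. \<iota> s k) \<in> borel_measurable (sigma S E)" for k
    proof (rule borel_measurableI_le)
      fix y
      have "convex_on S (\<lambda>s. fn k s + - 1 * (if s \<in> S then y else 0))"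
        by (intro A_convex A_add A_scale fn_A A_const)
      moreover have "continuous_on S (\<lambda>s. fn k s + - 1 * (if s \<in> S then y else 0))"
        by (intro A_cont A_add A_scale fn_A A_const)
      moreover have "{s\<in>S. \<iota> s k \<le> y} = {s\<in>S. fn k s + - 1 * (if s \<in> S then y else 0) \<le> 0}"
        by (auto simp: \<iota>_def)
      ultimately have "{s\<in>S. \<iota> s k \<le> y} \<in> E"
        unfolding E_def by (intro CollectI exI[of _ "\<lambda>s. fn k s + - 1 * (if s \<in> S then y else 0)"] conjI)
      then show "{s\<in>space (sigma S E). \<iota> s k \<le> y} \<in> sets (sigma S E)" by (simp add: sp_sig)
    qed
    then have m: "\<iota> \<in> borel_measurable (sigma S E)" by (rule measurable_coordinatewise_then_product)
    show "sets MS \<subseteq> sigma_sets S E"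
    proof
      fix B assume B: "B \<in> sets MS"
      have "\<iota> -` (\<iota> ` B) \<inter> space (sigma S E) \<in> sets (sigma S E)"
        using m \<iota>_image_borel[OF B] by (rule measurable_sets)
      moreover have "\<iota> -` (\<iota> ` B) \<inter> S = B"
        using B \<iota>_inj by (auto simp: sets_MS dest: inj_onD)
      ultimately show "B \<in> sigma_sets S E" by (simp add: sp_sig)
    qed
  qed
  have le0: "measure \<nu> {s\<in>S. g s \<le> 0} = measure \<rho> {s\<in>S. g s \<le> 0}"
    if g: "continuous_on S g" "convex_on S g" for g :: "'s \<Rightarrow> real"
  proof -
    \<comment> \<open>The difference \<open>max 1 (h n s) - h n s\<close> is 1 where
      \<open>g s \<le> 0\<close> and vanishes as soon as
      \<open>real n * g s \<ge> 1\<close>.\<close>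
    define h where "h n s = max 0 (real n * g s)" for n s
    have h: "continuous_on S (h n)" "convex_on S (h n)" for n
      unfolding h_def using g S_convex
      by (auto intro!: continuous_intros convex_on_max_fun convex_on_cmul simp: convex_on_const)
    have k: "continuous_on S (\<lambda>s. max 1 (h n s))" "convex_on S (\<lambda>s. max 1 (h n s))" for n
      using h[of n] S_convex by (auto intro!: continuous_intros convex_on_max_fun simp: convex_on_const)
    have lim: "(\<lambda>n. max 1 (h n s) - h n s) \<longlonglongrightarrow> indicator {s\<in>S. g s \<le> 0} s" if s: "s \<in> S" for s
    proof (cases "g s \<le> 0")
      case True
      then have "h n s = 0" for n by (simp add: h_def mult_nonneg_nonpos)
      then show ?thesis using True s by simp
    next
      case False
      then obtain n0 where n0: "1 < real n0 * g s" using reals_Archimedean3[of "g s"] by auto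
      have "max 1 (h n s) - h n s = 0" if "n0 \<le> n" for n
      proof -
        have "real n0 * g s \<le> real n * g s" using that False by (intro mult_right_mono) auto
        then show ?thesis using n0 by (simp add: h_def)
      qed
      then have "\<forall>\<^sub>F n in sequentially. max 1 (h n s) - h n s = 0"
        unfolding eventually_sequentially by blast
      then show ?thesis using False by (simp add: tendsto_eventually)
    qed
    have conv: "(\<lambda>n. \<integral>s. max 1 (h n s) - h n s \<partial>\<tau>) \<longlonglongrightarrow> measure \<tau> {s\<in>S. g s \<le> 0}"
      if \<tau>: "prob_space \<tau>" "sets \<tau> = sets MS" for \<tau>
    proof -
      interpret \<tau>: prob_space \<tau> by fact
      have sp: "space \<tau> = S" using sets_eq_imp_space_eq[OF \<tau>(2)] by (simp add: space_MS)
      have X: "{s\<in>S. g s \<le> 0} \<in> sets \<tau>" using E_sets g \<tau>(2) by (auto simp: E_def)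
      have "(\<lambda>n. \<integral>s. max 1 (h n s) - h n s \<partial>\<tau>) \<longlonglongrightarrow> (\<integral>s. indicator {s\<in>S. g s \<le> 0} s \<partial>\<tau>)"
      proof (rule integral_dominated_convergence[where w = "\<lambda>_. 1"])
        show "(\<lambda>s. max 1 (h n s) - h n s) \<in> borel_measurable \<tau>" for n
          using integrable_continuous[OF \<tau> continuous_on_diff[OF k(1) h(1)]]
          by (rule borel_measurable_integrable)
        show "AE s in \<tau>. (\<lambda>n. max 1 (h n s) - h n s) \<longlonglongrightarrow> indicator {s\<in>S. g s \<le> 0} s"
          using lim by (intro AE_I2) (simp add: sp)
        show "AE s in \<tau>. norm (max 1 (h n s) - h n s) \<le> 1" for n
          by (intro AE_I2) (auto simp: h_def max_def)
      qed (use X in auto)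
      then show ?thesis using X by (simp add: sp Int_absorb2)
    qed
    have "(\<integral>s. max 1 (h n s) - h n s \<partial>\<nu>) = (\<integral>s. max 1 (h n s) - h n s \<partial>\<rho>)" for n
      using eq[OF h(1,2)] eq[OF k(1,2)] h(1) k(1)
        integrable_continuous[OF \<nu>] integrable_continuous[OF \<rho>] by simp
    then show ?thesis using conv[OF \<nu>] conv[OF \<rho>] LIMSEQ_unique by simp
  qed
  show ?thesis
  proof (rule measure_eqI_generator_eq[where E = E and \<Omega> = S and A = "\<lambda>_. S"])
    show "Int_stable E"
    proof (rule Int_stableI)
      fix X Y assume "X \<in> E" "Y \<in> E"
      then obtain f g :: "'s \<Rightarrow> real" where fg: "X = {s\<in>S. f s \<le> 0}" "Y = {s\<in>S. g s \<le> 0}"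
        "continuous_on S f" "continuous_on S g" "convex_on S f" "convex_on S g"
        by (auto simp: E_def)
      have "X \<inter> Y = {s\<in>S. max (f s) (g s) \<le> 0}" using fg by auto
      then show "X \<inter> Y \<in> E"
        unfolding E_def using continuous_on_max[OF fg(3,4)] convex_on_max_fun[OF fg(5,6)]
        by (intro CollectI exI[of _ "\<lambda>s. max (f s) (g s)"] conjI)
    qed
    show "emeasure \<nu> X = emeasure \<rho> X" if "X \<in> E" for X
      using that le0 by (auto simp: E_def \<rho>.emeasure_eq_measure \<nu>.emeasure_eq_measure)
  qed (use E_Pow S_E sets_E \<rho> \<nu> in \<open>auto simp: \<nu>.emeasure_eq_measure\<close>)
qed

text \<open>For convex \<open>f\<close> the order gives one inequality of integrals and
  \<open>choquet_le_integral_le\<close> the other; equality for all continuous convex functions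
  identifies the measures.\<close>

lemma maximal_probI:
  assumes \<rho>: "prob_space \<rho>" "sets \<rho> = sets MS" and null: "\<And>k m. measure \<rho> (Z k m) = 0"
  shows "maximal_prob S \<rho>"
  unfolding maximal_prob_def
proof (intro conjI allI impI)
  show "regular_prob S \<rho>" using \<rho> by (rule regular_probI)
  fix \<nu> assume "regular_prob S \<nu>" and le: "choquet_le S \<rho> \<nu>"
  then have \<nu>: "prob_space \<nu>" "sets \<nu> = sets MS" by (auto simp: regular_prob_def)
  show "\<nu> = \<rho>"
  proof (rule measure_eqI_convex[OF \<rho> \<nu>])
    fix f :: "'s \<Rightarrow> real" assume f: "continuous_on S f" "convex_on S f"
    then have "(\<integral>s. f s \<partial>\<rho>) \<le> (\<integral>s. f s \<partial>\<nu>)" using le by (simp add: choquet_le_def)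
    then show "(\<integral>s. f s \<partial>\<nu>) = (\<integral>s. f s \<partial>\<rho>)"
      using choquet_le_integral_le[OF \<rho> null \<nu> le f(1)] by simp
  qed
qed

end

section \<open>Separable Choquet simplices\<close>

locale separable_simplex = separable_affine +
  assumes simplex: "choquet_simplex S"
begin

definition \<mu> :: "'a \<Rightarrow> 'a measure" where
  "\<mu> x = (THE m. maximal_prob S m \<and> represents m x)"

lemma \<mu>_ex1: "x \<in> S \<Longrightarrow> \<exists>!m. maximal_prob S m \<and> represents m x"
  using simplex by (simp add: choquet_simplex_def)

lemma \<mu>_maximal: "x \<in> S \<Longrightarrow> maximal_prob S (\<mu> x)" and \<mu>_represents: "x \<in> S \<Longrightarrow> represents (\<mu> x) x"
  using theI'[OF \<mu>_ex1] by (simp_all add: \<mu>_def)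

lemma \<mu>_unique: "x \<in> S \<Longrightarrow> maximal_prob S m \<Longrightarrow> represents m x \<Longrightarrow> \<mu> x = m"
  using \<mu>_ex1 \<mu>_maximal \<mu>_represents by blast

lemma \<mu>_prob: "x \<in> S \<Longrightarrow> prob_space (\<mu> x)" and \<mu>_sets: "x \<in> S \<Longrightarrow> sets (\<mu> x) = sets MS"
  using \<mu>_maximal by (auto simp: maximal_prob_def regular_prob_def)

text \<open>Maximality amounts to null sets \<open>Z k m\<close>, a condition that mixtures inherit.
  The mixture also represents the right point, so uniqueness in the simplex applies.\<close>

lemma \<mu>_join:
  assumes xy: "x \<in> S" "y \<in> S" and t: "0 \<le> t" "t \<le> 1"
  shows "\<mu> (t *\<^sub>R x + (1 - t) *\<^sub>R y) = mixture t (\<mu> x) (\<mu> y)"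
proof (rule \<mu>_unique)
  note mix = \<mu>_prob[OF xy(1)] \<mu>_prob[OF xy(2)] \<mu>_sets[OF xy(1)] \<mu>_sets[OF xy(2)] t
  show "t *\<^sub>R x + (1 - t) *\<^sub>R y \<in> S" using S_convex xy t by (simp add: convex_def)
  show "maximal_prob S (mixture t (\<mu> x) (\<mu> y))"
  proof (rule maximal_probI)
    show "prob_space (mixture t (\<mu> x) (\<mu> y))" by (rule prob_space_mixture[OF mix])
    show "sets (mixture t (\<mu> x) (\<mu> y)) = sets MS" by (rule sets_mixture[OF mix])
    show "measure (mixture t (\<mu> x) (\<mu> y)) (Z k m) = 0" for k m
      using measure_mixture[OF mix Z_sets] maximal_null[OF \<mu>_maximal[OF xy(1)]]
        maximal_null[OF \<mu>_maximal[OF xy(2)]] by simp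
  qed
  show "represents (mixture t (\<mu> x) (\<mu> y)) (t *\<^sub>R x + (1 - t) *\<^sub>R y)"
    unfolding represents_def
  proof (intro allI impI)
    fix \<phi> :: "'a \<Rightarrow> real" assume \<phi>: "linear \<phi>" "continuous_on UNIV \<phi>"
    have c: "continuous_on S \<phi>" using \<phi>(2) by (rule continuous_on_subset) simp
    obtain b where b: "\<forall>s\<in>S. \<bar>\<phi> s\<bar> \<le> b" using bounded_on_S[OF c] by blast
    have "(\<integral>s. \<phi> s \<partial>mixture t (\<mu> x) (\<mu> y)) = t * (\<integral>s. \<phi> s \<partial>\<mu> x) + (1 - t) * (\<integral>s. \<phi> s \<partial>\<mu> y)"
      by (rule integral_mixture[OF mix borel_measurable_continuous_on_restrict[OF c], of b])
        (use b in \<open>auto simp: space_MS\<close>)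
    then show "(\<integral>s. \<phi> s \<partial>mixture t (\<mu> x) (\<mu> y)) = \<phi> (t *\<^sub>R x + (1 - t) *\<^sub>R y)"
      using \<mu>_represents[OF xy(1)] \<mu>_represents[OF xy(2)] \<phi>
      by (simp add: represents_def linear_add linear_scale)
  qed
qed

lemma measure_\<mu>_join:
  assumes "x \<in> S" "y \<in> S" "0 \<le> t" "t \<le> 1" "X \<in> sets MS"
  shows "measure (\<mu> (t *\<^sub>R x + (1 - t) *\<^sub>R y)) X = t * measure (\<mu> x) X + (1 - t) * measure (\<mu> y) X"
  unfolding \<mu>_join[OF assms(1-4)]
  by (rule measure_mixture[OF \<mu>_prob \<mu>_prob \<mu>_sets \<mu>_sets]) (use assms in auto)

text \<open>The point mass is maximal because an extreme point lies in none of the sets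
  \<open>Z k m\<close>.\<close>

lemma \<mu>_extreme_point:
  assumes p: "p extreme_point_of S"
  shows "\<mu> p = return MS p"
proof -
  have pS: "p \<in> S" using p by (simp add: extreme_point_of_def)
  show ?thesis
  proof (rule \<mu>_unique[OF pS])
    show "maximal_prob S (return MS p)"
    proof (rule maximal_probI)
      show "prob_space (return MS p)" by (rule prob_space_return) (simp add: space_MS pS)
      show "measure (return MS p) (Z k m) = 0" for k m
        using extreme_imp_not_Z[OF p] by (simp add: measure_return[OF Z_sets])
    qed simp
    show "represents (return MS p) p"
      unfolding represents_def
      by (intro allI impI integral_return borel_measurable_continuous_on_restrict)
        (auto simp: space_MS pS intro: continuous_on_subset)
  qed
qed

text \<open>The maximal measure of \<open>x\<close> is then a finite sum of point masses, so
  \<open>x\<close> is a convex combination of extreme points, and an affine function is determined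
  by its values there.\<close>

lemma finite_extreme_points_imp_not_infinite_dimensional:
  assumes fin: "finite {p. p extreme_point_of S}"
  shows "\<not> infinite_dimensional (affine_functions S)"
proof (rule determined_by_finite_imp_not_infinite_dimensional[OF fin A_zero A_add A_scale])
  fix f assume f: "f \<in> A" and f0: "\<And>e. e \<in> {p. p extreme_point_of S} \<Longrightarrow> f e = 0"
  define E where "E = {p. p extreme_point_of S}"
  have ES: "E \<subseteq> S" by (auto simp: E_def extreme_point_of_def)
  have finE: "finite E" using fin by (simp add: E_def)
  have "f x = 0" if x: "x \<in> S" for x
  proof -
    interpret prob_space "\<mu> x" by (rule \<mu>_prob[OF x])
    have ms: "{e} \<in> sets (\<mu> x)" if "e \<in> E" for e
      using that ES \<mu>_sets[OF x] compact_sets_MS[of "{e}"] by auto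
    have AE: "AE s in \<mu> x. s \<in> E"
      using AE_extreme_point[OF \<mu>_prob[OF x] \<mu>_sets[OF x] maximal_null[OF \<mu>_maximal[OF x]]]
      by (simp add: E_def)
    define w where "w e = measure (\<mu> x) {e}" for e
    have int: "(\<integral>s. \<phi> s \<partial>\<mu> x) = (\<Sum>e\<in>E. w e * \<phi> e)"
      if \<phi>: "continuous_on S \<phi>" for \<phi> :: "'a \<Rightarrow> real"
    proof -
      have "(\<integral>s. \<phi> s \<partial>\<mu> x) = (\<integral>s. (\<Sum>e\<in>E. \<phi> e * indicator {e} s) \<partial>\<mu> x)"
      proof (rule integral_cong_AE)
        show "\<phi> \<in> borel_measurable (\<mu> x)"
          using integrable_continuous[OF \<mu>_prob[OF x] \<mu>_sets[OF x] \<phi>] by (rule borel_measurable_integrable)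
        show "(\<lambda>s. \<Sum>e\<in>E. \<phi> e * indicator {e} s) \<in> borel_measurable (\<mu> x)"
          using ms by (intro borel_measurable_sum borel_measurable_times) auto
        show "AE s in \<mu> x. \<phi> s = (\<Sum>e\<in>E. \<phi> e * indicator {e} s)"
          using AE
        proof eventually_elim
          case (elim s)
          then show ?case using finE by (simp add: indicator_def if_distrib sum.delta cong: if_cong)
        qed
      qed
      also have "\<dots> = (\<Sum>e\<in>E. \<phi> e * w e)"
      proof (subst Bochner_Integration.integral_sum)
        show "integrable (\<mu> x) (\<lambda>s. \<phi> e * indicator {e} s)" if "e \<in> E" for e
          using ms[OF that] by (intro integrable_mult_right integrable_real_indicator) (simp_all add: less_top[symmetric])
        show "(\<Sum>e\<in>E. \<integral>s. \<phi> e * indicator {e} s \<partial>\<mu> x) = (\<Sum>e\<in>E. \<phi> e * w e)"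
          using ms ES sets_eq_imp_space_eq[OF \<mu>_sets[OF x]]
          by (intro sum.cong) (auto simp: w_def space_MS Int_absorb2)
      qed
      finally show ?thesis by (simp add: mult.commute)
    qed
    have w1: "(\<Sum>e\<in>E. w e) = 1" using int[OF continuous_on_const[of S 1]] prob_space by simp
    have neE: "E \<noteq> {}" using w1 by auto
    have yS: "(\<Sum>e\<in>E. w e *\<^sub>R e) \<in> S"
      using ES finE w1 S_convex by (intro convex_sum) (auto simp: w_def)
    have "x = (\<Sum>e\<in>E. w e *\<^sub>R e)"
    proof (rule ccontr)
      assume "x \<noteq> (\<Sum>e\<in>E. w e *\<^sub>R e)"
      then obtain \<phi> :: "'a \<Rightarrow> real" where \<phi>: "linear \<phi>" "continuous_on UNIV \<phi>" "\<phi> x \<noteq> \<phi> (\<Sum>e\<in>E. w e *\<^sub>R e)"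
        using continuous_linear_separates by blast
      have "\<phi> x = (\<Sum>e\<in>E. w e * \<phi> e)"
        using \<mu>_represents[OF x] \<phi> int[OF continuous_on_subset[OF \<phi>(2)]] by (simp add: represents_def)
      then show False using \<phi> by (simp add: linear_sum linear_scale)
    qed
    \<comment> \<open>Jensen's inequality for \<open>f\<close> and for \<open>- f\<close> replaces a
      formula for affine functions at finite convex combinations.\<close>
    moreover have "f (\<Sum>e\<in>E. w e *\<^sub>R e) \<le> (\<Sum>e\<in>E. w e * f e)"
      using ES w1 by (intro convex_on_sum[OF finE neE A_convex[OF f]]) (auto simp: w_def)
    moreover have "- f (\<Sum>e\<in>E. w e *\<^sub>R e) \<le> (\<Sum>e\<in>E. w e * - f e)"
      using ES w1 by (intro convex_on_sum[OF finE neE A_minus_convex[OF f]]) (auto simp: w_def)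
    moreover have "(\<Sum>e\<in>E. w e * f e) = 0" "(\<Sum>e\<in>E. w e * - f e) = 0"
      using f0 by (auto simp: E_def intro!: sum.neutral)
    ultimately show ?thesis by simp
  qed
  moreover have "f x = 0" if "x \<notin> S" for x using f that by (simp add: affine_functions_def)
  ultimately show "f = (\<lambda>x. 0)" by blast
qed auto

text \<open>
  The hypothesis bounds the norm of the difference of the evaluations at \<open>x\<close> and \<open>x'\<close> by \<open>N\<close>.
  Then \<open>x + (N/2) y' = x' + (N/2) y\<close> for suitable \<open>y, y' \<in> S\<close>, and \<open>\<mu>\<close> is affine.
\<close>
lemma sum_measure_difference_le:
  assumes N: "N \<ge> 0" and x: "x \<in> S" "x' \<in> S"
    and bound: "\<And>a. a \<in> A \<Longrightarrow> \<bar>a x - a x'\<bar> \<le> N * sup_norm_on S a"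
    and X: "\<And>n::nat. X n \<in> sets MS" and disj: "disjoint_family X" and Un: "(\<Union>n. X n) = S"
  shows "summable (\<lambda>n. \<bar>measure (\<mu> x) (X n) - measure (\<mu> x') (X n)\<bar>)"
    and "(\<Sum>n. \<bar>measure (\<mu> x) (X n) - measure (\<mu> x') (X n)\<bar>) \<le> N"
proof -
  obtain y y' where y: "y \<in> S" "y' \<in> S" "\<And>a. a \<in> A \<Longrightarrow> N/2 * (a y - a y') = a x - a x'"
  proof -
    have "\<exists>y\<in>S. \<exists>y'\<in>S. \<forall>a\<in>A. N/2 * (a y - a y') = a x - a x'"
      by (rule difference_representation[OF N x]) (rule bound)
    then show thesis using that by auto
  qed
  define u where "u = N / 2"
  have u: "u \<ge> 0" using N by (simp add: u_def)
  \<comment> \<open>Dividing \<open>x + u y' = x' + u y\<close> by \<open>1 + u\<close> turns both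
    sides into convex combinations, to which affinity of \<open>\<mu>\<close> applies.\<close>
  define t where "t = 1 / (1 + u)"
  have t: "0 \<le> t" "t \<le> 1" "t > 0" "1 - t = u * t" using u by (auto simp: t_def field_simps)
  have eq: "t *\<^sub>R x + (1 - t) *\<^sub>R y' = t *\<^sub>R x' + (1 - t) *\<^sub>R y"
  proof (rule A_eq_imp_eq)
    show "t *\<^sub>R x + (1 - t) *\<^sub>R y' \<in> S" "t *\<^sub>R x' + (1 - t) *\<^sub>R y \<in> S"
      using S_convex x y t by (auto simp: convex_def)
    fix a assume a: "a \<in> A"
    have "t * (a x - a x') = (1 - t) * (a y - a y')"
      using y(3)[OF a] by (simp add: t(4) u_def)
    moreover have "a (t *\<^sub>R x + (1 - t) *\<^sub>R y') = t * a x + (1 - t) * a y'"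
      "a (t *\<^sub>R x' + (1 - t) *\<^sub>R y) = t * a x' + (1 - t) * a y"
      using t by (auto intro!: A_affine[OF a] x y)
    ultimately show "a (t *\<^sub>R x + (1 - t) *\<^sub>R y') = a (t *\<^sub>R x' + (1 - t) *\<^sub>R y)"
      by (simp only:) (simp add: algebra_simps)
  qed
  have diff: "measure (\<mu> x) (X n) - measure (\<mu> x') (X n) = u * (measure (\<mu> y) (X n) - measure (\<mu> y') (X n))" for n
  proof -
    have "t * measure (\<mu> x) (X n) + (1 - t) * measure (\<mu> y') (X n)
        = t * measure (\<mu> x') (X n) + (1 - t) * measure (\<mu> y) (X n)"
      using measure_\<mu>_join[OF x(1) y(2) t(1,2) X[of n]] measure_\<mu>_join[OF x(2) y(1) t(1,2) X[of n]]
      by (simp add: eq)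
    then have "t * (measure (\<mu> x) (X n) - measure (\<mu> x') (X n))
        = t * (u * (measure (\<mu> y) (X n) - measure (\<mu> y') (X n)))"
      unfolding t(4) by (simp add: algebra_simps)
    then show ?thesis using t(3) by simp
  qed
  have sums: "(\<lambda>n. measure (\<mu> z) (X n)) sums 1" if z: "z \<in> S" for z
  proof -
    interpret prob_space "\<mu> z" by (rule \<mu>_prob[OF z])
    have "space (\<mu> z) = S" using sets_eq_imp_space_eq[OF \<mu>_sets[OF z]] by (simp add: space_MS)
    then show ?thesis
      using finite_measure_UNION[OF _ disj] X \<mu>_sets[OF z] Un prob_space by auto
  qed
  have le: "\<bar>measure (\<mu> x) (X n) - measure (\<mu> x') (X n)\<bar> \<le> u * (measure (\<mu> y) (X n) + measure (\<mu> y') (X n))" for n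
  proof -
    have "\<bar>measure (\<mu> y) (X n) - measure (\<mu> y') (X n)\<bar> \<le> measure (\<mu> y) (X n) + measure (\<mu> y') (X n)"
      using measure_nonneg[of "\<mu> y" "X n"] measure_nonneg[of "\<mu> y'" "X n"] by linarith
    then show ?thesis unfolding diff using u by (simp add: abs_mult mult_left_mono)
  qed
  have s: "(\<lambda>n. u * (measure (\<mu> y) (X n) + measure (\<mu> y') (X n))) sums (u * (1 + 1))"
    by (intro sums_mult sums_add sums y)
  show *: "summable (\<lambda>n. \<bar>measure (\<mu> x) (X n) - measure (\<mu> x') (X n)\<bar>)"
    by (rule summable_comparison_test'[OF sums_summable[OF s], of 0]) (use le in auto)
  have "(\<Sum>n. \<bar>measure (\<mu> x) (X n) - measure (\<mu> x') (X n)\<bar>) \<le> u * (1 + 1)"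
    using suminf_le[OF le * sums_summable[OF s]] sums_unique[OF s] by simp
  then show "(\<Sum>n. \<bar>measure (\<mu> x) (X n) - measure (\<mu> x') (X n)\<bar>) \<le> N" by (simp add: u_def)
qed

text \<open>
  \<open>Q n s\<close> is the mass that the maximal measure of \<open>s\<close> gives to the extreme point \<open>e n\<close>, except
  that \<open>Q 0 s\<close> collects the mass of the complement of the other extreme points of the sequence.
\<close>
theorem l1_coordinates_exist:
  assumes inf: "infinite_dimensional (affine_functions S)"
  obtains e :: "nat \<Rightarrow> 'a" and Q :: "nat \<Rightarrow> 'a \<Rightarrow> real"
  where "\<And>n. e n \<in> S" "\<And>n s. 0 \<le> Q n s" "\<And>s. s \<in> S \<Longrightarrow> (\<lambda>n. Q n s) sums 1" "\<And>n. Q n (e n) = 1"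
    "\<And>n x y t. x \<in> S \<Longrightarrow> y \<in> S \<Longrightarrow> 0 \<le> t \<Longrightarrow> t \<le> 1 \<Longrightarrow>
      Q n (t *\<^sub>R x + (1 - t) *\<^sub>R y) = t * Q n x + (1 - t) * Q n y"
    "\<And>x x' N. x \<in> S \<Longrightarrow> x' \<in> S \<Longrightarrow> N \<ge> 0 \<Longrightarrow>
      (\<And>a. a \<in> affine_functions S \<Longrightarrow> \<bar>a x - a x'\<bar> \<le> N * sup_norm_on S a) \<Longrightarrow>
      summable (\<lambda>n. \<bar>Q n x - Q n x'\<bar>) \<and> (\<Sum>n. \<bar>Q n x - Q n x'\<bar>) \<le> N"
proof -
  have "infinite {p. p extreme_point_of S}"
    using inf finite_extreme_points_imp_not_infinite_dimensional by blast
  then obtain e :: "nat \<Rightarrow> 'a" where e: "inj e" "range e \<subseteq> {p. p extreme_point_of S}"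
    using infinite_countable_subset by blast
  then have ext: "e n extreme_point_of S" for n by auto
  then have eS: "e n \<in> S" for n by (auto simp: extreme_point_of_def)
  define X where "X n = (if n = 0 then S - (\<Union>i. {e (Suc i)}) else {e n})" for n
  have pt: "{e n} \<in> sets MS" for n by (rule compact_sets_MS) (use eS in auto)
  have XM: "X n \<in> sets MS" for n
  proof -
    have "S \<in> sets MS" by (rule compact_sets_MS[OF S_compact]) simp
    then show ?thesis using pt by (auto simp: X_def)
  qed
  have disj: "disjoint_family X"
  proof -
    have "X m \<inter> X n = {}" if "m < n" for m n
      using that injD[OF e(1)] by (cases n) (auto simp: X_def)
    then show ?thesis unfolding disjoint_family_on_def by (metis Int_commute linorder_neqE_nat)
  qed
  have Un: "(\<Union>n. X n) = S"
  proof
    show "(\<Union>n. X n) \<subseteq> S" using XM by (auto simp: sets_MS)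
    show "S \<subseteq> (\<Union>n. X n)"
    proof
      fix s assume "s \<in> S"
      then have "s \<in> X 0 \<or> (\<exists>i. s \<in> X (Suc i))" by (auto simp: X_def)
      then show "s \<in> (\<Union>n. X n)" by blast
    qed
  qed
  have eX: "e n \<in> X n" for n using eS injD[OF e(1)] by (auto simp: X_def)
  define Q where "Q n s = measure (\<mu> s) (X n)" for n s
  show thesis
  proof
    show "(\<lambda>n. Q n s) sums 1" if s: "s \<in> S" for s
    proof -
      interpret prob_space "\<mu> s" by (rule \<mu>_prob[OF s])
      have "space (\<mu> s) = S" using sets_eq_imp_space_eq[OF \<mu>_sets[OF s]] by (simp add: space_MS)
      then show ?thesis unfolding Q_def
        using finite_measure_UNION[OF _ disj] XM \<mu>_sets[OF s] Un prob_space by auto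
    qed
    show "Q n (e n) = 1" for n
      unfolding Q_def \<mu>_extreme_point[OF ext] measure_return[OF XM] using eX by simp
    show "Q n (t *\<^sub>R x + (1 - t) *\<^sub>R y) = t * Q n x + (1 - t) * Q n y"
      if "x \<in> S" "y \<in> S" "0 \<le> t" "t \<le> 1" for n x y t
      unfolding Q_def using measure_\<mu>_join[OF that XM] .
    show "summable (\<lambda>n. \<bar>Q n x - Q n x'\<bar>) \<and> (\<Sum>n. \<bar>Q n x - Q n x'\<bar>) \<le> N"
      if "x \<in> S" "x' \<in> S" "N \<ge> 0" "\<And>a. a \<in> A \<Longrightarrow> \<bar>a x - a x'\<bar> \<le> N * sup_norm_on S a" for x x' N
      unfolding Q_def
      by (intro conjI sum_measure_difference_le[OF that(3,1,2) _ XM disj Un]) (rule that(4), assumption)+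
  qed (auto simp: Q_def eS)
qed

end

section \<open>Weak* compactness\<close>

text \<open>Banach-Alaoglu for a slice of the dual ball: linearity and the prescribed values are
  closed conditions in a Tychonoff-compact product of intervals, and \<open>Blinfun\<close> is
  continuous from there to the weak* topology.\<close>

lemma compactin_weak_star_slice:
  fixes Y :: "'a::real_normed_vector set"
  shows "compactin weak_star {F :: 'a \<Rightarrow>\<^sub>L real. norm F \<le> 1 \<and> blinfun_apply F z = 1 \<and> (\<forall>y\<in>Y. blinfun_apply F y = 0)}"
    (is "compactin _ ?C")
proof -
  define P where "P = {f :: 'a \<Rightarrow> real. (\<forall>x y. f (x + y) = f x + f y) \<and> (\<forall>c x. f (c *\<^sub>R x) = c * f x)
      \<and> (\<forall>x. f x \<in> {- norm x..norm x}) \<and> f z = 1 \<and> (\<forall>y\<in>Y. f y = 0)}"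
  have coord: "continuous_on UNIV (\<lambda>f :: 'a \<Rightarrow> real. f x)" for x
    by (rule continuous_on_product_coordinates)
  have "compactin (product_topology (\<lambda>_. euclidean) UNIV) (PiE UNIV (\<lambda>x::'a. {- norm x..norm x}))"
    by (simp add: compactin_PiE)
  then have "compact (PiE UNIV (\<lambda>x::'a. {- norm x..norm x}))"
    by (simp add: euclidean_product_topology)
  moreover have "closed {f :: 'a \<Rightarrow> real. (\<forall>x y. f (x + y) = f x + f y) \<and> (\<forall>c x. f (c *\<^sub>R x) = c * f x)
      \<and> f z = 1 \<and> (\<forall>y. y \<in> Y \<longrightarrow> f y = 0)}"
    by (intro closed_Collect_conj closed_Collect_all closed_Collect_imp closed_Collect_eq
        continuous_intros coord open_Collect_const)
  ultimately have "compact (PiE UNIV (\<lambda>x::'a. {- norm x..norm x}) \<inter>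
      {f :: 'a \<Rightarrow> real. (\<forall>x y. f (x + y) = f x + f y) \<and> (\<forall>c x. f (c *\<^sub>R x) = c * f x)
      \<and> f z = 1 \<and> (\<forall>y. y \<in> Y \<longrightarrow> f y = 0)})"
    by (rule compact_Int_closed)
  moreover have "PiE UNIV (\<lambda>x::'a. {- norm x..norm x}) \<inter>
      {f :: 'a \<Rightarrow> real. (\<forall>x y. f (x + y) = f x + f y) \<and> (\<forall>c x. f (c *\<^sub>R x) = c * f x)
      \<and> f z = 1 \<and> (\<forall>y. y \<in> Y \<longrightarrow> f y = 0)} = P"
    by (auto simp: P_def PiE_iff)
  ultimately have P: "compact P" by simp
  have apply_Blinfun: "blinfun_apply (Blinfun f) = f" if "f \<in> P" for f
  proof (rule bounded_linear_Blinfun_apply, rule bounded_linear_intro[where K = 1])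
    fix x
    have "f x \<in> {- norm x..norm x}" using that by (simp add: P_def)
    then show "norm (f x) \<le> norm x * 1" by auto
  qed (use that in \<open>auto simp: P_def\<close>)
  have "continuous_map (subtopology euclidean P) weak_star Blinfun"
    unfolding continuous_on_strong_operator_topo_iff_coordinatewise
  proof
    fix x
    have "continuous_on P (\<lambda>f. blinfun_apply (Blinfun f) x)"
      using continuous_on_subset[OF coord[of x]] by (rule continuous_on_eq) (auto simp: apply_Blinfun)
    then show "continuous_map (subtopology euclidean P) euclidean (\<lambda>f. blinfun_apply (Blinfun f) x)" by simp
  qed
  then have "compactin weak_star (Blinfun ` P)"
    using P by (intro image_compactin) (auto simp: compactin_subtopology)
  moreover have "Blinfun ` P = ?C"
  proof
    show "Blinfun ` P \<subseteq> ?C"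
    proof (intro image_subsetI CollectI conjI)
      fix f assume f: "f \<in> P"
      show "norm (Blinfun f) \<le> 1"
      proof (rule norm_blinfun_bound)
        fix x
        have "f x \<in> {- norm x..norm x}" using f by (simp add: P_def)
        then show "norm (blinfun_apply (Blinfun f) x) \<le> 1 * norm x" by (auto simp: apply_Blinfun[OF f])
      qed simp
    qed (auto simp: apply_Blinfun, auto simp: P_def)
    show "?C \<subseteq> Blinfun ` P"
    proof
      fix F assume F: "F \<in> ?C"
      have "\<bar>blinfun_apply F x\<bar> \<le> norm x" for x
        using norm_blinfun[of F x] mult_right_mono[of "norm F" 1 "norm x"] F by auto
      then have "blinfun_apply F x \<in> {- norm x..norm x}" for x by (metis abs_le_iff atLeastAtMost_iff minus_le_iff)
      then have "blinfun_apply F \<in> P" using F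
        by (simp add: P_def blinfun.add_right blinfun.scaleR_right)
      then show "F \<in> Blinfun ` P" by (metis blinfun_apply_inverse image_eqI)
    qed
  qed
  ultimately show ?thesis by simp
qed

section \<open>Cosets and the weak* topology of the annihilator\<close>

definition coset :: "'a::real_normed_vector set \<Rightarrow> 'a \<Rightarrow> 'a set" where
  "coset Y x = {x + y |y. y \<in> Y}"

lemma quotient_space_coset: "quotient_space Y = range (coset Y)"
  by (simp add: quotient_space_def coset_def)

lemma coset_eval_coset:
  assumes "F \<in> annihilator Y" "subspace Y"
  shows "coset_eval F (coset Y x) = blinfun_apply F x"
proof -
  have "blinfun_apply F ` coset Y x = {blinfun_apply F x}"
  proof
    show "blinfun_apply F ` coset Y x \<subseteq> {blinfun_apply F x}"
      using assms(1) by (auto simp: coset_def annihilator_def blinfun.add_right)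
    have "x \<in> coset Y x" using subspace_0[OF assms(2)] by (force simp: coset_def)
    then show "{blinfun_apply F x} \<subseteq> blinfun_apply F ` coset Y x" by blast
  qed
  then show ?thesis by (simp add: coset_eval_def)
qed

text \<open>Evaluation at a coset is evaluation at any representative, so the identity is continuous
  from the subspace topology of \<open>weak_star\<close> and carries compactness over.\<close>

lemma compactin_annihilator_weak_star:
  assumes C: "compactin weak_star C" "C \<subseteq> annihilator Y" and Y: "subspace Y"
  shows "compactin (annihilator_weak_star Y) C"
proof -
  let ?T = "subtopology weak_star (annihilator Y)"
  have top: "topspace ?T = annihilator Y" by (simp add: strong_operator_topology_topspace)
  have "continuous_map ?T (annihilator_weak_star Y) (\<lambda>F. F)"
    unfolding annihilator_weak_star_def
  proof (rule continuous_map_pullback')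
    show "topspace ?T \<subseteq> (\<lambda>F. F) -` annihilator Y" by (simp add: top)
    show "continuous_map ?T (product_topology (\<lambda>_. euclideanreal) (quotient_space Y))
        ((\<lambda>f. restrict (coset_eval f) (quotient_space Y)) \<circ> (\<lambda>F. F))"
      unfolding continuous_map_componentwise
    proof (intro conjI ballI)
      fix q assume "q \<in> quotient_space Y"
      then obtain x where q: "q = coset Y x" "q \<in> quotient_space Y" by (auto simp: quotient_space_coset)
      have "continuous_map ?T euclideanreal (\<lambda>F. blinfun_apply F x)"
        by (intro continuous_map_from_subtopology strong_operator_topology_continuous_evaluation)
      then show "continuous_map ?T euclideanreal
          (\<lambda>F. ((\<lambda>f. restrict (coset_eval f) (quotient_space Y)) \<circ> (\<lambda>F. F)) F q)"
        by (rule continuous_map_eq) (use q in \<open>auto simp: coset_eval_coset[OF _ Y]\<close>)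
    qed auto
  qed
  then have "compactin (annihilator_weak_star Y) ((\<lambda>F. F) ` C)"
    using C by (intro image_compactin) (auto simp: compactin_subtopology)
  then show ?thesis by simp
qed

section \<open>Isometric copies in a quotient\<close>

context
  fixes Y :: "'a::real_normed_vector set"
  assumes Y: "subspace Y"
begin

lemma in_coset: "x \<in> coset Y x"
  using subspace_0[OF Y] by (force simp: coset_def)

lemma coset_eq_iff: "coset Y x = coset Y x' \<longleftrightarrow> x - x' \<in> Y"
proof
  assume "coset Y x = coset Y x'"
  then have "x \<in> coset Y x'" using in_coset by blast
  then show "x - x' \<in> Y" by (auto simp: coset_def)
next
  assume d: "x - x' \<in> Y"
  show "coset Y x = coset Y x'"
  proof (intro equalityI subsetI)
    fix w assume "w \<in> coset Y x"
    then obtain y where "y \<in> Y" "w = x + y" by (auto simp: coset_def)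
    then have "w = x' + ((x - x') + y)" "(x - x') + y \<in> Y" using d subspace_add[OF Y] by auto
    then show "w \<in> coset Y x'" unfolding coset_def by blast
  next
    fix w assume "w \<in> coset Y x'"
    then obtain y where "y \<in> Y" "w = x' + y" by (auto simp: coset_def)
    then have "w = x + (y - (x - x'))" "y - (x - x') \<in> Y" using d subspace_diff[OF Y] by auto
    then show "w \<in> coset Y x" unfolding coset_def by blast
  qed
qed

lemma coset_subspace: "y \<in> Y \<Longrightarrow> coset Y y = Y"
proof -
  assume "y \<in> Y"
  then have "coset Y y = coset Y 0" by (simp add: coset_eq_iff)
  then show ?thesis by (simp add: coset_def)
qed

lemma quotient_add_coset: "quotient_add (coset Y x) (coset Y x') = coset Y (x + x')"
proof (intro equalityI subsetI)
  fix w assume "w \<in> quotient_add (coset Y x) (coset Y x')"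
  then obtain y y' where "y \<in> Y" "y' \<in> Y" "w = (x + y) + (x' + y')" by (auto simp: quotient_add_def coset_def)
  then have "w = (x + x') + (y + y')" "y + y' \<in> Y" using subspace_add[OF Y] by auto
  then show "w \<in> coset Y (x + x')" unfolding coset_def by blast
next
  fix w assume "w \<in> coset Y (x + x')"
  then obtain y where "y \<in> Y" "w = x + (x' + y)" by (auto simp: coset_def add.assoc)
  moreover have "x' + y \<in> coset Y x'" using \<open>y \<in> Y\<close> by (auto simp: coset_def)
  ultimately show "w \<in> quotient_add (coset Y x) (coset Y x')"
    using in_coset unfolding quotient_add_def by blast
qed

lemma quotient_scale_coset: "quotient_scale Y c (coset Y x) = coset Y (c *\<^sub>R x)"
proof (intro equalityI subsetI)
  fix w assume "w \<in> quotient_scale Y c (coset Y x)"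
  then obtain y y' where "y \<in> Y" "y' \<in> Y" "w = c *\<^sub>R (x + y) + y'" by (auto simp: quotient_scale_def coset_def)
  then have "w = c *\<^sub>R x + (c *\<^sub>R y + y')" "c *\<^sub>R y + y' \<in> Y"
    using subspace_add[OF Y] subspace_scale[OF Y] by (auto simp: scaleR_add_right)
  then show "w \<in> coset Y (c *\<^sub>R x)" unfolding coset_def by blast
next
  fix w assume "w \<in> coset Y (c *\<^sub>R x)"
  then obtain y where "y \<in> Y" "w = c *\<^sub>R x + y" by (auto simp: coset_def)
  then show "w \<in> quotient_scale Y c (coset Y x)" using in_coset unfolding quotient_scale_def by blast
qed

lemma quotient_norm_le: "w \<in> coset Y x \<Longrightarrow> quotient_norm (coset Y x) \<le> norm w"
  unfolding quotient_norm_def by (rule cINF_lower) (auto intro: bdd_belowI[of _ 0])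

text \<open>\<open>F\<close> is constant on the coset, so its norm bound may be minimized over all
  representatives.\<close>

lemma annihilator_quotient_norm:
  assumes "F \<in> annihilator Y"
  shows "\<bar>blinfun_apply F x\<bar> \<le> norm F * quotient_norm (coset Y x)"
proof -
  have le: "\<bar>blinfun_apply F x\<bar> \<le> norm F * norm w" if "w \<in> coset Y x" for w
  proof -
    have "blinfun_apply F w = blinfun_apply F x"
      using that assms by (auto simp: coset_def annihilator_def blinfun.add_right)
    then show ?thesis using norm_blinfun[of F w] by simp
  qed
  show ?thesis
  proof (cases "norm F = 0")
    case True then show ?thesis by (simp add: blinfun.zero_left)
  next
    case False
    then have pos: "norm F > 0" by simp
    have "\<bar>blinfun_apply F x\<bar> / norm F \<le> quotient_norm (coset Y x)"
      unfolding quotient_norm_def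
      using le in_coset pos by (intro cINF_greatest) (auto simp: field_simps)
    then show ?thesis using pos by (simp add: field_simps)
  qed
qed

text \<open>
  \<open>val x\<close> is the affine function corresponding to the coset of \<open>x\<close>, for \<open>x\<close> in the preimage \<open>U\<close> of
  the isometric copy.
\<close>
lemma isometric_copy_lift:
  assumes V: "quotient_subspace Y V" and iso: "linearly_isometric_to_A Y V S"
    and Aadd: "\<And>f g. f \<in> affine_functions S \<Longrightarrow> g \<in> affine_functions S \<Longrightarrow> (\<lambda>s. f s + g s) \<in> affine_functions S"
    and Ascale: "\<And>c f. f \<in> affine_functions S \<Longrightarrow> (\<lambda>s. c * f s) \<in> affine_functions S"
  obtains U and val :: "'a \<Rightarrow> 's::hausdorff_lcs \<Rightarrow> real"
  where "subspace U" "Y \<subseteq> U" "\<And>x. x \<in> U \<Longrightarrow> val x \<in> affine_functions S"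
    "\<And>a. a \<in> affine_functions S \<Longrightarrow> \<exists>x\<in>U. val x = a"
    "\<And>x y. x \<in> U \<Longrightarrow> y \<in> U \<Longrightarrow> val (x + y) = (\<lambda>s. val x s + val y s)"
    "\<And>c x. x \<in> U \<Longrightarrow> val (c *\<^sub>R x) = (\<lambda>s. c * val x s)"
    "\<And>y. y \<in> Y \<Longrightarrow> val y = (\<lambda>s. 0)"
    "\<And>x. x \<in> U \<Longrightarrow> sup_norm_on S (val x) \<le> norm x"
    "\<And>F x. F \<in> annihilator Y \<Longrightarrow> x \<in> U \<Longrightarrow> \<bar>blinfun_apply F x\<bar> \<le> norm F * sup_norm_on S (val x)"
proof -
  obtain J where J: "bij_betw J (affine_functions S) V"
    "\<And>f g. f \<in> affine_functions S \<Longrightarrow> g \<in> affine_functions S \<Longrightarrow>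
        J (\<lambda>x. f x + g x) = quotient_add (J f) (J g)"
    "\<And>c f. f \<in> affine_functions S \<Longrightarrow> J (\<lambda>x. c * f x) = quotient_scale Y c (J f)"
    "\<And>f. f \<in> affine_functions S \<Longrightarrow> quotient_norm (J f) = sup_norm_on S f"
    using iso unfolding linearly_isometric_to_A_def by blast
  define U where "U = {x. coset Y x \<in> V}"
  define val where "val x = the_inv_into (affine_functions S) J (coset Y x)" for x
  have inj: "inj_on J (affine_functions S)" and img: "J ` affine_functions S = V"
    using J(1) by (auto simp: bij_betw_def)
  have valA: "val x \<in> affine_functions S" and Jval: "J (val x) = coset Y x" if "x \<in> U" for x
    using that inj img by (auto simp: U_def val_def the_inv_into_into f_the_inv_into_f)
  have val_eq: "val x = f" if "f \<in> affine_functions S" "J f = coset Y x" for x f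
    using that inj by (simp add: val_def the_inv_into_f_eq)
  have YV: "Y \<in> V" and VV: "V \<subseteq> quotient_space Y" using V by (auto simp: quotient_subspace_def)
  have add: "quotient_add p q \<in> V" if "p \<in> V" "q \<in> V" for p q using V that by (auto simp: quotient_subspace_def)
  have scale: "quotient_scale Y c q \<in> V" if "q \<in> V" for c q using V that by (auto simp: quotient_subspace_def)
  show thesis
  proof
    show YU: "Y \<subseteq> U" using YV by (auto simp: U_def coset_subspace)
    show "subspace U"
      using subspace_0[OF Y] YU add[of "coset Y _" "coset Y _"] scale[of "coset Y _"]
      by (auto simp: subspace_def U_def quotient_add_coset quotient_scale_coset)
    show "val x \<in> affine_functions S" if "x \<in> U" for x using valA[OF that] .
    show "\<exists>x\<in>U. val x = a" if a: "a \<in> affine_functions S" for a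
    proof -
      have "J a \<in> V" using a img by auto
      then obtain x where "J a = coset Y x" using VV by (auto simp: quotient_space_coset)
      then show ?thesis using val_eq[OF a] \<open>J a \<in> V\<close> by (auto simp: U_def)
    qed
    show "val (x + y) = (\<lambda>s. val x s + val y s)" if "x \<in> U" "y \<in> U" for x y
      using that by (intro val_eq Aadd valA) (simp_all add: J(2) valA Jval quotient_add_coset)
    show sc: "val (c *\<^sub>R x) = (\<lambda>s. c * val x s)" if "x \<in> U" for c x
      using that by (intro val_eq Ascale valA) (simp_all add: J(3) valA Jval quotient_scale_coset)
    show "val y = (\<lambda>s. 0)" if y: "y \<in> Y" for y
    proof -
      have "coset Y y = coset Y (0 *\<^sub>R y)" using y by (simp add: coset_eq_iff)
      then have "val y = val (0 *\<^sub>R y)" by (simp add: val_def)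
      then show ?thesis using sc[of y 0] y YU by auto
    qed
    show "sup_norm_on S (val x) \<le> norm x" if "x \<in> U" for x
      using J(4)[OF valA[OF that]] Jval[OF that] quotient_norm_le[OF in_coset, of x] by simp
    show "\<bar>blinfun_apply F x\<bar> \<le> norm F * sup_norm_on S (val x)" if "F \<in> annihilator Y" "x \<in> U" for F x
      using annihilator_quotient_norm[OF that(1), of x] J(4)[OF valA[OF that(2)]] Jval[OF that(2)] by simp
  qed
qed

end

text \<open>A dense set may miss \<open>U\<close>; near each of its points \<open>d\<close>, and for
  each radius, a point of \<open>U\<close> is chosen if there is one.\<close>

lemma separable_dense_sequence:
  fixes U :: "'a::real_normed_vector set"
  assumes sep: "separable_space (euclidean :: 'a topology)" and U: "U \<noteq> {}"
  shows "\<exists>u :: nat \<Rightarrow> 'a. range u \<subseteq> U \<and> (\<forall>x\<in>U. \<forall>e>0. \<exists>k. norm (u k - x) < e)"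
proof -
  obtain D :: "'a set" where D: "countable D" "closure D = UNIV"
    using sep by (auto simp: separable_space_def)
  obtain u0 where u0: "u0 \<in> U" using U by blast
  \<comment> \<open>The default \<open>u0\<close> keeps the value in \<open>U\<close> when the ball
    misses \<open>U\<close>.\<close>
  define p where "p d n = (if U \<inter> ball d (1 / real (Suc n)) = {} then u0 else SOME u. u \<in> U \<inter> ball d (1 / real (Suc n)))" for d n
  have p: "p d n \<in> U" "U \<inter> ball d (1 / real (Suc n)) \<noteq> {} \<Longrightarrow> p d n \<in> ball d (1 / real (Suc n))" for d n
    using u0 some_in_eq[of "U \<inter> ball d (1 / real (Suc n))"] by (auto simp: p_def)
  define P where "P = (\<lambda>(d, n). p d n) ` (D \<times> UNIV)"
  have P: "countable P" "P \<subseteq> U" using D p by (auto simp: P_def)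
  have "D \<noteq> {}" using D(2) by auto
  then have ne: "P \<noteq> {}" by (auto simp: P_def)
  have "\<exists>k. norm (from_nat_into P k - x) < e" if x: "x \<in> U" and e: "e > 0" for x e
  proof -
    obtain n where n: "1 / real (Suc n) < e / 2"
      using reals_Archimedean[of "e / 2"] e by (auto simp: inverse_eq_divide)
    have "x \<in> closure D" using D(2) by simp
    then obtain d where d: "d \<in> D" "dist d x < 1 / real (Suc n)"
      unfolding closure_approachable by (metis of_nat_0_less_iff zero_less_Suc zero_less_divide_1_iff)
    then have "U \<inter> ball d (1 / real (Suc n)) \<noteq> {}" using x by auto
    then have "dist d (p d n) < 1 / real (Suc n)" using p(2) by auto
    then have "norm (p d n - x) < e"
      using dist_triangle_half_l d(2) n dist_triangle[of "p d n" x d]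
      by (simp add: dist_norm[symmetric] dist_commute)
    moreover have "p d n \<in> P" using d(1) by (force simp: P_def)
    moreover obtain k where "from_nat_into P k = p d n"
      using from_nat_into_surj[OF P(1) \<open>p d n \<in> P\<close>] by blast
    ultimately show ?thesis by metis
  qed
  moreover have "range (from_nat_into P) \<subseteq> U" using from_nat_into[OF ne] P(2) by blast
  ultimately show ?thesis by blast
qed

section \<open>The fixed-point-free map\<close>

lemma linear_bounded_to_blinfun:
  fixes g :: "'a::real_normed_vector \<Rightarrow> real"
  assumes g: "linear g" and le: "\<And>x. g x \<le> norm x"
  obtains G where "blinfun_apply G = g" "norm G \<le> 1"
proof -
  have abs: "\<bar>g x\<bar> \<le> norm x" for x using le[of x] le[of "- x"] linear_neg[OF g, of x] by auto
  have "bounded_linear g"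
    by (rule bounded_linear_intro[where K = 1]) (use g abs in \<open>auto simp: linear_add linear_scale\<close>)
  then have app: "blinfun_apply (Blinfun g) = g" by (rule bounded_linear_Blinfun_apply)
  have "norm (Blinfun g) \<le> 1" by (rule norm_blinfun_bound) (auto simp: app abs)
  then show thesis using app that by blast
qed

lemma fixed_point_free_map_exists:
  fixes Y :: "'a::banach set" and S :: "'s::hausdorff_lcs set"
  assumes sep: "separable_space (euclidean :: 'a topology)" and Y: "subspace Y"
    and S: "choquet_simplex S" and inf: "infinite_dimensional (affine_functions S)"
    and V: "quotient_subspace Y V" and iso: "linearly_isometric_to_A Y V S"
  obtains C and T :: "('a \<Rightarrow>\<^sub>L real) \<Rightarrow> ('a \<Rightarrow>\<^sub>L real)"
  where "C \<noteq> {}" "convex C" "compactin weak_star C" "C \<subseteq> annihilator Y"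
    "T \<in> C \<rightarrow> C" "nonexpansive_on C T" "\<And>F. F \<in> C \<Longrightarrow> T F \<noteq> F"
proof -
  interpret compact_convex S by standard (use S in \<open>auto simp: choquet_simplex_def\<close>)
  have S_ne: "S \<noteq> {}"
  proof
    assume "S = {}"
    then have "\<not> infinite_dimensional A"
      by (intro determined_by_finite_imp_not_infinite_dimensional[of "{}"])
        (auto simp: affine_functions_def)
    then show False using inf by simp
  qed
  obtain U and val :: "'a \<Rightarrow> 's \<Rightarrow> real" where U: "subspace U" "Y \<subseteq> U"
    and valA: "\<And>x. x \<in> U \<Longrightarrow> val x \<in> A"
    and val_surj: "\<And>a. a \<in> A \<Longrightarrow> \<exists>x\<in>U. val x = a"
    and val_add: "\<And>x y. x \<in> U \<Longrightarrow> y \<in> U \<Longrightarrow> val (x + y) = (\<lambda>s. val x s + val y s)"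
    and val_scale: "\<And>c x. x \<in> U \<Longrightarrow> val (c *\<^sub>R x) = (\<lambda>s. c * val x s)"
    and val_Y: "\<And>y. y \<in> Y \<Longrightarrow> val y = (\<lambda>s. 0)"
    and val_norm: "\<And>x. x \<in> U \<Longrightarrow> sup_norm_on S (val x) \<le> norm x"
    and ann_le: "\<And>F x. F \<in> annihilator Y \<Longrightarrow> x \<in> U \<Longrightarrow> \<bar>blinfun_apply F x\<bar> \<le> norm F * sup_norm_on S (val x)"
    using isometric_copy_lift[OF Y V iso A_add A_scale] by blast
  have val_diff: "val (x - y) = (\<lambda>s. val x s - val y s)" if "x \<in> U" "y \<in> U" for x y
    using val_add[OF that(1) subspace_scale[OF U(1) that(2), of "- 1"]] val_scale[OF that(2), of "- 1"] by simp
  have val_le: "\<bar>val x s\<bar> \<le> norm x" if "x \<in> U" "s \<in> S" for x s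
    using abs_le_sup_norm[OF valA[OF that(1)] that(2)] val_norm[OF that(1)] by simp
  have U_ne: "U \<noteq> {}" using subspace_0[OF U(1)] by blast
  obtain u :: "nat \<Rightarrow> 'a" where u: "range u \<subseteq> U" "\<And>x e. x \<in> U \<Longrightarrow> e > 0 \<Longrightarrow> \<exists>k. norm (u k - x) < e"
    using separable_dense_sequence[OF sep U_ne] by blast
  have uU: "u k \<in> U" for k using u(1) by blast
  interpret separable_simplex S "\<lambda>k. val (u k)"
  proof
    show "val (u k) \<in> A" for k by (rule valA[OF uU])
    show "\<exists>k. \<forall>s\<in>S. \<bar>val (u k) s - a s\<bar> < e" if a: "a \<in> A" and e: "e > 0" for a e
    proof -
      obtain x where x: "x \<in> U" "val x = a" using val_surj[OF a] by blast
      obtain k where k: "norm (u k - x) < e" using u(2)[OF x(1) e] by blast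
      have "\<bar>val (u k) s - a s\<bar> < e" if "s \<in> S" for s
        using val_le[OF subspace_diff[OF U(1) uU x(1)] that, of k] k by (simp add: val_diff[OF uU x(1)] x(2))
      then show ?thesis by blast
    qed
    show "S \<noteq> {}" by (rule S_ne)
    show "choquet_simplex S" by (rule S)
  qed
  obtain e Q where e: "\<And>n. e n \<in> S" and Q0: "\<And>n s. 0 \<le> Q n s"
    and Q1: "\<And>s. s \<in> S \<Longrightarrow> (\<lambda>n. Q n s) sums 1" and Qe: "\<And>n. Q n (e n) = 1"
    and Q_join: "\<And>n x y t. x \<in> S \<Longrightarrow> y \<in> S \<Longrightarrow> 0 \<le> t \<Longrightarrow> t \<le> 1 \<Longrightarrow>
      Q n (t *\<^sub>R x + (1 - t) *\<^sub>R y) = t * Q n x + (1 - t) * Q n y"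
    and Q_diff: "\<And>x x' N. x \<in> S \<Longrightarrow> x' \<in> S \<Longrightarrow> N \<ge> 0 \<Longrightarrow>
      (\<And>a. a \<in> A \<Longrightarrow> \<bar>a x - a x'\<bar> \<le> N * sup_norm_on S a) \<Longrightarrow>
      summable (\<lambda>n. \<bar>Q n x - Q n x'\<bar>) \<and> (\<Sum>n. \<bar>Q n x - Q n x'\<bar>) \<le> N"
    by (rule l1_coordinates_exist[OF inf]) blast
  obtain x1 where x1: "x1 \<in> U" "val x1 = (\<lambda>s. if s \<in> S then 1 else 0)" using val_surj[OF A_const] by blast
  have sup_le: "sup_norm_on S (val x) \<le> c" if "\<And>s. s \<in> S \<Longrightarrow> \<bar>val x s\<bar> \<le> c" for x c
    using S_ne that by (rule sup_norm_le)
  \<comment> \<open>\<open>x1\<close> represents the constant 1. Norm at most 1 together with value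
    1 at \<open>x1\<close> is what makes the restriction to \<open>U\<close> an evaluation at a
    point of \<open>S\<close>, and in this form \<open>C\<close> is a slice of the dual
    ball.\<close>
  define C where "C = {F :: 'a \<Rightarrow>\<^sub>L real. norm F \<le> 1 \<and> blinfun_apply F x1 = 1 \<and> (\<forall>y\<in>Y. blinfun_apply F y = 0)}"
  have C_ann: "C \<subseteq> annihilator Y" by (auto simp: C_def annihilator_def)

  have "\<exists>s\<in>S. \<forall>x\<in>U. blinfun_apply F x = val x s" if F: "F \<in> C" for F
  proof -
    have ann: "F \<in> annihilator Y" using F C_ann by blast
    have nF: "norm F \<le> 1" and Fx1: "blinfun_apply F x1 = 1" using F by (auto simp: C_def)
    \<comment> \<open>The choice of the preimage is immaterial: two preimages differ by an element
      whose affine function is zero, and \<open>F\<close> vanishes there by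
      \<open>ann_le\<close>.\<close>
    define L where "L a = blinfun_apply F (SOME x. x \<in> U \<and> val x = a)" for a
    have L: "L (val x) = blinfun_apply F x" if x: "x \<in> U" for x
    proof -
      define x' where "x' = (SOME x'. x' \<in> U \<and> val x' = val x)"
      have x': "x' \<in> U" "val x' = val x"
        unfolding x'_def using someI[of "\<lambda>x'. x' \<in> U \<and> val x' = val x" x] x by auto
      have "sup_norm_on S (val (x' - x)) \<le> 0"
        by (rule sup_le) (simp add: val_diff[OF x'(1) x] x'(2))
      then have "norm F * sup_norm_on S (val (x' - x)) \<le> 0" by (rule mult_nonneg_nonpos[OF norm_ge_zero])
      then have "\<bar>blinfun_apply F (x' - x)\<bar> \<le> 0"
        using ann_le[OF ann subspace_diff[OF U(1) x'(1) x]] by linarith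
      then show ?thesis by (simp add: L_def x'_def[symmetric] blinfun.diff_right)
    qed
    have "\<exists>s\<in>S. \<forall>a\<in>A. a s = L a"
    proof (rule state_is_evaluation)
      fix a b assume "a \<in> A" "b \<in> A"
      then obtain x y where xy: "x \<in> U" "val x = a" "y \<in> U" "val y = b" using val_surj by metis
      have "L (val (x + y)) = L (val x) + L (val y)"
        unfolding L[OF xy(1)] L[OF xy(3)] L[OF subspace_add[OF U(1) xy(1,3)]] by (rule blinfun.add_right)
      then show "L (\<lambda>s. a s + b s) = L a + L b" using xy by (simp add: val_add)
    next
      fix c a assume "a \<in> A"
      then obtain x where x: "x \<in> U" "val x = a" using val_surj by metis
      have "L (val (c *\<^sub>R x)) = c * L (val x)"
        unfolding L[OF x(1)] L[OF subspace_scale[OF U(1) x(1)]] by (simp add: blinfun.scaleR_right)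
      then show "L (\<lambda>s. c * a s) = c * L a" using x by (simp add: val_scale)
    next
      fix a assume a: "a \<in> A"
      obtain x where x: "x \<in> U" "val x = a" using val_surj[OF a] by blast
      obtain z where z: "z \<in> S" "\<And>s. s \<in> S \<Longrightarrow> a s \<le> a z"
        using continuous_attains_sup[OF S_compact S_ne A_cont[OF a]] by blast
      \<comment> \<open>Adding the norm makes the function nonnegative on \<open>S\<close>, so its
        norm is at most \<open>a z + c\<close>; contractivity of \<open>F\<close> then gives
        \<open>L a \<le> a z\<close>.\<close>
      define c where "c = sup_norm_on S a"
      have xc: "x + c *\<^sub>R x1 \<in> U" by (intro subspace_add subspace_scale U x1 x)
      have vc: "val (x + c *\<^sub>R x1) s = a s + c" if "s \<in> S" for s
        using x x1 that subspace_scale[OF U(1) x1(1)] by (simp add: val_add val_scale)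
      have "sup_norm_on S (val (x + c *\<^sub>R x1)) \<le> a z + c"
      proof (rule sup_le)
        fix s assume s: "s \<in> S"
        show "\<bar>val (x + c *\<^sub>R x1) s\<bar> \<le> a z + c"
          unfolding vc[OF s] using abs_le_sup_norm[OF a s] z(2)[OF s] by (auto simp: c_def abs_le_iff)
      qed
      moreover have "norm F * sup_norm_on S (val (x + c *\<^sub>R x1)) \<le> 1 * sup_norm_on S (val (x + c *\<^sub>R x1))"
        using nF abs_le_sup_norm[OF valA[OF xc] z(1)] by (intro mult_right_mono) auto
      moreover have "blinfun_apply F (x + c *\<^sub>R x1) = L a + c"
        using L[OF x(1)] x(2) Fx1 by (simp add: blinfun.add_right blinfun.scaleR_right)
      ultimately have "L a \<le> a z" using ann_le[OF ann xc] by linarith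
      then show "\<exists>s\<in>S. L a \<le> a s" using z(1) by blast
    qed
    then obtain s where "s \<in> S" "\<forall>a\<in>A. a s = L a" by blast
    then show ?thesis using valA L by (intro bexI[of _ s]) auto
  qed
  then obtain r where rS: "\<And>F. F \<in> C \<Longrightarrow> r F \<in> S"
    and r: "\<And>F x. F \<in> C \<Longrightarrow> x \<in> U \<Longrightarrow> blinfun_apply F x = val x (r F)"
    by metis

  have "\<exists>G. G \<in> C \<and> (\<forall>x\<in>U. blinfun_apply G x = val x (e n))" for n
  proof -
    obtain g where g: "linear g" "\<And>x. x \<in> U \<Longrightarrow> g x = val x (e n)" "\<And>x. g x \<le> norm x"
    proof (rule hahn_banach[of norm U "\<lambda>x. val x (e n)"])
      show "sublinear (norm :: 'a \<Rightarrow> real)" by (simp add: sublinear_def norm_triangle_ineq)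
      show "val x (e n) \<le> norm x" if "x \<in> U" for x using val_le[OF that e[of n]] by simp
    qed (use U val_add val_scale in auto)
    obtain G where G: "blinfun_apply G = g" "norm G \<le> 1" using linear_bounded_to_blinfun[OF g(1,3)] by blast
    have "blinfun_apply G x1 = 1" using g(2)[OF x1(1)] x1(2) e by (simp add: G)
    moreover have "blinfun_apply G y = 0" if "y \<in> Y" for y using g(2)[of y] U(2) val_Y[OF that] that by (auto simp: G)
    ultimately show ?thesis using G g(2) by (intro exI[of _ G]) (auto simp: C_def)
  qed
  then obtain E where EC: "\<And>n. E n \<in> C" and E: "\<And>n x. x \<in> U \<Longrightarrow> blinfun_apply (E n) x = val x (e n)" by metis

  have nE: "norm (E n) \<le> 1" for n using EC[of n] by (simp add: C_def)
  have summ: "summable (\<lambda>i. q i *\<^sub>R E (Suc i))" and nsum: "norm (\<Sum>i. q i *\<^sub>R E (Suc i)) \<le> (\<Sum>i. \<bar>q i\<bar>)"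
    if q: "summable (\<lambda>i. \<bar>q i\<bar>)" for q
  proof -
    have le: "norm (q i *\<^sub>R E (Suc i)) \<le> \<bar>q i\<bar>" for i using mult_left_mono[OF nE[of "Suc i"], of "\<bar>q i\<bar>"] by simp
    have s: "summable (\<lambda>i. norm (q i *\<^sub>R E (Suc i)))"
      by (rule summable_comparison_test'[OF q, of 0]) (use le in auto)
    then show "summable (\<lambda>i. q i *\<^sub>R E (Suc i))" by (rule summable_norm_cancel)
    show "norm (\<Sum>i. q i *\<^sub>R E (Suc i)) \<le> (\<Sum>i. \<bar>q i\<bar>)"
      using summable_norm[OF s] suminf_le[OF le s q] by linarith
  qed
  have app: "blinfun_apply (\<Sum>i. q i *\<^sub>R E (Suc i)) x = (\<Sum>i. q i * blinfun_apply (E (Suc i)) x)"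
    if q: "summable (\<lambda>i. \<bar>q i\<bar>)" for q x
    using bounded_linear.suminf[OF blinfun.bounded_linear_left summ[OF q], of x] by (simp add: blinfun.scaleR_left)
  \<comment> \<open>It is used with total mass 1 for \<open>T F\<close>, and with mass
    \<open>1 - c\<close> for the remainder after one summand has been split off.\<close>
  have combo: "norm (\<Sum>i. q i *\<^sub>R E (Suc i)) \<le> c" "blinfun_apply (\<Sum>i. q i *\<^sub>R E (Suc i)) x1 = c"
      "y \<in> Y \<Longrightarrow> blinfun_apply (\<Sum>i. q i *\<^sub>R E (Suc i)) y = 0"
    if q: "\<And>i. 0 \<le> q i" "q sums c" for q c y
  proof -
    have abs: "(\<lambda>i. \<bar>q i\<bar>) = q" using q(1) by auto
    have s: "summable (\<lambda>i. \<bar>q i\<bar>)" unfolding abs using q(2) by (rule sums_summable)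
    show "norm (\<Sum>i. q i *\<^sub>R E (Suc i)) \<le> c" using nsum[OF s] sums_unique[OF q(2)] by (simp add: abs)
    show "blinfun_apply (\<Sum>i. q i *\<^sub>R E (Suc i)) x1 = c"
      using app[OF s, of x1] EC sums_unique[OF q(2)] by (simp add: C_def)
    show "blinfun_apply (\<Sum>i. q i *\<^sub>R E (Suc i)) y = 0" if "y \<in> Y"
      using app[OF s, of y] EC that by (simp add: C_def)
  qed
  define T where "T F = (\<Sum>k. Q k (r F) *\<^sub>R E (Suc k))" for F
  have TC: "T F \<in> C" if F: "F \<in> C" for F
    using combo[of "\<lambda>k. Q k (r F)" 1] Q0 Q1[OF rS[OF F]] by (simp add: C_def T_def)
  have absQ: "summable (\<lambda>k. \<bar>Q k s\<bar>)" if "s \<in> S" for s using Q0 sums_summable[OF Q1[OF that]] by simp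
  have nonexp: "norm (T F - T F') \<le> norm (F - F')" if F: "F \<in> C" "F' \<in> C" for F F'
  proof -
    have "summable (\<lambda>n. \<bar>Q n (r F) - Q n (r F')\<bar>) \<and> (\<Sum>n. \<bar>Q n (r F) - Q n (r F')\<bar>) \<le> norm (F - F')"
    proof (rule Q_diff)
      fix a assume "a \<in> A"
      then obtain x where x: "x \<in> U" "val x = a" using val_surj by blast
      have "F - F' \<in> annihilator Y" using F C_ann by (auto simp: annihilator_def C_def blinfun.diff_left)
      from ann_le[OF this x(1)] show "\<bar>a (r F) - a (r F')\<bar> \<le> norm (F - F') * sup_norm_on S a"
        using r[OF F(1) x(1)] r[OF F(2) x(1)] x(2) by (simp add: blinfun.diff_left)
    qed (use rS F in auto)
    moreover have "T F - T F' = (\<Sum>k. (Q k (r F) - Q k (r F')) *\<^sub>R E (Suc k))"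
      unfolding T_def using suminf_diff[OF summ[OF absQ[OF rS[OF F(1)]]] summ[OF absQ[OF rS[OF F(2)]]]]
      by (simp add: scaleR_diff_left)
    ultimately show ?thesis using nsum[of "\<lambda>k. Q k (r F) - Q k (r F')"] by simp
  qed
  have nofix: "T F \<noteq> F" if F: "F \<in> C" for F
  proof
    assume TF: "T F = F"
    define s where "s = r F"
    have s: "s \<in> S" unfolding s_def by (rule rS[OF F])
    have step: "Q k s \<le> Q (Suc k) s" for k
    proof -
      define c where "c = Q k s"
      \<comment> \<open>The term with index \<open>k\<close> is removed, so that \<open>F\<close>
        becomes \<open>c\<close> times \<open>E (Suc k)\<close> plus a remainder \<open>G\<close> of
        mass \<open>1 - c\<close>.\<close>
      define q where "q i = (if i = k then 0 else Q i s)" for i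
      have "(\<lambda>i. Q i s - (if i = k then Q i s else 0)) sums (1 - Q k s)"
        by (intro sums_diff Q1 s sums_single)
      moreover have "(\<lambda>i. Q i s - (if i = k then Q i s else 0)) = q" by (auto simp: q_def)
      ultimately have q: "q sums (1 - c)" "\<And>i. 0 \<le> q i" by (auto simp: c_def q_def Q0)
      have c: "0 \<le> c" "c \<le> 1" using Q0 sums_le[OF _ sums_zero q(1)] q(2) by (auto simp: c_def)
      have sq: "summable (\<lambda>i. \<bar>q i\<bar>)" using q(2) sums_summable[OF q(1)] by simp
      define G where "G = (\<Sum>i. q i *\<^sub>R E (Suc i))"
      have "F - G = (\<Sum>i. (Q i s - q i) *\<^sub>R E (Suc i))"
        unfolding G_def TF[symmetric, unfolded T_def, folded s_def]
        using suminf_diff[OF summ[OF absQ[OF s]] summ[OF sq]]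
        by (simp add: scaleR_diff_left TF[unfolded T_def, folded s_def])
      also have "(\<lambda>i. (Q i s - q i) *\<^sub>R E (Suc i)) = (\<lambda>i. if i = k then c *\<^sub>R E (Suc i) else 0)"
        by (auto simp: q_def c_def)
      also have "suminf \<dots> = c *\<^sub>R E (Suc k)" using sums_unique[OF sums_single] by metis
      finally have FG: "F = c *\<^sub>R E (Suc k) + G" by (simp add: algebra_simps)
      have G: "norm G \<le> 1 - c" "blinfun_apply G x1 = 1 - c" "\<And>y. y \<in> Y \<Longrightarrow> blinfun_apply G y = 0"
        unfolding G_def using combo[OF q(2,1)] by auto
      \<comment> \<open>After normalization the remainder lies in \<open>C\<close> and is thus an
        evaluation at some \<open>w\<close> on \<open>U\<close>. If \<open>c = 1\<close> the
        remainder vanishes and any point serves, here \<open>s\<close>.\<close>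
      obtain w where w: "w \<in> S" "\<And>x. x \<in> U \<Longrightarrow> blinfun_apply G x = (1 - c) * val x w"
      proof (cases "c = 1")
        case True
        then have "G = 0" using G(1) by simp
        then show thesis using that[OF s] True by (simp add: blinfun.zero_left)
      next
        case False
        then have c1: "1 - c > 0" using c by simp
        define H where "H = (1 / (1 - c)) *\<^sub>R G"
        have HC: "H \<in> C"
          using G c1 by (auto simp: H_def C_def blinfun.scaleR_left divide_le_eq_1)
        have "blinfun_apply G x = (1 - c) * val x (r H)" if "x \<in> U" for x
          using r[OF HC that] c1 by (simp add: H_def blinfun.scaleR_left field_simps)
        then show thesis using that rS[OF HC] by blast
      qed
      have "s = c *\<^sub>R e (Suc k) + (1 - c) *\<^sub>R w"
      proof (rule A_eq_imp_eq[OF s])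
        show "c *\<^sub>R e (Suc k) + (1 - c) *\<^sub>R w \<in> S"
          using S_convex e w c by (simp add: convex_def)
        fix a assume a: "a \<in> A"
        obtain x where x: "x \<in> U" "val x = a" using val_surj[OF a] by blast
        have "a s = c * a (e (Suc k)) + (1 - c) * a w"
          using r[OF F x(1)] E[OF x(1), of "Suc k"] w(2)[OF x(1)] x(2) arg_cong[OF FG, of "\<lambda>G. blinfun_apply G x"]
          by (simp add: s_def blinfun.add_left blinfun.scaleR_left)
        then show "a s = a (c *\<^sub>R e (Suc k) + (1 - c) *\<^sub>R w)"
          using A_affine[OF a e w(1), of c "1 - c"] c by simp
      qed
      \<comment> \<open>The point \<open>e (Suc k)\<close> has coordinate 1 at index
        \<open>Suc k\<close>, so the mass \<open>c = Q k s\<close> reappears there, and the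
        contribution of \<open>w\<close> is nonnegative.\<close>
      then have "Q (Suc k) s = c * 1 + (1 - c) * Q (Suc k) w"
        using Q_join[OF e w(1) c, of "Suc k" "Suc k"] Qe by simp
      then show ?thesis using c Q0[of "Suc k" w] mult_nonneg_nonneg[of "1 - c" "Q (Suc k) w"] by (simp add: c_def)
    qed
    have mono: "Q k s \<le> Q n s" if "k \<le> n" for k n
      using step that by (rule lift_Suc_mono_le)
    have "(\<lambda>n. Q n s) \<longlonglongrightarrow> 0" using sums_summable[OF Q1[OF s]] by (rule summable_LIMSEQ_zero)
    then have "Q k s \<le> 0" for k using mono by (intro LIMSEQ_le_const) auto
    then have "Q k s = 0" for k using Q0 by (simp add: order_antisym)
    then show False using Q1[OF s] sums_unique2[of "\<lambda>_. 0 :: real" 1 0] by simp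
  qed
  show thesis
  proof
    show "C \<noteq> {}" using EC by blast
    show "convex C"
    proof (rule convexI)
      fix F G and p q :: real assume FG: "F \<in> C" "G \<in> C" and pq: "0 \<le> p" "0 \<le> q" "p + q = 1"
      have "norm (p *\<^sub>R F + q *\<^sub>R G) \<le> p * norm F + q * norm G"
        using norm_triangle_ineq[of "p *\<^sub>R F" "q *\<^sub>R G"] pq by simp
      also have "\<dots> \<le> p * 1 + q * 1" using FG pq by (intro add_mono mult_left_mono) (auto simp: C_def)
      finally show "p *\<^sub>R F + q *\<^sub>R G \<in> C"
        using FG pq by (simp add: C_def blinfun.add_left blinfun.scaleR_left)
    qed
    show "compactin weak_star C" unfolding C_def by (rule compactin_weak_star_slice)
    show "C \<subseteq> annihilator Y" by (rule C_ann)
    show "T \<in> C \<rightarrow> C" using TC by auto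
    show "nonexpansive_on C T" using nonexp by (auto simp: nonexpansive_on_def)
    show "T F \<noteq> F" if "F \<in> C" for F using nofix[OF that] .
  qed
qed

text \<open>One set and one map refute both properties: \<open>C\<close> lies in the annihilator and
  is compact in both topologies.\<close>

theorem mainTheorem2:
  fixes Y :: "'a::banach set"
  assumes "separable_space (euclidean :: 'a topology)"
    and "subspace Y" and "closed Y"
    and "\<exists>S :: 's::hausdorff_lcs set. choquet_simplex S \<and>
           infinite_dimensional (affine_functions S) \<and>
           (\<exists>V. quotient_subspace Y V \<and> linearly_isometric_to_A Y V S)"
  shows "\<not> has_FPP (annihilator_weak_star Y) \<and> \<not> has_FPP (weak_star :: ('a \<Rightarrow>\<^sub>L real) topology)"
proof -
  obtain S :: "'s set" and V where "choquet_simplex S" "infinite_dimensional (affine_functions S)"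
    "quotient_subspace Y V" "linearly_isometric_to_A Y V S" using assms(4) by blast
  from fixed_point_free_map_exists[OF assms(1,2) this]
  obtain C and T :: "('a \<Rightarrow>\<^sub>L real) \<Rightarrow> ('a \<Rightarrow>\<^sub>L real)" where
    "C \<noteq> {}" "convex C" "compactin weak_star C" "C \<subseteq> annihilator Y"
    "T \<in> C \<rightarrow> C" "nonexpansive_on C T" "\<And>F. F \<in> C \<Longrightarrow> T F \<noteq> F" by blast
  then show ?thesis
    using compactin_annihilator_weak_star[OF _ _ assms(2), of C] unfolding has_FPP_def by blast
qed

end
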